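(* Consider the polling model with parameter regeneration described in the context, with arrival rates $\lambda_0,\dots,\lambda_d>0$ and regime distributions $\nu_0,\dots,\nu_d$ on $\mathcal M$ satisfying Condition E, and assume that the random matrix $A$ is not almost surely equal to a deterministic matrix. Suppose that there exist parameters $(\mu,\gamma)_n\in\operatorname{supp}\nu_n$, $n=0,\dots,d$, such that the homogeneous model, i.e. the polling model with the same arrival rates in which each $\nu_n$ is replaced by the point mass at $(\mu,\gamma)_n$, is transient. Then $s_0<\infty$.
   Context: **Model.** Fix $d\ge 1$ and stations indexed by $\mathbb Z_{d+1}=\{0,\dots,d\}$; write $[k]:=k \bmod (d+1)$. Customers arrive at station $n$ according to a Poisson process of rate $\lambda_n>0$, independently of everything else; each station has an infinite capacity queue. A single server visits the stations in cyclic order $0\to1\to\cdots\to d\to0\to\cdots$. Service is exhaustive: the server stays at a station until its queue is empty, then instantly moves to the next station (instantly passing over empty stations). Let $$\mathcal M=\Big\{(\mu,\gamma)=(\mu,\gamma_1,\dots,\gamma_d):\ \mu>0,\ \gamma_i\ge0\ \forall i,\ \sum_{j=1}^d\gamma_j\le1\Big\}\subset\mathbb R^{d+1},$$ and let $\nu_0,\dots,\nu_d$ be probability measures on $\mathcal M$. Each time the server comes to station $n$, a regime $(\mu,\gamma)\in\mathcal M$ is chosen according to $\nu_n$, independently of everything else, and is used during the whole stay of the server at that station: service times are i.i.d. exponential with parameter $\mu$, and each served customer, independently, goes to station $[n+k]$ with probability $\gamma_k$ ($k=1,\dots,d$) or leaves the system with probability $1-\gamma_1-\cdots-\gamma_d$.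 When there are no customers in the system the server waits at a special place (and jumps instantly to the station where the first new customer arrives). Starting from a fixed nonempty configuration with the server at station $0$, let $\tau$ be the first time at which there are no customers in the system; the model is called transient if $\mathbb P[\tau=\infty]>0$. **Condition E.** (i) There is $\varepsilon_0>0$ with $\nu_n[(\mu,\gamma):\mu>\lambda_n+\varepsilon_0]=1$ for all $n=0,\dots,d$. (ii) There is $M_0$ with $\nu_n[(\mu,\gamma):\mu\le M_0]=1$ for all $n=0,\dots,d$. **Random matrices.** For $n\in\{0,\dots,d\}$ let $A^{(n)}=(a^{(n)}_{i,j})_{i,j=0,\dots,d-1}$ be the random $d\times d$ matrix with first column $a^{(n)}_{k,0}=\dfrac{\lambda_{[n+k+1]}+\gamma_{k+1}\mu}{\mu-\lambda_n}$, $k=0,\dots,d-1$, with $a^{(n)}_{k,k+1}=1$ for $k=0,\dots,d-2$, and all other entries $0$, where $(\mu,\gamma)\sim\nu_n$. Let $A=A^{(d)}\cdots A^{(0)}$ with $A^{(0)},\dots,A^{(d)}$ independent. **The parameter $s_0$.** Let $A_1,A_2,\dots$ be i.i.d. copies of $A$, let $\|\cdot\|$ be the $\mathcal L_1$-norm, and for $s\ge0$ let $$\mathsf k(s)=\lim_{n\to\infty}\big(\mathbb E\|A_n\cdots A_1\|^s\big)^{1/n}$$ (the limit exists and is finite under Condition E). Then $s_0=\inf\{s>0:\mathsf k(s)>1\}$, with $\inf\varnothing=+\infty$. The paper uses "absence of geometric ergodicity" to mean $s_0<\infty$. *)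

theory Defs
  imports "HOL-Probability.Probability" "Jordan_Normal_Form.Matrix"
begin

section \<open>Regimes\<close>

text \<open>
  A regime is a pair \<open>(\<mu>, \<gamma>)\<close>. The vector \<open>(\<gamma>\<^sub>1, \<dots>, \<gamma>\<^sub>d)\<close> is a function on
  \<open>nat\<close> vanishing outside \<open>{1..d}\<close>. With the product topology on \<open>nat \<Rightarrow> real\<close>, the set
  \<open>regimes d\<close> is homeomorphic, via the coordinates \<open>1, \<dots>, d\<close>, to the corresponding subset of
  Euclidean space of dimension \<open>d + 1\<close>.
\<close>

type_synonym regime = "real \<times> (nat \<Rightarrow> real)"

definition regimes :: "nat \<Rightarrow> regime set" where
  "regimes d = {(\<mu>, \<gamma>). 0 < \<mu> \<and> (\<forall>i\<in>{1..d}. 0 \<le> \<gamma> i) \<and> (\<forall>i. i \<notin> {1..d} \<longrightarrow> \<gamma> i = 0) \<and>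
     (\<Sum>j=1..d. \<gamma> j) \<le> 1}"

definition regime_law :: "nat \<Rightarrow> regime measure \<Rightarrow> bool" where
  "regime_law d \<nu> \<longleftrightarrow> prob_space \<nu> \<and> sets \<nu> = sets borel \<and> (AE q in \<nu>. q \<in> regimes d)"

definition regime_support :: "nat \<Rightarrow> regime measure \<Rightarrow> regime set" where
  "regime_support d \<nu> = {q \<in> regimes d. \<forall>U. open U \<longrightarrow> q \<in> U \<longrightarrow> 0 < emeasure \<nu> U}"

definition condition_E :: "nat \<Rightarrow> (nat \<Rightarrow> real) \<Rightarrow> (nat \<Rightarrow> regime measure) \<Rightarrow> bool" where
  "condition_E d lam \<nu> \<longleftrightarrow>
     (\<exists>\<epsilon>\<^sub>0>0. \<forall>n\<le>d. AE q in \<nu> n. fst q > lam n + \<epsilon>\<^sub>0) \<and>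
     (\<exists>M\<^sub>0. \<forall>n\<le>d. AE q in \<nu> n. fst q \<le> M\<^sub>0)"


section \<open>The polling process\<close>

text \<open>
  The process is built on a product space from independent families: interarrival times
  \<open>a m i\<close> at station \<open>m\<close> (exponential with rate \<open>lam m\<close>, so that arrivals at \<open>m\<close> form a Poisson
  process), service requirements \<open>e j\<close> (exponential with rate 1; the \<open>j\<close>-th service takes time
  \<open>e j / \<mu>\<close>, which is exponential with parameter \<open>\<mu>\<close>), uniform variables \<open>u j\<close> which route the
  \<open>j\<close>-th served customer, and regimes \<open>r v\<close>. Here \<open>v = 0, 1, 2, \<dots>\<close> numbers the successive visits
  of the server, visit \<open>v\<close> being to station \<open>v mod (d + 1)\<close>; visits to empty stations have
  duration zero, and the regime drawn for them is not used.
\<close>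

definition exponential_law :: "real \<Rightarrow> real measure" where
  "exponential_law l = density lborel (exponential_density l)"

definition polling_space :: "nat \<Rightarrow> (nat \<Rightarrow> real) \<Rightarrow> (nat \<Rightarrow> regime measure) \<Rightarrow>
    ((nat \<Rightarrow> nat \<Rightarrow> real) \<times> (nat \<Rightarrow> real) \<times> (nat \<Rightarrow> real) \<times> (nat \<Rightarrow> regime)) measure" where
  "polling_space d lam \<nu> =
     (\<Pi>\<^sub>M m\<in>{0..d}. \<Pi>\<^sub>M i\<in>UNIV. exponential_law (lam m)) \<Otimes>\<^sub>M
     ((\<Pi>\<^sub>M j\<in>UNIV. exponential_law 1) \<Otimes>\<^sub>M
     ((\<Pi>\<^sub>M j\<in>UNIV. uniform_measure lborel {0..<1}) \<Otimes>\<^sub>M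
     (\<Pi>\<^sub>M v\<in>UNIV. \<nu> (v mod (d + 1)))))"

text \<open>The number of arrivals in \<open>[0, t]\<close>, for given interarrival times.\<close>

definition arrivals :: "(nat \<Rightarrow> real) \<Rightarrow> real \<Rightarrow> nat" where
  "arrivals b t = card {i. (\<Sum>l\<le>i. b l) \<le> t}"

text \<open>
  For \<open>u\<close> uniform on \<open>[0, 1)\<close>, a customer served at station \<open>n\<close> goes to station
  \<open>(n + k) mod (d + 1)\<close> with probability \<open>\<gamma> k\<close>, and leaves with the remaining probability.
\<close>

definition route :: "nat \<Rightarrow> nat \<Rightarrow> (nat \<Rightarrow> real) \<Rightarrow> real \<Rightarrow> nat option" where
  "route d n \<gamma> u =
     (if u < (\<Sum>k=1..d. \<gamma> k) then Some ((n + (LEAST k. u < (\<Sum>i=1..k. \<gamma> i))) mod (d + 1))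
      else None)"

definition no_customers :: "nat \<Rightarrow> (nat \<Rightarrow> nat) \<Rightarrow> bool" where
  "no_customers d x \<longleftrightarrow> (\<forall>m\<le>d. x m = 0)"

text \<open>
  The visit during which the next service takes place, for queue lengths \<open>x\<close> (not all zero) when
  the current visit is \<open>v\<close>: it is \<open>v\<close> itself as long as the current queue is nonempty.
\<close>

definition serving_visit :: "nat \<Rightarrow> (nat \<Rightarrow> nat) \<Rightarrow> nat \<Rightarrow> nat" where
  "serving_visit d x v = (LEAST w. v \<le> w \<and> 0 < x (w mod (d + 1)))"

text \<open>
  The triple (time, current visit, queue lengths) right after the first \<open>j\<close> services, the
  customer in service being counted in the queue. It is frozen once the system is empty.
\<close>

primrec polling_state :: "nat \<Rightarrow> (nat \<Rightarrow> nat) \<Rightarrow> (nat \<Rightarrow> nat \<Rightarrow> real) \<Rightarrow> (nat \<Rightarrow> real) \<Rightarrow>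
    (nat \<Rightarrow> real) \<Rightarrow> (nat \<Rightarrow> regime) \<Rightarrow> nat \<Rightarrow> real \<times> nat \<times> (nat \<Rightarrow> nat)" where
  "polling_state d x\<^sub>0 a e u r 0 = (0, serving_visit d x\<^sub>0 0, x\<^sub>0)"
| "polling_state d x\<^sub>0 a e u r (Suc j) =
     (let (t, v, x) = polling_state d x\<^sub>0 a e u r j;
          (\<mu>, \<gamma>) = r v;
          n = v mod (d + 1);
          t' = t + e j / \<mu>;
          x' = (\<lambda>m. if m \<le> d
                 then x m + (arrivals (a m) t' - arrivals (a m) t)
                      - (if m = n then 1 else 0)
                      + (if route d n \<gamma> (u j) = Some m then 1 else 0)
                 else 0)
      in if no_customers d x then (t, v, x) else (t', serving_visit d x' v, x'))"

text \<open>
  The first time at which the system is empty. The system can only become empty at the end of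
  a service, because the customer in service is present until then.
\<close>

definition emptying_time :: "nat \<Rightarrow> (nat \<Rightarrow> nat) \<Rightarrow> (nat \<Rightarrow> nat \<Rightarrow> real) \<Rightarrow> (nat \<Rightarrow> real) \<Rightarrow>
    (nat \<Rightarrow> real) \<Rightarrow> (nat \<Rightarrow> regime) \<Rightarrow> ereal" where
  "emptying_time d x\<^sub>0 a e u r =
     Inf {ereal t | j t v x. polling_state d x\<^sub>0 a e u r j = (t, v, x) \<and> no_customers d x}"

definition transient :: "nat \<Rightarrow> (nat \<Rightarrow> real) \<Rightarrow> (nat \<Rightarrow> regime measure) \<Rightarrow> (nat \<Rightarrow> nat) \<Rightarrow> bool" where
  "transient d lam \<nu> x\<^sub>0 \<longleftrightarrow>
     measure (polling_space d lam \<nu>)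
       {(a, e, u, r) \<in> space (polling_space d lam \<nu>). emptying_time d x\<^sub>0 a e u r = \<infinity>} > 0"


section \<open>The random matrices and the parameter \<open>s\<^sub>0\<close>\<close>

definition station_matrix :: "nat \<Rightarrow> (nat \<Rightarrow> real) \<Rightarrow> nat \<Rightarrow> regime \<Rightarrow> real mat" where
  "station_matrix d lam n = (\<lambda>(\<mu>, \<gamma>). Matrix.mat d d (\<lambda>(i, j).
     if j = 0 then (lam ((n + i + 1) mod (d + 1)) + \<gamma> (i + 1) * \<mu>) / (\<mu> - lam n)
     else if j = i + 1 then 1 else 0))"

text \<open>\<open>left_prod d B n\<close> is the product \<open>B (n - 1) * \<dots> * B 1 * B 0\<close> of \<open>d \<times> d\<close> matrices.\<close>

primrec left_prod :: "nat \<Rightarrow> (nat \<Rightarrow> real mat) \<Rightarrow> nat \<Rightarrow> real mat" where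
  "left_prod d B 0 = 1\<^sub>m d"
| "left_prod d B (Suc n) = B n * left_prod d B n"

definition cycle_matrix :: "nat \<Rightarrow> (nat \<Rightarrow> real) \<Rightarrow> (nat \<Rightarrow> regime) \<Rightarrow> real mat" where
  "cycle_matrix d lam q = left_prod d (\<lambda>n. station_matrix d lam n (q n)) (d + 1)"

definition cycle_space :: "nat \<Rightarrow> (nat \<Rightarrow> regime measure) \<Rightarrow> (nat \<Rightarrow> regime) measure" where
  "cycle_space d \<nu> = (\<Pi>\<^sub>M n\<in>{0..d}. \<nu> n)"

definition l1_norm_vec :: "real vec \<Rightarrow> real" where
  "l1_norm_vec v = (\<Sum>i<dim_vec v. \<bar>vec_index v i\<bar>)"

text \<open>The operator norm induced by the \<open>L\<^sub>1\<close>-norm on vectors.\<close>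

definition l1_norm_mat :: "real mat \<Rightarrow> real" where
  "l1_norm_mat B = (SUP v\<in>{v \<in> carrier_vec (dim_col B). l1_norm_vec v = 1}. l1_norm_vec (B *\<^sub>v v))"

definition k_fun :: "nat \<Rightarrow> (nat \<Rightarrow> real) \<Rightarrow> (nat \<Rightarrow> regime measure) \<Rightarrow> real \<Rightarrow> real" where
  "k_fun d lam \<nu> s = lim (\<lambda>n.
     (LINT \<omega>|(\<Pi>\<^sub>M i\<in>UNIV. cycle_space d \<nu>).
        l1_norm_mat (left_prod d (\<lambda>i. cycle_matrix d lam (\<omega> i)) n) powr s) powr (1 / real n))"

definition s_zero :: "nat \<Rightarrow> (nat \<Rightarrow> real) \<Rightarrow> (nat \<Rightarrow> regime measure) \<Rightarrow> ereal" where
  "s_zero d lam \<nu> = Inf (ereal ` {s. 0 < s \<and> 1 < k_fun d lam \<nu> s})"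

end

theory Submission
  imports Defs
begin

text \<open>
  Let \<open>B\<close> be the cycle matrix of the homogeneous model. Its entries are positive, so it has a
  positive left eigenvector \<open>w\<close>, with eigenvalue \<open>\<rho>\<close> say.

  If \<open>\<rho> \<le> 1\<close>, value the customers by \<open>w\<close> at the end of a cycle and by the images of \<open>w\<close> under
  the station matrices at earlier stages. The total value \<open>V\<close> is a supermartingale along the
  successive services, so \<open>ln (1 + V)\<close> strictly decreases in mean in every nonempty state. As the
  expected total decrease is finite and there are only finitely many states below each level,
  the system empties almost surely; this covers the critical case \<open>\<rho> = 1\<close>.

  Hence transience forces \<open>\<rho> > 1\<close>. Regimes close to those of the homogeneous model are drawn
  throughout a cycle with some probability \<open>p > 0\<close>, and such a cycle multiplies \<open>w\<close> by at least some
  \<open>r > 1\<close>. So the \<open>s\<close>-th moment of the norm of a product of \<open>n\<close> cycle matrices is at least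
  \<open>c\<^sup>s (p r\<^sup>s)\<^sup>n\<close>; being submultiplicative in \<open>n\<close>, it has a growth rate, which exceeds \<open>1\<close> for
  large \<open>s\<close>.
\<close>

section \<open>Arrival streams\<close>

text \<open>Two obstacles shape the recurrence half. The process runs on an absolute clock, whereas
  drift arguments want a Markov chain. So the randomness not yet used is carried along with the
  state in \<open>poll_map\<close>, and memorylessness shows that after each service it has its
  original law and is independent of the new state. Secondly, at \<open>\<rho> = 1\<close> the value
  \<open>V\<close> need not lose anything in mean, so there is no drift bounded away from zero. The
  logarithm gives a decrease that is positive in each nonempty state but not uniform, and the
  finiteness of the sublevel sets takes over the role of uniformity.

  In the moment half, \<open>k_fun\<close> is defined by \<open>lim\<close>, so bounds on the
  moments say nothing until convergence is known. Fekete's lemma supplies it; the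
  submultiplicativity that it requires comes from the independence of disjoint blocks of cycles. The
  neighbourhoods of the regimes are chosen so that every coefficient loses at most a factor
  \<open>\<theta>\<close>. A cycle has \<open>d + 1\<close> visits, which fixes how close
  \<open>\<theta>\<close> must be to 1.\<close>

definition resid :: "(nat \<Rightarrow> real) \<Rightarrow> real \<Rightarrow> nat \<Rightarrow> real" where
  "resid b t i = (if i = 0 then (\<Sum>l\<le>arrivals b t. b l) - t else b (arrivals b t + i))"

text \<open>The finiteness clause guards against the convention that \<open>card\<close> of an
  infinite set is 0, under which \<open>arrivals\<close> would drop back to 0. Positivity makes the
  arrival times increase.\<close>

definition good_arrivals :: "(nat \<Rightarrow> real) \<Rightarrow> bool" where
  "good_arrivals b \<longleftrightarrow> (\<forall>i. 0 < b i) \<and> (\<forall>t. finite {i. (\<Sum>l\<le>i. b l) \<le> t})"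

abbreviation arrival_law :: "real \<Rightarrow> (nat \<Rightarrow> real) measure" where
  "arrival_law l \<equiv> \<Pi>\<^sub>M i\<in>UNIV. exponential_law l"

lemma sets_exponential_law[simp, measurable_cong]: "sets (exponential_law l) = sets borel"
  by (simp add: exponential_law_def)

lemma space_exponential_law[simp]: "space (exponential_law l) = UNIV"
  by (simp add: exponential_law_def)

lemma prob_space_exponential_law: "0 < l \<Longrightarrow> prob_space (exponential_law l)"
  unfolding exponential_law_def by (rule prob_space_exponential_density)

lemma space_arrival_law[simp]: "space (arrival_law l) = UNIV"
  by (simp add: space_PiM)

lemma prob_space_arrival_law: "0 < l \<Longrightarrow> prob_space (arrival_law l)"
  by (intro prob_space_PiM prob_space_exponential_law)

lemma AE_exponential_law_pos:
  assumes "0 < l" shows "AE y in exponential_law l. 0 < y"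
  unfolding exponential_law_def
proof (subst AE_density)
  have "AE y in lborel. y \<noteq> (0::real)"
    by (rule AE_lborel_singleton)
  then show "AE y in lborel. 0 < ennreal (exponential_density l y) \<longrightarrow> 0 < y"
    by eventually_elim (auto simp: exponential_density_def)
qed simp

lemma nn_integral_exponential_law_id:
  assumes "0 < l" shows "(\<integral>\<^sup>+y. ennreal y \<partial>exponential_law l) = ennreal (1 / l)"
proof -
  have "(\<integral>\<^sup>+y. ennreal y \<partial>exponential_law l) = (\<integral>\<^sup>+y. ennreal (exponential_density l y * y ^ 1) \<partial>lborel)"
    unfolding exponential_law_def
    by (subst nn_integral_density) (auto simp: ennreal_mult' exponential_density_nonneg assms)
  also have "\<dots> = ennreal (1 / l)"
    using nn_integral_erlang_ith_moment[of l 0 1] assms by simp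
  finally show ?thesis .
qed

text \<open>Translation by \<open>s\<close> multiplies the density on the positive half line by
  \<open>exp (- l * s)\<close>. The constant is left as a tail probability, so that the later
  comparison of \<open>h\<close> with the constant function 1 never has to compute it.\<close>

lemma nn_integral_exponential_law_memoryless:
  assumes "0 < l" "0 \<le> s" and [measurable]: "h \<in> borel_measurable borel"
  shows "(\<integral>\<^sup>+y. indicator {s<..} y * h (y - s) \<partial>exponential_law l)
    = emeasure (exponential_law l) {s<..} * (\<integral>\<^sup>+y. h y \<partial>exponential_law l)"
proof -
  have shift: "(\<integral>\<^sup>+y. indicator {s<..} y * g (y - s) \<partial>exponential_law l)
    = ennreal (exp (- l * s)) * (\<integral>\<^sup>+y. g y \<partial>exponential_law l)"
    if [measurable]: "g \<in> borel_measurable borel" for g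
  proof -
    have "(\<integral>\<^sup>+y. indicator {s<..} y * g (y - s) \<partial>exponential_law l)
      = (\<integral>\<^sup>+y. ennreal (exponential_density l y) * (indicator {s<..} y * g (y - s)) \<partial>lborel)"
      unfolding exponential_law_def by (subst nn_integral_density) auto
    also have "\<dots> = (\<integral>\<^sup>+y. ennreal (exponential_density l (s + 1 * y)) * (indicator {s<..} (s + 1 * y) * g (s + 1 * y - s)) \<partial>lborel)"
      by (subst nn_integral_real_affine[where c=1 and t=s]) auto
    also have "\<dots> = (\<integral>\<^sup>+y. ennreal (exp (- l * s)) * (ennreal (exponential_density l y) * g y) \<partial>lborel)"
    proof (intro nn_integral_cong_AE)
      \<comment> \<open>At \<open>y = 0\<close> the density is positive while the strict tail
        indicator vanishes, so this point is excluded.\<close>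
      have "AE y in lborel. y \<noteq> (0::real)"
        by (rule AE_lborel_singleton)
      then show "AE y in lborel. ennreal (exponential_density l (s + 1 * y)) * (indicator {s<..} (s + 1 * y) * g (s + 1 * y - s))
        = ennreal (exp (- l * s)) * (ennreal (exponential_density l y) * g y)"
      proof eventually_elim
        case (elim y)
        have "exponential_density l (s + y) = exp (- l * s) * exponential_density l y" if "y > 0"
          using that \<open>0 \<le> s\<close> by (simp add: exponential_density_def algebra_simps flip: exp_add)
        then show ?case
          using elim assms(1) by (cases "y > 0")
            (simp_all add: ennreal_mult' exponential_density_nonneg mult_ac indicator_def, simp add: exponential_density_def)
      qed
    qed
    also have "\<dots> = ennreal (exp (- l * s)) * (\<integral>\<^sup>+y. g y \<partial>exponential_law l)"
      unfolding exponential_law_def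
      by (subst nn_integral_density) (auto simp: nn_integral_cmult)
    finally show ?thesis .
  qed
  interpret prob_space "exponential_law l" using assms(1) by (rule prob_space_exponential_law)
  have "emeasure (exponential_law l) {s<..} = ennreal (exp (- l * s))"
    using shift[of "\<lambda>_. 1"] emeasure_space_1 by simp
  then show ?thesis using shift[of h] by simp
qed

section \<open>Measurability of counts and residual streams\<close>

lemma measurable_partial_sums[measurable]:
  "(\<lambda>b. \<Sum>l\<le>i. b l) \<in> borel_measurable (arrival_law l')"
  by measurable

lemma measurable_arrival_law_component:
  assumes "f \<in> M \<rightarrow>\<^sub>M (\<Pi>\<^sub>M i\<in>(UNIV::nat set). borel :: real measure)"
  shows "(\<lambda>x. f x i) \<in> borel_measurable M"
  using measurable_compose[OF assms measurable_component_singleton[of i UNIV]] by simp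

lemma measurable_indicator_count_space[measurable (raw)]:
  assumes "c \<in> M \<rightarrow>\<^sub>M count_space UNIV"
  shows "(\<lambda>x. indicator A (c x) :: ennreal) \<in> borel_measurable M"
  by (rule measurable_compose[OF assms]) simp

lemma measurable_arrivals[measurable (raw)]:
  assumes [measurable]: "f \<in> M \<rightarrow>\<^sub>M (\<Pi>\<^sub>M i\<in>(UNIV::nat set). borel :: real measure)" "g \<in> borel_measurable M"
  shows "(\<lambda>x. arrivals (f x) (g x)) \<in> M \<rightarrow>\<^sub>M count_space UNIV"
proof -
  have [measurable]: "(\<lambda>x. f x i) \<in> borel_measurable M" for i
    by (rule measurable_arrival_law_component[OF assms(1)])
  show ?thesis unfolding arrivals_def by measurable
qed

lemma measurable_resid[measurable (raw)]:
  assumes [measurable]: "f \<in> M \<rightarrow>\<^sub>M (\<Pi>\<^sub>M i\<in>(UNIV::nat set). borel :: real measure)" "g \<in> borel_measurable M"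
  shows "(\<lambda>x. resid (f x) (g x)) \<in> M \<rightarrow>\<^sub>M (\<Pi>\<^sub>M i\<in>UNIV. borel)"
proof (rule measurable_PiM_single')
  have [measurable]: "(\<lambda>x. f x i) \<in> borel_measurable M" for i
    by (rule measurable_arrival_law_component[OF assms(1)])
  fix i :: nat
  have "(\<lambda>x. (\<lambda>k x. if i = 0 then (\<Sum>l\<le>k. f x l) - g x else f x (k + i)) (arrivals (f x) (g x)) x) \<in> borel_measurable M"
    by (rule measurable_compose_countable) measurable
  then show "(\<lambda>x. resid (f x) (g x) i) \<in> borel_measurable M"
    by (simp add: resid_def)
qed auto

text \<open>The coordinates of the product measure are independent exponentials. Both indices start
  at 0: arrival \<open>i\<close> is a sum of \<open>i + 1\<close> of them, and
  \<open>erlang_density i\<close> is the density of such a sum.\<close>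

lemma distributed_arrival_time:
  assumes "0 < l"
  shows "distributed (arrival_law l) lborel (\<lambda>b. \<Sum>j\<le>i. b j) (erlang_density i l)"
proof -
  interpret prob_space "arrival_law l" using assms by (rule prob_space_arrival_law)
  have comp: "distr (arrival_law l) borel (\<lambda>b. b j) = exponential_law l" for j
  proof -
    have "distr (arrival_law l) borel (\<lambda>b. b j) = distr (arrival_law l) (exponential_law l) (\<lambda>b. b j)"
      by (rule distr_cong) auto
    also have "\<dots> = exponential_law l"
      by (rule distr_PiM_component) (auto intro: prob_space_exponential_law assms)
    finally show ?thesis .
  qed
  have "indep_vars (\<lambda>_. borel) (\<lambda>j b. b j) {..i}"
  proof (subst indep_vars_iff_distr_eq_PiM')
    have "distr (arrival_law l) (\<Pi>\<^sub>M j\<in>{..i}. borel) (\<lambda>b. \<lambda>j\<in>{..i}. b j)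
      = distr (arrival_law l) (\<Pi>\<^sub>M j\<in>{..i}. exponential_law l) (\<lambda>b. \<lambda>j\<in>{..i}. b j)"
      by (intro distr_cong sets_PiM_cong) auto
    also have "\<dots> = (\<Pi>\<^sub>M j\<in>{..i}. exponential_law l)"
      using distr_PiM_reindex[of UNIV "\<lambda>_. exponential_law l" "\<lambda>j. j" "{..i}"]
      by (simp add: prob_space_exponential_law assms)
    also have "\<dots> = (\<Pi>\<^sub>M j\<in>{..i}. distr (arrival_law l) borel (\<lambda>b. b j))"
      by (simp add: comp)
    finally show "distr (arrival_law l) (\<Pi>\<^sub>M j\<in>{..i}. borel) (\<lambda>b. \<lambda>j\<in>{..i}. b j) = \<dots>" .
  qed auto
  moreover have "distributed (arrival_law l) lborel (\<lambda>b. b j) (exponential_density l)" for j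
  proof -
    have "distr (arrival_law l) lborel (\<lambda>b. b j) = distr (arrival_law l) borel (\<lambda>b. b j)"
      by (rule distr_cong) auto
    then show ?thesis unfolding distributed_def comp by (auto simp: exponential_law_def)
  qed
  ultimately show ?thesis
    using exponential_distributed_sum[of "{..i}" l "\<lambda>j b. b j"] assms by simp
qed

lemma suminf_erlang_density:
  assumes "0 < l" "0 \<le> x"
  shows "(\<Sum>i. ennreal (erlang_density i l x)) = ennreal l"
proof -
  have "(\<lambda>i. (l * exp (- l * x)) * ((l * x) ^ i /\<^sub>R fact i)) sums ((l * exp (- l * x)) * exp (l * x))"
    by (intro sums_mult exp_converges)
  also have "(l * exp (- l * x)) * exp (l * x) = l"
    by (simp add: exp_minus)
  also have "(\<lambda>i. (l * exp (- l * x)) * ((l * x) ^ i /\<^sub>R fact i)) = (\<lambda>i. erlang_density i l x)"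
  proof
    fix i
    have "(l * exp (- l * x)) * ((l * x) ^ i /\<^sub>R fact i) = (l * exp (- l * x)) * (l ^ i * x ^ i) / fact i"
      by (simp add: power_mult_distrib divide_inverse)
    then show "(l * exp (- l * x)) * ((l * x) ^ i /\<^sub>R fact i) = erlang_density i l x"
      using assms by (simp add: erlang_density_def mult_ac)
  qed
  finally show ?thesis
    using assms by (intro suminf_ennreal_eq) auto
qed

text \<open>The series of indicators replaces \<open>arrivals\<close> because it is infinite where
  \<open>card\<close> returns 0. Its finite mean can therefore be used to show that the number of
  arrivals is finite.\<close>

lemma nn_integral_num_arrivals:
  assumes "0 < l" "0 \<le> t"
  shows "(\<integral>\<^sup>+b. (\<Sum>i. indicator {..t} (\<Sum>j\<le>i. b j)) \<partial>arrival_law l) = ennreal (l * t)"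
proof -
  have "(\<integral>\<^sup>+b. (\<Sum>i. indicator {..t} (\<Sum>j\<le>i. b j)) \<partial>arrival_law l)
    = (\<Sum>i. \<integral>\<^sup>+b. indicator {..t} (\<Sum>j\<le>i. b j) \<partial>arrival_law l)"
    by (rule nn_integral_suminf) measurable
  also have "\<dots> = (\<Sum>i. \<integral>\<^sup>+x. ennreal (erlang_density i l x) * indicator {..t} x \<partial>lborel)"
    by (intro suminf_cong distributed_nn_integral[symmetric] distributed_arrival_time assms) auto
  also have "\<dots> = (\<integral>\<^sup>+x. (\<Sum>i. ennreal (erlang_density i l x) * indicator {..t} x) \<partial>lborel)"
    by (rule nn_integral_suminf[symmetric]) measurable
  also have "\<dots> = (\<integral>\<^sup>+x. ennreal l * indicator {0..t} x \<partial>lborel)"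
  proof (intro nn_integral_cong)
    fix x :: real
    consider "x \<in> {0..t}" | "x < 0" | "t < x" by fastforce
    then show "(\<Sum>i. ennreal (erlang_density i l x) * indicator {..t} x) = ennreal l * indicator {0..t} x"
    proof cases
      case 1
      then show ?thesis using suminf_erlang_density[OF assms(1), of x] by simp
    next
      case 2
      then have "erlang_density i l x = 0" for i by (simp add: erlang_density_def)
      with 2 show ?thesis by simp
    qed simp
  qed
  also have "\<dots> = ennreal (l * t)"
    using assms by (simp add: nn_integral_cmult ennreal_mult')
  finally show ?thesis .
qed

lemma arrivals_le_suminf:
  "of_nat (arrivals b t) \<le> (\<Sum>i. indicator {..t} (\<Sum>j\<le>i. b j) :: ennreal)"
proof (cases "finite {i. (\<Sum>l\<le>i. b l) \<le> t}")
  case True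
  have "of_nat (arrivals b t) = (\<Sum>i\<in>{i. (\<Sum>l\<le>i. b l) \<le> t}. indicator {..t} (\<Sum>j\<le>i. b j) :: ennreal)"
    by (simp add: arrivals_def)
  also have "\<dots> \<le> (\<Sum>i. indicator {..t} (\<Sum>j\<le>i. b j) :: ennreal)"
    using True by (intro sum_le_suminf) auto
  finally show ?thesis .
qed (simp add: arrivals_def)

lemma nn_integral_arrivals_le:
  assumes "0 < l" "0 \<le> t"
  shows "(\<integral>\<^sup>+b. of_nat (arrivals b t) \<partial>arrival_law l) \<le> ennreal (l * t)"
proof -
  have "(\<integral>\<^sup>+b. of_nat (arrivals b t) \<partial>arrival_law l)
    \<le> (\<integral>\<^sup>+b. (\<Sum>i. indicator {..t} (\<Sum>j\<le>i. b j)) \<partial>arrival_law l)"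
    by (intro nn_integral_mono arrivals_le_suminf)
  then show ?thesis
    by (simp only: nn_integral_num_arrivals[OF assms])
qed

lemma ennreal_top_eqI:
  fixes x :: ennreal
  assumes "\<And>k. of_nat k \<le> x"
  shows "x = \<infinity>"
proof (rule ccontr)
  assume "x \<noteq> \<infinity>"
  then obtain k where "x < of_nat k"
    using ennreal_Ex_less_of_nat[of x] by (auto simp: less_top)
  with assms[of k] show False by simp
qed

text \<open>A count with finite mean is almost surely finite. Integer horizons suffice: there are
  countably many of them, and the sets of arrivals grow with the horizon.\<close>

lemma AE_good_arrivals:
  assumes "0 < l"
  shows "AE b in arrival_law l. good_arrivals b"
proof -
  have "AE b in arrival_law l. 0 < b i" for i
    by (rule AE_PiM_component) (auto intro: prob_space_exponential_law AE_exponential_law_pos assms)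
  then have pos: "AE b in arrival_law l. \<forall>i. 0 < b i"
    by (simp add: AE_all_countable)
  have "AE b in arrival_law l. finite {i. (\<Sum>j\<le>i. b j) \<le> real n}" for n
  proof -
    have "AE b in arrival_law l. (\<Sum>i. indicator {..real n} (\<Sum>j\<le>i. b j)) \<noteq> (\<infinity>::ennreal)"
      using nn_integral_num_arrivals[of l "real n"] assms
      by (intro nn_integral_PInf_AE) auto
    then show ?thesis
    proof eventually_elim
      case (elim b)
      show ?case
      proof (rule ccontr)
        assume inf: "infinite {i. (\<Sum>j\<le>i. b j) \<le> real n}"
        have "of_nat k \<le> (\<Sum>i. indicator {..real n} (\<Sum>j\<le>i. b j) :: ennreal)" for k
        proof -
          obtain F where F: "F \<subseteq> {i. (\<Sum>j\<le>i. b j) \<le> real n}" "finite F" "card F = k"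
            using infinite_arbitrarily_large[OF inf] by blast
          have "(of_nat k :: ennreal) = (\<Sum>i\<in>F. indicator {..real n} (\<Sum>j\<le>i. b j))"
            using F by (subst sum.cong[OF refl, of _ _ "\<lambda>_. 1"]) auto
          also have "\<dots> \<le> (\<Sum>i. indicator {..real n} (\<Sum>j\<le>i. b j))"
            using F by (intro sum_le_suminf) auto
          finally show ?thesis .
        qed
        then have "(\<Sum>i. indicator {..real n} (\<Sum>j\<le>i. b j) :: ennreal) = \<infinity>"
                by (rule ennreal_top_eqI)
        with elim show False by simp
      qed
    qed
  qed
  then have "AE b in arrival_law l. \<forall>n. finite {i. (\<Sum>j\<le>i. b j) \<le> real n}"
    by (simp add: AE_all_countable)
  with pos show ?thesis
  proof eventually_elim
    case (elim b)
    have "finite {i. (\<Sum>l\<le>i. b l) \<le> t}" for t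
      using elim(2)[rule_format, of "nat \<lceil>t\<rceil>"]
      by (rule rev_finite_subset) (auto intro: order_trans[OF _ real_nat_ceiling_ge])
    with elim show ?case by (simp add: good_arrivals_def)
  qed
qed

section \<open>Pathwise calculus of counts and residual streams\<close>

lemma good_arrivals_partial_sums_mono:
  assumes "good_arrivals b" "i \<le> k"
  shows "(\<Sum>l\<le>i. b l) \<le> (\<Sum>l\<le>k. b l)"
  using assms by (intro sum_mono2) (auto simp: good_arrivals_def less_imp_le)

text \<open>A finite downward closed set of naturals is the initial segment determined by its
  cardinality.\<close>

lemma good_arrivals_Collect:
  assumes "good_arrivals b"
  shows "{i. (\<Sum>l\<le>i. b l) \<le> t} = {..<arrivals b t}"
proof -
  let ?A = "{i. (\<Sum>l\<le>i. b l) \<le> t}"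
  have fin: "finite ?A" using assms by (simp add: good_arrivals_def)
  have down: "k \<in> ?A" if "i \<in> ?A" "k \<le> i" for i k
    using good_arrivals_partial_sums_mono[OF assms that(2)] that(1) by auto
  have "?A = {..<card ?A}"
  proof (cases "?A = {}")
    case False
    have "?A \<subseteq> {..Max ?A}" using Max_ge[OF fin] by blast
    moreover have "{..Max ?A} \<subseteq> ?A" using down[OF Max_in[OF fin False]] by blast
    ultimately have "?A = {..Max ?A}" by (rule equalityI)
    then show ?thesis by (metis card_atMost lessThan_Suc_atMost)
  qed simp
  then show ?thesis by (simp add: arrivals_def)
qed

lemma good_arrivals_le_iff:
  "good_arrivals b \<Longrightarrow> (\<Sum>l\<le>i. b l) \<le> t \<longleftrightarrow> i < arrivals b t"
  using good_arrivals_Collect[of b t] by (simp add: set_eq_iff)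

lemma arrivals_eqI:
  assumes "\<And>i. (\<Sum>l\<le>i. b l) \<le> t \<longleftrightarrow> i < n"
  shows "arrivals b t = n"
proof -
  have "{i. (\<Sum>l\<le>i. b l) \<le> t} = {..<n}" using assms by auto
  then show ?thesis by (simp add: arrivals_def)
qed

text \<open>Entry 0 of \<open>resid b t\<close> is the wait from \<open>t\<close> to the next
  arrival, and the later entries are untouched interarrival times. Hence the arrival times of the
  residual stream are the original ones, renumbered and moved back by \<open>t\<close>.\<close>

lemma sum_resid:
  "(\<Sum>l\<le>i. resid b t l) = (\<Sum>l\<le>arrivals b t + i. b l) - t"
  by (induction i) (auto simp: resid_def)

lemma arrivals_resid:
  assumes "good_arrivals b" "0 \<le> s"
  shows "arrivals (resid b t) s = arrivals b (t + s) - arrivals b t"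
proof (rule arrivals_eqI)
  fix i
  have "(\<Sum>l\<le>i. resid b t l) \<le> s \<longleftrightarrow> (\<Sum>l\<le>arrivals b t + i. b l) \<le> t + s"
    by (auto simp: sum_resid)
  then show "(\<Sum>l\<le>i. resid b t l) \<le> s \<longleftrightarrow> i < arrivals b (t + s) - arrivals b t"
    using good_arrivals_le_iff[OF assms(1), of "arrivals b t + i" "t + s"] by auto
qed

lemma arrivals_mono:
  assumes "good_arrivals b" "t \<le> t'"
  shows "arrivals b t \<le> arrivals b t'"
proof -
  have "{..<arrivals b t} \<subseteq> {..<arrivals b t'}"
    using order_trans[OF _ assms(2)] unfolding good_arrivals_Collect[OF assms(1), symmetric] by blast
  then show ?thesis by (simp add: lessThan_subset_iff)
qed

text \<open>The flow property of residual streams. It lets an environment that is restarted after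
  every service be compared with a stream read on an absolute clock.\<close>

lemma resid_resid:
  assumes "good_arrivals b" "0 \<le> s"
  shows "resid (resid b t) s = resid b (t + s)"
proof
  fix i
  let ?N = "arrivals b t" and ?K = "arrivals b (t + s)"
  have NK: "?N \<le> ?K" using arrivals_mono[OF assms(1)] assms(2) by simp
  show "resid (resid b t) s i = resid b (t + s) i"
  proof (cases "i = 0")
    case True
    then show ?thesis
      unfolding resid_def[of "resid b t" s] resid_def[of b "t + s"] sum_resid
      using NK by (simp add: arrivals_resid[OF assms])
  next
    case False
    have "resid (resid b t) s i = resid b t (arrivals (resid b t) s + i)"
      using False by (simp add: resid_def[of "resid b t" s])
    also have "\<dots> = b (?N + (?K - ?N + i))"
      unfolding arrivals_resid[OF assms] using False by (simp add: resid_def)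
    finally show ?thesis
      using NK False by (simp add: resid_def)
  qed
qed

lemma resid_0:
  assumes "good_arrivals b"
  shows "resid b 0 = b"
proof -
  have "(\<Sum>l\<le>i. b l) > 0" for i
    using assms by (intro sum_pos) (auto simp: good_arrivals_def)
  then have "arrivals b 0 = 0"
    by (intro arrivals_eqI) (auto simp: not_le)
  then show ?thesis by (auto simp: resid_def fun_eq_iff)
qed

section \<open>Conditioning on the first interarrival time\<close>

lemma sum_case_nat: "(\<Sum>l\<le>Suc i. case_nat y b l) = y + (\<Sum>l\<le>i. b l)"
  by (induction i) (simp_all add: ac_simps)

lemma arrivals_case_nat_gt:
  assumes "s < y" "\<And>i. 0 < b i"
  shows "arrivals (case_nat y b) s = 0"
proof (rule arrivals_eqI)
  fix i
  show "((\<Sum>l\<le>i. case_nat y b l) \<le> s) = (i < 0)"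
  proof (cases i)
    case (Suc k)
    have "0 < (\<Sum>l\<le>k. b l)" using assms(2) by (intro sum_pos) auto
    then show ?thesis using assms(1) unfolding Suc sum_case_nat by auto
  qed (use assms(1) in auto)
qed

lemma resid_case_nat_gt:
  assumes "s < y" "\<And>i. 0 < b i"
  shows "resid (case_nat y b) s = case_nat (y - s) b"
  using arrivals_case_nat_gt[of s y b] assms by (auto simp: resid_def fun_eq_iff split: nat.split)

lemma arrivals_case_nat_le:
  assumes "y \<le> s" "good_arrivals b"
  shows "arrivals (case_nat y b) s = Suc (arrivals b (s - y))"
proof (rule arrivals_eqI)
  fix i
  show "((\<Sum>l\<le>i. case_nat y b l) \<le> s) = (i < Suc (arrivals b (s - y)))"
  proof (cases i)
    case (Suc k)
    then show ?thesis using good_arrivals_le_iff[OF assms(2), of k "s - y"]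
      unfolding Suc sum_case_nat by auto
  qed (use assms(1) in auto)
qed

lemma resid_case_nat_le:
  assumes "y \<le> s" "good_arrivals b"
  shows "resid (case_nat y b) s = resid b (s - y)"
  unfolding resid_def arrivals_case_nat_le[OF assms] sum_case_nat
  by (auto simp: fun_eq_iff)

lemma nn_integral_PiM_case_nat:
  fixes M :: "'a measure"
  assumes "prob_space M" and [measurable]: "f \<in> borel_measurable (\<Pi>\<^sub>M i\<in>(UNIV::nat set). M)"
  shows "(\<integral>\<^sup>+b. f b \<partial>(\<Pi>\<^sub>M i\<in>(UNIV::nat set). M))
    = (\<integral>\<^sup>+y. \<integral>\<^sup>+b. f (case_nat y b) \<partial>(\<Pi>\<^sub>M i\<in>(UNIV::nat set). M) \<partial>M)"
proof -
  interpret prob_space M by fact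
  interpret sequence_space M ..
  have "(\<integral>\<^sup>+b. f b \<partial>S) = (\<integral>\<^sup>+b. f b \<partial>distr (M \<Otimes>\<^sub>M S) S (\<lambda>(y, b). case_nat y b))"
    by (simp only: PiM_iter)
  also have "\<dots> = (\<integral>\<^sup>+z. f (case z of (y, b) \<Rightarrow> case_nat y b) \<partial>(M \<Otimes>\<^sub>M S))"
    by (rule nn_integral_distr) measurable
  also have "\<dots> = (\<integral>\<^sup>+y. \<integral>\<^sup>+b. f (case_nat y b) \<partial>S \<partial>M)"
    by (subst P.nn_integral_fst[symmetric]) auto
  finally show ?thesis .
qed

lemma AE_arrival_law_pos:
  assumes "0 < l"
  shows "AE b in arrival_law l. \<forall>i. 0 < b i"
  using AE_good_arrivals[OF assms] by eventually_elim (simp add: good_arrivals_def)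

text \<open>Induction on the count, conditioning on the first interarrival time \<open>y\<close>. No
  arrival by \<open>s\<close> means \<open>s < y\<close>, and then the overshoot
  \<open>y - s\<close> is exponential again. Otherwise the stream starts afresh at \<open>y\<close>,
  and the induction hypothesis applies with horizon \<open>s - y\<close>.\<close>

lemma nn_integral_resid_eq:
  assumes l: "0 < l" and "0 \<le> s" and [measurable]: "h \<in> borel_measurable (arrival_law l)"
  shows "(\<integral>\<^sup>+b. indicator {k} (arrivals b s) * h (resid b s) \<partial>arrival_law l)
    = (\<integral>\<^sup>+b. indicator {k} (arrivals b s) \<partial>arrival_law l) * (\<integral>\<^sup>+b. h b \<partial>arrival_law l)"
  using assms(2)
proof (induction k arbitrary: s)
  interpret exp: prob_space "exponential_law l" using l by (rule prob_space_exponential_law)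
  interpret arr: prob_space "arrival_law l" using l by (rule prob_space_arrival_law)
  note law = nn_integral_PiM_case_nat[OF prob_space_exponential_law[OF l]]
  case (0 s)
  \<comment> \<open>Stated for an arbitrary \<open>g\<close>: the instance with the constant
    function 1 identifies the factor in front of the integral as the probability of the
    count.\<close>
  have *: "(\<integral>\<^sup>+b. indicator {0} (arrivals b s) * g (resid b s) \<partial>arrival_law l)
    = emeasure (exponential_law l) {s<..} * (\<integral>\<^sup>+b. g b \<partial>arrival_law l)"
    if [measurable]: "g \<in> borel_measurable (arrival_law l)" for g
  proof -
    have "(\<integral>\<^sup>+b. indicator {0} (arrivals b s) * g (resid b s) \<partial>arrival_law l)
      = (\<integral>\<^sup>+y. \<integral>\<^sup>+b. indicator {0} (arrivals (case_nat y b) s) * g (resid (case_nat y b) s) \<partial>arrival_law l \<partial>exponential_law l)"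
      by (rule law) measurable
    also have "\<dots> = (\<integral>\<^sup>+y. indicator {s<..} y * (\<integral>\<^sup>+b. g (case_nat (y - s) b) \<partial>arrival_law l) \<partial>exponential_law l)"
    proof (rule nn_integral_cong)
      fix y
      show "(\<integral>\<^sup>+b. indicator {0} (arrivals (case_nat y b) s) * g (resid (case_nat y b) s) \<partial>arrival_law l)
        = indicator {s<..} y * (\<integral>\<^sup>+b. g (case_nat (y - s) b) \<partial>arrival_law l)"
      proof (cases "s < y")
        case True
        have "(\<integral>\<^sup>+b. indicator {0} (arrivals (case_nat y b) s) * g (resid (case_nat y b) s) \<partial>arrival_law l)
          = (\<integral>\<^sup>+b. g (case_nat (y - s) b) \<partial>arrival_law l)"
          using AE_arrival_law_pos[OF l] True
          by (intro nn_integral_cong_AE) (auto simp: arrivals_case_nat_gt resid_case_nat_gt elim: eventually_mono)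
        with True show ?thesis by simp
      next
        case False
        have "(\<integral>\<^sup>+b. indicator {0} (arrivals (case_nat y b) s) * g (resid (case_nat y b) s) \<partial>arrival_law l)
          = (\<integral>\<^sup>+b. 0 \<partial>arrival_law l)"
          using AE_good_arrivals[OF l] False
          by (intro nn_integral_cong_AE) (auto simp: arrivals_case_nat_le elim: eventually_mono)
        with False show ?thesis by simp
      qed
    qed
    also have "\<dots> = emeasure (exponential_law l) {s<..} * (\<integral>\<^sup>+y. \<integral>\<^sup>+b. g (case_nat y b) \<partial>arrival_law l \<partial>exponential_law l)"
      using l 0 by (intro nn_integral_exponential_law_memoryless)
        (auto intro!: arr.borel_measurable_nn_integral simp: measurable_cong_sets[OF sets_exponential_law refl, symmetric])
    also have "(\<integral>\<^sup>+y. \<integral>\<^sup>+b. g (case_nat y b) \<partial>arrival_law l \<partial>exponential_law l) = (\<integral>\<^sup>+b. g b \<partial>arrival_law l)"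
      by (rule law[symmetric]) measurable
    finally show ?thesis .
  qed
  show ?case
    using *[of h] *[of "\<lambda>_. 1"] arr.emeasure_space_1 by simp
next
  interpret exp: prob_space "exponential_law l" using l by (rule prob_space_exponential_law)
  interpret arr: prob_space "arrival_law l" using l by (rule prob_space_arrival_law)
  note law = nn_integral_PiM_case_nat[OF prob_space_exponential_law[OF l]]
  case (Suc k s)
  \<comment> \<open>\<open>P\<close> is the probability of \<open>Suc k\<close> arrivals, which is
    recognised at the end by testing with the constant function 1.\<close>
  define P where "P = (\<integral>\<^sup>+y. indicator {..s} y * (\<integral>\<^sup>+b. indicator {k} (arrivals b (s - y)) \<partial>arrival_law l) \<partial>exponential_law l)"
  have *: "(\<integral>\<^sup>+b. indicator {Suc k} (arrivals b s) * g (resid b s) \<partial>arrival_law l) = P * (\<integral>\<^sup>+b. g b \<partial>arrival_law l)"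
    if [measurable]: "g \<in> borel_measurable (arrival_law l)"
    and IH: "\<And>s. 0 \<le> s \<Longrightarrow> (\<integral>\<^sup>+b. indicator {k} (arrivals b s) * g (resid b s) \<partial>arrival_law l)
      = (\<integral>\<^sup>+b. indicator {k} (arrivals b s) \<partial>arrival_law l) * (\<integral>\<^sup>+b. g b \<partial>arrival_law l)" for g
  proof -
    have "(\<integral>\<^sup>+b. indicator {Suc k} (arrivals b s) * g (resid b s) \<partial>arrival_law l)
      = (\<integral>\<^sup>+y. \<integral>\<^sup>+b. indicator {Suc k} (arrivals (case_nat y b) s) * g (resid (case_nat y b) s) \<partial>arrival_law l \<partial>exponential_law l)"
      by (rule law) measurable
    also have "\<dots> = (\<integral>\<^sup>+y. indicator {..s} y * (\<integral>\<^sup>+b. indicator {k} (arrivals b (s - y)) \<partial>arrival_law l) * (\<integral>\<^sup>+b. g b \<partial>arrival_law l) \<partial>exponential_law l)"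
    proof (rule nn_integral_cong)
      fix y
      show "(\<integral>\<^sup>+b. indicator {Suc k} (arrivals (case_nat y b) s) * g (resid (case_nat y b) s) \<partial>arrival_law l)
        = indicator {..s} y * (\<integral>\<^sup>+b. indicator {k} (arrivals b (s - y)) \<partial>arrival_law l) * (\<integral>\<^sup>+b. g b \<partial>arrival_law l)"
      proof (cases "y \<le> s")
        case True
        have "(\<integral>\<^sup>+b. indicator {Suc k} (arrivals (case_nat y b) s) * g (resid (case_nat y b) s) \<partial>arrival_law l)
          = (\<integral>\<^sup>+b. indicator {k} (arrivals b (s - y)) * g (resid b (s - y)) \<partial>arrival_law l)"
          using AE_good_arrivals[OF l] True
          by (intro nn_integral_cong_AE) (auto simp: arrivals_case_nat_le resid_case_nat_le indicator_def elim: eventually_mono)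
        with True IH[of "s - y"] show ?thesis by simp
      next
        case False
        have "(\<integral>\<^sup>+b. indicator {Suc k} (arrivals (case_nat y b) s) * g (resid (case_nat y b) s) \<partial>arrival_law l)
          = (\<integral>\<^sup>+b. 0 \<partial>arrival_law l)"
          using AE_arrival_law_pos[OF l] False
          by (intro nn_integral_cong_AE) (auto simp: arrivals_case_nat_gt elim: eventually_mono)
        with False show ?thesis by simp
      qed
    qed
    also have "\<dots> = P * (\<integral>\<^sup>+b. g b \<partial>arrival_law l)"
      unfolding P_def by (rule nn_integral_multc) measurable
    finally show ?thesis .
  qed
  show ?case
    using *[of h] *[of "\<lambda>_. 1"] Suc.IH arr.emeasure_space_1 by simp
qed

lemma nn_integral_indicator_suminf:
  fixes F :: "nat \<Rightarrow> 'a \<Rightarrow> ennreal"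
  assumes [measurable]: "c \<in> M \<rightarrow>\<^sub>M count_space UNIV" "\<And>k. F k \<in> borel_measurable M"
  shows "(\<integral>\<^sup>+x. F (c x) x \<partial>M) = (\<Sum>k. \<integral>\<^sup>+x. indicator {k} (c x) * F k x \<partial>M)"
proof -
  have "(\<Sum>k. indicator {k} n * F k x) = F n x" for n x
    using suminf_finite[of "{n}" "\<lambda>k. indicator {k} n * F k x"] by (simp add: indicator_def)
  then have "(\<integral>\<^sup>+x. F (c x) x \<partial>M) = (\<integral>\<^sup>+x. (\<Sum>k. indicator {k} (c x) * F k x) \<partial>M)"
    by simp
  also have "\<dots> = (\<Sum>k. \<integral>\<^sup>+x. indicator {k} (c x) * F k x \<partial>M)"
    by (rule nn_integral_suminf) measurable
  finally show ?thesis .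
qed

text \<open>By memorylessness the residual arrival stream is independent of the past and has the
  original law.\<close>

lemma nn_integral_arrivals_resid:
  assumes l: "0 < l" and s: "0 \<le> s"
    and [measurable]: "\<And>k. G k \<in> borel_measurable (arrival_law l)"
  shows "(\<integral>\<^sup>+b. G (arrivals b s) (resid b s) \<partial>arrival_law l)
    = (\<integral>\<^sup>+b. \<integral>\<^sup>+b'. G (arrivals b s) b' \<partial>arrival_law l \<partial>arrival_law l)"
proof -
  have "(\<integral>\<^sup>+b. G (arrivals b s) (resid b s) \<partial>arrival_law l)
    = (\<Sum>k. \<integral>\<^sup>+b. indicator {k} (arrivals b s) * G k (resid b s) \<partial>arrival_law l)"
    by (rule nn_integral_indicator_suminf) measurable
  also have "\<dots> = (\<Sum>k. \<integral>\<^sup>+b. indicator {k} (arrivals b s) * (\<integral>\<^sup>+b'. G k b' \<partial>arrival_law l) \<partial>arrival_law l)"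
  proof (intro suminf_cong)
    fix k
    show "(\<integral>\<^sup>+b. indicator {k} (arrivals b s) * G k (resid b s) \<partial>arrival_law l)
      = (\<integral>\<^sup>+b. indicator {k} (arrivals b s) * (\<integral>\<^sup>+b'. G k b' \<partial>arrival_law l) \<partial>arrival_law l)"
      by (subst nn_integral_resid_eq[OF l s]) (simp_all add: nn_integral_multc)
  qed
  also have "\<dots> = (\<integral>\<^sup>+b. \<integral>\<^sup>+b'. G (arrivals b s) b' \<partial>arrival_law l \<partial>arrival_law l)"
    by (rule nn_integral_indicator_suminf[symmetric]) measurable
  finally show ?thesis .
qed

section \<open>Independent regeneration\<close>

text \<open>The outcome \<open>c\<close> of an experiment is independent of what remains of the randomness, and the
  remainder \<open>r\<close> has the original law.\<close>

definition splits :: "'a measure \<Rightarrow> 'c measure \<Rightarrow> ('a \<Rightarrow> 'c) \<Rightarrow> ('a \<Rightarrow> 'a) \<Rightarrow> bool" where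
  "splits M C c r \<longleftrightarrow> c \<in> M \<rightarrow>\<^sub>M C \<and> r \<in> M \<rightarrow>\<^sub>M M \<and>
     (\<forall>G\<in>borel_measurable (C \<Otimes>\<^sub>M M).
       (\<integral>\<^sup>+x. G (c x, r x) \<partial>M) = (\<integral>\<^sup>+x. \<integral>\<^sup>+x'. G (c x, x') \<partial>M \<partial>M))"

lemma splitsD:
  assumes "splits M C c r" "G \<in> borel_measurable (C \<Otimes>\<^sub>M M)"
  shows "(\<integral>\<^sup>+x. G (c x, r x) \<partial>M) = (\<integral>\<^sup>+x. \<integral>\<^sup>+x'. G (c x, x') \<partial>M \<partial>M)"
  using assms by (auto simp: splits_def)

lemma splits_arrivals:
  assumes "0 < l" "0 \<le> s"
  shows "splits (arrival_law l) (count_space UNIV) (\<lambda>b. arrivals b s) (\<lambda>b. resid b s)"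
  unfolding splits_def
proof (intro conjI ballI)
  fix G :: "nat \<times> (nat \<Rightarrow> real) \<Rightarrow> ennreal"
  assume [measurable]: "G \<in> borel_measurable (count_space UNIV \<Otimes>\<^sub>M arrival_law l)"
  have "(\<lambda>b. G (k, b)) \<in> borel_measurable (arrival_law l)" for k
    by measurable
  from nn_integral_arrivals_resid[OF assms, of "\<lambda>k b. G (k, b)", OF this]
  show "(\<integral>\<^sup>+b. G (arrivals b s, resid b s) \<partial>arrival_law l)
    = (\<integral>\<^sup>+b. \<integral>\<^sup>+b'. G (arrivals b s, b') \<partial>arrival_law l \<partial>arrival_law l)" .
qed measurable

lemma splits_iid:
  fixes M :: "'a measure"
  assumes "prob_space M"
  shows "splits (\<Pi>\<^sub>M i\<in>(UNIV::nat set). M) M (\<lambda>b. b 0) (\<lambda>b i. b (Suc i))"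
  unfolding splits_def
proof (intro conjI ballI)
  let ?S = "\<Pi>\<^sub>M i\<in>(UNIV::nat set). M"
  interpret M: prob_space M by fact
  interpret S: prob_space ?S by (intro prob_space_PiM assms)
  fix G :: "'a \<times> (nat \<Rightarrow> 'a) \<Rightarrow> ennreal"
  assume [measurable]: "G \<in> borel_measurable (M \<Otimes>\<^sub>M ?S)"
  have [measurable]: "(\<lambda>b i. b (Suc i)) \<in> ?S \<rightarrow>\<^sub>M ?S"
    by (rule measurable_PiM_single') (auto simp: space_PiM PiE_iff)
  have "(\<integral>\<^sup>+x. G (x 0, \<lambda>i. x (Suc i)) \<partial>?S) = (\<integral>\<^sup>+y. \<integral>\<^sup>+b. G (y, b) \<partial>?S \<partial>M)"
    by (subst nn_integral_PiM_case_nat[OF assms]) simp_all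
  also have "\<dots> = (\<integral>\<^sup>+x. \<integral>\<^sup>+x'. G (x 0, x') \<partial>?S \<partial>?S)"
    by (subst (2) nn_integral_PiM_case_nat[OF assms]) (simp_all add: S.emeasure_space_1)
  finally show "(\<integral>\<^sup>+x. G (x 0, \<lambda>i. x (Suc i)) \<partial>?S) = (\<integral>\<^sup>+x. \<integral>\<^sup>+x'. G (x 0, x') \<partial>?S \<partial>?S)" .
qed (auto intro!: measurable_PiM_single' simp: space_PiM PiE_iff)

text \<open>The second experiment may depend on the outcome of the first one.\<close>

lemma splits_pair:
  assumes "prob_space M1" "prob_space M2"
    and s1: "splits M1 C1 c1 r1"
    and s2: "\<And>z. z \<in> space C1 \<Longrightarrow> splits M2 C2 (c2 z) (r2 z)"
    and c2: "case_prod c2 \<in> C1 \<Otimes>\<^sub>M M2 \<rightarrow>\<^sub>M C2" and r2: "case_prod r2 \<in> C1 \<Otimes>\<^sub>M M2 \<rightarrow>\<^sub>M M2"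
  shows "splits (M1 \<Otimes>\<^sub>M M2) (C1 \<Otimes>\<^sub>M C2) (\<lambda>(x, y). (c1 x, c2 (c1 x) y)) (\<lambda>(x, y). (r1 x, r2 (c1 x) y))"
  unfolding splits_def
proof (intro conjI ballI)
  interpret M1: prob_space M1 by fact
  interpret M2: prob_space M2 by fact
  interpret pair_prob_space M1 M2 ..
  have c1[measurable]: "c1 \<in> M1 \<rightarrow>\<^sub>M C1" and r1[measurable]: "r1 \<in> M1 \<rightarrow>\<^sub>M M1"
    using s1 by (auto simp: splits_def)
  have [measurable]: "(\<lambda>x. c2 (fst x) (snd x)) \<in> C1 \<Otimes>\<^sub>M M2 \<rightarrow>\<^sub>M C2" "(\<lambda>x. r2 (fst x) (snd x)) \<in> C1 \<Otimes>\<^sub>M M2 \<rightarrow>\<^sub>M M2"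
    using c2 r2 by (simp_all add: case_prod_beta')
  have c2'[measurable (raw)]: "(\<lambda>x. c2 (f x) (g x)) \<in> M \<rightarrow>\<^sub>M C2"
    if [measurable]: "f \<in> M \<rightarrow>\<^sub>M C1" "g \<in> M \<rightarrow>\<^sub>M M2" for M :: "'z measure" and f g
    using measurable_compose[of "\<lambda>x. (f x, g x)" M, OF _ c2] by simp
  have r2'[measurable (raw)]: "(\<lambda>x. r2 (f x) (g x)) \<in> M \<rightarrow>\<^sub>M M2"
    if [measurable]: "f \<in> M \<rightarrow>\<^sub>M C1" "g \<in> M \<rightarrow>\<^sub>M M2" for M :: "'z measure" and f g
    using measurable_compose[of "\<lambda>x. (f x, g x)" M, OF _ r2] by simp
  show cm[measurable]: "(\<lambda>(x, y). (c1 x, c2 (c1 x) y)) \<in> M1 \<Otimes>\<^sub>M M2 \<rightarrow>\<^sub>M C1 \<Otimes>\<^sub>M C2"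
    unfolding case_prod_beta'
    by (intro measurable_Pair measurable_compose[OF measurable_fst c1]
        measurable_compose[of "\<lambda>x. (c1 (fst x), snd x)", OF _ c2, unfolded prod.case]) measurable
  show rm[measurable]: "(\<lambda>(x, y). (r1 x, r2 (c1 x) y)) \<in> M1 \<Otimes>\<^sub>M M2 \<rightarrow>\<^sub>M M1 \<Otimes>\<^sub>M M2"
    unfolding case_prod_beta'
    by (intro measurable_Pair measurable_compose[OF measurable_fst r1]
        measurable_compose[of "\<lambda>x. (c1 (fst x), snd x)", OF _ r2, unfolded prod.case]) measurable
  fix G :: "_ \<Rightarrow> ennreal" assume G[measurable]: "G \<in> borel_measurable ((C1 \<Otimes>\<^sub>M C2) \<Otimes>\<^sub>M (M1 \<Otimes>\<^sub>M M2))"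
  have c2x[measurable]: "c2 z \<in> M2 \<rightarrow>\<^sub>M C2" "r2 z \<in> M2 \<rightarrow>\<^sub>M M2" if "z \<in> space C1" for z
    using s2[OF that] by (auto simp: splits_def)
  have c1s: "c1 x \<in> space C1" "r1 x \<in> space M1" if "x \<in> space M1" for x
    using that measurable_space[OF c1] measurable_space[OF r1] by auto
  have "(\<integral>\<^sup>+z. G ((\<lambda>(x, y). (c1 x, c2 (c1 x) y)) z, (\<lambda>(x, y). (r1 x, r2 (c1 x) y)) z) \<partial>(M1 \<Otimes>\<^sub>M M2))
    = (\<integral>\<^sup>+x. \<integral>\<^sup>+y. G ((c1 x, c2 (c1 x) y), (r1 x, r2 (c1 x) y)) \<partial>M2 \<partial>M1)"
    by (subst M2.nn_integral_fst[symmetric]) simp_all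
  \<comment> \<open>The second factor is treated first. With \<open>x\<close> fixed its experiment
    has the fixed parameter \<open>c1 x\<close>, so its remainder can be replaced by an independent
    \<open>y'\<close>. Afterwards the integrand depends on \<open>x\<close> only through
    \<open>c1 x\<close> and \<open>r1 x\<close>, so that \<open>s1\<close> applies; the rest is
    Fubini.\<close>
  also have "\<dots> = (\<integral>\<^sup>+x. \<integral>\<^sup>+y. \<integral>\<^sup>+y'. G ((c1 x, c2 (c1 x) y), (r1 x, y')) \<partial>M2 \<partial>M2 \<partial>M1)"
  proof (rule nn_integral_cong)
    fix x assume x: "x \<in> space M1"
    note [measurable] = c1s[OF x]
    have "(\<lambda>(c, y). G ((c1 x, c), (r1 x, y))) \<in> borel_measurable (C2 \<Otimes>\<^sub>M M2)"
      by measurable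
    from splitsD[OF s2 this] c1s[OF x]
    show "(\<integral>\<^sup>+y. G ((c1 x, c2 (c1 x) y), (r1 x, r2 (c1 x) y)) \<partial>M2)
      = (\<integral>\<^sup>+y. \<integral>\<^sup>+y'. G ((c1 x, c2 (c1 x) y), (r1 x, y')) \<partial>M2 \<partial>M2)"
      by simp
  qed
  also have "\<dots> = (\<integral>\<^sup>+x. \<integral>\<^sup>+x'. \<integral>\<^sup>+y. \<integral>\<^sup>+y'. G ((c1 x, c2 (c1 x) y), (x', y')) \<partial>M2 \<partial>M2 \<partial>M1 \<partial>M1)"
  proof -
    have "(\<lambda>(z, x). \<integral>\<^sup>+y. \<integral>\<^sup>+y'. G ((z, c2 z y), (x, y')) \<partial>M2 \<partial>M2) \<in> borel_measurable (C1 \<Otimes>\<^sub>M M1)"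
      by measurable
    from splitsD[OF s1 this] show ?thesis by simp
  qed
  also have "\<dots> = (\<integral>\<^sup>+x. \<integral>\<^sup>+y. \<integral>\<^sup>+x'. \<integral>\<^sup>+y'. G ((c1 x, c2 (c1 x) y), (x', y')) \<partial>M2 \<partial>M1 \<partial>M2 \<partial>M1)"
  proof (rule nn_integral_cong)
    fix x assume x: "x \<in> space M1"
    note [measurable] = c1s[OF x]
    show "(\<integral>\<^sup>+x'. \<integral>\<^sup>+y. \<integral>\<^sup>+y'. G ((c1 x, c2 (c1 x) y), (x', y')) \<partial>M2 \<partial>M2 \<partial>M1)
      = (\<integral>\<^sup>+y. \<integral>\<^sup>+x'. \<integral>\<^sup>+y'. G ((c1 x, c2 (c1 x) y), (x', y')) \<partial>M2 \<partial>M1 \<partial>M2)"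
      by (rule Fubini'[symmetric]) measurable
  qed
  also have "\<dots> = (\<integral>\<^sup>+x. \<integral>\<^sup>+y. \<integral>\<^sup>+w. G ((c1 x, c2 (c1 x) y), w) \<partial>(M1 \<Otimes>\<^sub>M M2) \<partial>M2 \<partial>M1)"
  proof (intro nn_integral_cong)
    fix x y assume x: "x \<in> space M1" and [measurable]: "y \<in> space M2"
    note [measurable] = c1s[OF x]
    show "(\<integral>\<^sup>+x'. \<integral>\<^sup>+y'. G ((c1 x, c2 (c1 x) y), (x', y')) \<partial>M2 \<partial>M1)
      = (\<integral>\<^sup>+w. G ((c1 x, c2 (c1 x) y), w) \<partial>(M1 \<Otimes>\<^sub>M M2))"
      by (rule M2.nn_integral_fst) measurable
  qed
  also have "\<dots> = (\<integral>\<^sup>+z. \<integral>\<^sup>+w. G ((\<lambda>(x, y). (c1 x, c2 (c1 x) y)) z, w) \<partial>(M1 \<Otimes>\<^sub>M M2) \<partial>(M1 \<Otimes>\<^sub>M M2))"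
  proof -
    have "(\<lambda>z. \<integral>\<^sup>+w. G ((\<lambda>(x, y). (c1 x, c2 (c1 x) y)) z, w) \<partial>(M1 \<Otimes>\<^sub>M M2)) \<in> borel_measurable (M1 \<Otimes>\<^sub>M M2)"
      by measurable
    from M2.nn_integral_fst[OF this] show ?thesis by simp
  qed
  finally show "(\<integral>\<^sup>+z. G ((\<lambda>(x, y). (c1 x, c2 (c1 x) y)) z, (\<lambda>(x, y). (r1 x, r2 (c1 x) y)) z) \<partial>(M1 \<Otimes>\<^sub>M M2))
    = (\<integral>\<^sup>+z. \<integral>\<^sup>+w. G ((\<lambda>(x, y). (c1 x, c2 (c1 x) y)) z, w) \<partial>(M1 \<Otimes>\<^sub>M M2) \<partial>(M1 \<Otimes>\<^sub>M M2))" .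
qed

text \<open>One coordinate is peeled off at a time by \<open>splits_pair\<close>, here with a second
  experiment that ignores the first outcome; \<open>ins\<close> moves between the product over
  \<open>insert i I\<close> and a binary product. The intended coordinates are the arrival streams,
  all observed over the same service time.\<close>

lemma splits_PiM:
  assumes "finite I" "\<And>i. i \<in> I \<Longrightarrow> prob_space (M i)" "\<And>i. i \<in> I \<Longrightarrow> splits (M i) C (c i) (r i)"
  shows "splits (PiM I M) (\<Pi>\<^sub>M i\<in>I. C) (\<lambda>x. \<lambda>i\<in>I. c i (x i)) (\<lambda>x. \<lambda>i\<in>I. r i (x i))"
  using assms
proof (induction I rule: finite_induct)
  case empty
  show ?case
    by (simp add: splits_def PiM_empty nn_integral_count_space_finite measurable_count_space_eq1 restrict_def)
next
  case (insert i I)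
  let ?c = "\<lambda>I x. \<lambda>j\<in>I. c j (x j)" and ?r = "\<lambda>I x. \<lambda>j\<in>I. r j (x j)"
  have IH: "splits (PiM I M) (\<Pi>\<^sub>M i\<in>I. C) (?c I) (?r I)"
    by (rule insert.IH) (use insert in auto)
  have pM: "prob_space (M i)" "prob_space (PiM I M)"
    using insert by (auto intro!: prob_space_PiM)
  have si: "splits (M i) C (c i) (r i)" using insert by auto
  have cm: "c j \<in> M j \<rightarrow>\<^sub>M C" "r j \<in> M j \<rightarrow>\<^sub>M M j" if "j \<in> insert i I" for j
    using insert(5)[OF that] by (auto simp: splits_def)
  have cm'[measurable]: "?c I \<in> PiM I M \<rightarrow>\<^sub>M (\<Pi>\<^sub>M i\<in>I. C)" "?r I \<in> PiM I M \<rightarrow>\<^sub>M PiM I M"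
    "c i \<in> M i \<rightarrow>\<^sub>M C" "r i \<in> M i \<rightarrow>\<^sub>M M i"
    using IH cm[of i] by (auto simp: splits_def)
  have pair: "splits (M i \<Otimes>\<^sub>M PiM I M) (C \<Otimes>\<^sub>M (\<Pi>\<^sub>M i\<in>I. C)) (\<lambda>(x, y). (c i x, ?c I y)) (\<lambda>(x, y). (r i x, ?r I y))"
    by (rule splits_pair[OF pM si IH])
      (simp_all add: case_prod_beta' measurable_compose[OF measurable_snd cm'(1)] measurable_compose[OF measurable_snd cm'(2)])
  have ins: "(\<integral>\<^sup>+x. f x \<partial>PiM (insert i I) M) = (\<integral>\<^sup>+z. f ((snd z)(i := fst z)) \<partial>(M i \<Otimes>\<^sub>M PiM I M))"
    if [measurable]: "f \<in> borel_measurable (PiM (insert i I) M)" for f :: "_ \<Rightarrow> ennreal"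
  proof -
    have "(\<integral>\<^sup>+x. f x \<partial>PiM (insert i I) M) = (\<integral>\<^sup>+x. f x \<partial>distr (M i \<Otimes>\<^sub>M PiM I M) (PiM (insert i I) M) (\<lambda>(x, X). X(i := x)))"
      using distr_pair_PiM_eq_PiM[of I M i] insert.prems by simp
    also have "\<dots> = (\<integral>\<^sup>+z. f (case z of (x, X) \<Rightarrow> X(i := x)) \<partial>(M i \<Otimes>\<^sub>M PiM I M))"
      by (rule nn_integral_distr) measurable
    finally show ?thesis by (simp add: case_prod_beta')
  qed
  have upd: "?c (insert i I) (X(i := x)) = (?c I X)(i := c i x)" "?r (insert i I) (X(i := x)) = (?r I X)(i := r i x)" for x X
    using insert(2) by (auto simp: fun_eq_iff restrict_def)
  show ?case
    unfolding splits_def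
  proof (intro conjI ballI)
    show C[measurable]: "?c (insert i I) \<in> PiM (insert i I) M \<rightarrow>\<^sub>M (\<Pi>\<^sub>M i\<in>insert i I. C)"
      "?r (insert i I) \<in> PiM (insert i I) M \<rightarrow>\<^sub>M PiM (insert i I) M"
      by (intro measurable_restrict; rule measurable_compose[OF _ cm(1)] measurable_compose[OF _ cm(2)];
          auto intro: measurable_component_singleton)+
    fix G :: "_ \<Rightarrow> ennreal"
    assume [measurable]: "G \<in> borel_measurable ((\<Pi>\<^sub>M i\<in>insert i I. C) \<Otimes>\<^sub>M PiM (insert i I) M)"
    interpret PI: prob_space "PiM (insert i I) M"
      using insert by (auto intro!: prob_space_PiM)
    have "(\<integral>\<^sup>+x. G (?c (insert i I) x, ?r (insert i I) x) \<partial>PiM (insert i I) M)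
      = (\<integral>\<^sup>+z. G ((?c I (snd z))(i := c i (fst z)), (?r I (snd z))(i := r i (fst z))) \<partial>(M i \<Otimes>\<^sub>M PiM I M))"
      by (subst ins) (measurable, simp only: upd)
    also have "\<dots> = (\<integral>\<^sup>+z. \<integral>\<^sup>+w. G ((?c I (snd z))(i := c i (fst z)), (snd w)(i := fst w)) \<partial>(M i \<Otimes>\<^sub>M PiM I M) \<partial>(M i \<Otimes>\<^sub>M PiM I M))"
    proof -
      have "(\<lambda>u. G ((snd (fst u))(i := fst (fst u)), (snd (snd u))(i := fst (snd u))))
        \<in> borel_measurable ((C \<Otimes>\<^sub>M (\<Pi>\<^sub>M i\<in>I. C)) \<Otimes>\<^sub>M (M i \<Otimes>\<^sub>M PiM I M))"
        by measurable
      from splitsD[OF pair this] show ?thesis by (simp add: case_prod_beta')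
    qed
    also have "\<dots> = (\<integral>\<^sup>+z. \<integral>\<^sup>+w. G ((?c I (snd z))(i := c i (fst z)), w) \<partial>PiM (insert i I) M \<partial>(M i \<Otimes>\<^sub>M PiM I M))"
    proof (rule nn_integral_cong)
      fix z assume "z \<in> space (M i \<Otimes>\<^sub>M PiM I M)"
      then have zs[measurable]: "fst z \<in> space (M i)" "snd z \<in> space (PiM I M)"
        by (auto simp: space_pair_measure)
      have [measurable]: "?c I (snd z) \<in> space (\<Pi>\<^sub>M i\<in>I. C)" "c i (fst z) \<in> space C"
        using measurable_space[OF cm'(1) zs(2)] measurable_space[OF cm'(3) zs(1)] by simp_all
      have [measurable]: "(?c I (snd z))(i := c i (fst z)) \<in> space (\<Pi>\<^sub>M i\<in>insert i I. C)"
        using \<open>?c I (snd z) \<in> _\<close> \<open>c i (fst z) \<in> _\<close> by (auto simp: space_PiM PiE_iff extensional_def)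
      show "(\<integral>\<^sup>+w. G ((?c I (snd z))(i := c i (fst z)), (snd w)(i := fst w)) \<partial>(M i \<Otimes>\<^sub>M PiM I M))
        = (\<integral>\<^sup>+w. G ((?c I (snd z))(i := c i (fst z)), w) \<partial>PiM (insert i I) M)"
        by (rule ins[symmetric]) measurable
    qed
    also have "\<dots> = (\<integral>\<^sup>+x. \<integral>\<^sup>+w. G (?c (insert i I) x, w) \<partial>PiM (insert i I) M \<partial>PiM (insert i I) M)"
      by (subst (2) ins) (measurable, simp only: upd)
    finally show "(\<integral>\<^sup>+x. G (?c (insert i I) x, ?r (insert i I) x) \<partial>PiM (insert i I) M)
      = (\<integral>\<^sup>+x. \<integral>\<^sup>+w. G (?c (insert i I) x, w) \<partial>PiM (insert i I) M \<partial>PiM (insert i I) M)" .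
  qed
qed

section \<open>The chain of services\<close>

definition next_queues :: "nat \<Rightarrow> nat \<Rightarrow> (nat \<Rightarrow> nat) \<Rightarrow> (nat \<Rightarrow> nat) \<Rightarrow> nat option \<Rightarrow> nat \<Rightarrow> nat" where
  "next_queues d n x c rt m =
     (if m \<le> d then x m + c m - (if m = n then 1 else 0) + (if rt = Some m then 1 else 0) else 0)"

text \<open>One service, with \<open>c\<close> arrivals during it; states are pairs of a station and queue lengths.\<close>

definition poll_step :: "nat \<Rightarrow> (nat \<Rightarrow> regime) \<Rightarrow> nat \<times> (nat \<Rightarrow> nat) \<Rightarrow> (nat \<Rightarrow> nat) \<Rightarrow> real \<Rightarrow> nat \<times> (nat \<Rightarrow> nat)" where
  "poll_step d q y c u =
     (if no_customers d (snd y) then y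
      else let x' = next_queues d (fst y) (snd y) c (route d (fst y) (snd (q (fst y))) u)
           in (serving_visit d x' (fst y) mod (d + 1), x'))"

text \<open>Service requirements and routing variables, paired with the arrival streams.\<close>

type_synonym env = "((nat \<Rightarrow> real) \<times> (nat \<Rightarrow> real)) \<times> (nat \<Rightarrow> nat \<Rightarrow> real)"

text \<open>The absolute value makes the service time nonnegative for every \<open>e\<close>, not
  merely almost every one: \<open>splits_pair\<close> asks for regeneration of the second factor at
  every outcome of the first.\<close>

definition service_time :: "(nat \<Rightarrow> regime) \<Rightarrow> nat \<Rightarrow> real \<Rightarrow> real" where
  "service_time q n e = \<bar>e\<bar> / fst (q n)"

definition poll_counts :: "nat \<Rightarrow> (nat \<Rightarrow> regime) \<Rightarrow> nat \<Rightarrow> real \<Rightarrow> (nat \<Rightarrow> nat \<Rightarrow> real) \<Rightarrow> nat \<Rightarrow> nat" where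
  "poll_counts d q n e a = (\<lambda>m\<in>{0..d}. arrivals (a m) (service_time q n e))"

definition poll_resid :: "nat \<Rightarrow> (nat \<Rightarrow> regime) \<Rightarrow> nat \<Rightarrow> real \<Rightarrow> (nat \<Rightarrow> nat \<Rightarrow> real) \<Rightarrow> nat \<Rightarrow> nat \<Rightarrow> real" where
  "poll_resid d q n e a = (\<lambda>m\<in>{0..d}. resid (a m) (service_time q n e))"

text \<open>A skew product: the environment is advanced past the service just performed, by an
  amount that depends on the current station. The first component of the iterates is the Markov
  chain of the homogeneous model.\<close>

definition poll_map :: "nat \<Rightarrow> (nat \<Rightarrow> regime) \<Rightarrow> (nat \<times> (nat \<Rightarrow> nat)) \<times> env \<Rightarrow> (nat \<times> (nat \<Rightarrow> nat)) \<times> env" where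
  "poll_map d q = (\<lambda>(y, ((e, u), a)). (poll_step d q y (poll_counts d q (fst y) (e 0) a) (u 0),
     ((\<lambda>i. e (Suc i), \<lambda>i. u (Suc i)), poll_resid d q (fst y) (e 0) a)))"

abbreviation unif_law :: "real measure" where
  "unif_law \<equiv> uniform_measure lborel {0..<1}"

text \<open>The arrival streams come second because the time over which they are observed is
  determined by the service requirement, in the direction of dependence that
  \<open>splits_pair\<close> allows.\<close>

definition env_law :: "nat \<Rightarrow> (nat \<Rightarrow> real) \<Rightarrow> env measure" where
  "env_law d lam = ((\<Pi>\<^sub>M j\<in>UNIV. exponential_law 1) \<Otimes>\<^sub>M (\<Pi>\<^sub>M j\<in>UNIV. unif_law)) \<Otimes>\<^sub>M
     (\<Pi>\<^sub>M m\<in>{0..d}. arrival_law (lam m))"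

abbreviation state_space :: "(nat \<times> (nat \<Rightarrow> nat)) measure" where
  "state_space \<equiv> count_space UNIV \<Otimes>\<^sub>M (\<Pi>\<^sub>M m\<in>UNIV. count_space UNIV)"

section \<open>Measurability and regeneration of the environment\<close>

lemma prob_space_unif_law: "prob_space unif_law"
  by (intro prob_space_uniform_measure) auto

lemma prob_space_env_law:
  assumes "\<And>m. m \<le> d \<Longrightarrow> 0 < lam m"
  shows "prob_space (env_law d lam)"
  unfolding env_law_def
  by (intro prob_space_pair prob_space_PiM prob_space_exponential_law prob_space_unif_law) (auto intro: assms)

lemma measurable_count_space_comp2:
  fixes f :: "'a \<Rightarrow> 'b::countable" and g :: "'a \<Rightarrow> 'c::countable"
  assumes "f \<in> M \<rightarrow>\<^sub>M count_space UNIV" "g \<in> M \<rightarrow>\<^sub>M count_space UNIV"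
  shows "(\<lambda>x. h (f x) (g x)) \<in> M \<rightarrow>\<^sub>M count_space UNIV"
proof -
  have "(\<lambda>x. (f x, g x)) \<in> M \<rightarrow>\<^sub>M count_space UNIV \<Otimes>\<^sub>M count_space UNIV"
    using assms by measurable
  then have "(\<lambda>x. (f x, g x)) \<in> M \<rightarrow>\<^sub>M count_space UNIV"
    by (simp add: pair_measure_countable)
  from measurable_compose[OF this, of "case_prod h" "count_space UNIV"] show ?thesis by simp
qed

lemma measurable_count_space_comp:
  assumes "f \<in> M \<rightarrow>\<^sub>M count_space UNIV" "range h \<subseteq> space N"
  shows "(\<lambda>x. h (f x)) \<in> M \<rightarrow>\<^sub>M N"
  using assms by (intro measurable_compose[OF assms(1)]) auto

lemma measurable_route[measurable]: "route d n \<gamma> \<in> borel \<rightarrow>\<^sub>M count_space UNIV"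
proof -
  have "(\<lambda>u. LEAST k. u < (\<Sum>i=1..k. \<gamma> i)) \<in> borel \<rightarrow>\<^sub>M count_space UNIV"
    by measurable
  then have [measurable]: "(\<lambda>u. Some ((n + (LEAST k. u < (\<Sum>i=1..k. \<gamma> i))) mod (d + 1))) \<in> borel \<rightarrow>\<^sub>M count_space UNIV"
    by (rule measurable_count_space_comp) auto
  show ?thesis
    unfolding route_def[abs_def] by measurable
qed

lemma measurable_no_customers[measurable (raw)]:
  assumes [measurable]: "\<And>m. (\<lambda>z. x z m) \<in> M \<rightarrow>\<^sub>M count_space (UNIV :: nat set)"
  shows "Measurable.pred M (\<lambda>z. no_customers d (x z))"
  unfolding no_customers_def by measurable

lemma measurable_serving_visit:
  assumes [measurable]: "\<And>m. (\<lambda>z. x z m) \<in> M \<rightarrow>\<^sub>M count_space (UNIV :: nat set)"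
    and [measurable]: "v \<in> M \<rightarrow>\<^sub>M count_space UNIV"
  shows "(\<lambda>z. serving_visit d (x z) (v z)) \<in> M \<rightarrow>\<^sub>M count_space UNIV"
  unfolding serving_visit_def by measurable

lemma measurable_next_queues:
  assumes x: "\<And>m. m \<le> d \<Longrightarrow> (\<lambda>z. x z m) \<in> M \<rightarrow>\<^sub>M count_space (UNIV :: nat set)"
    and c: "\<And>m. m \<le> d \<Longrightarrow> (\<lambda>z. c z m) \<in> M \<rightarrow>\<^sub>M count_space (UNIV :: nat set)"
    and n: "n \<in> M \<rightarrow>\<^sub>M count_space UNIV" and rt: "rt \<in> M \<rightarrow>\<^sub>M count_space UNIV"
  shows "(\<lambda>z. next_queues d (n z) (x z) (c z) (rt z) m) \<in> M \<rightarrow>\<^sub>M count_space UNIV"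
proof (cases "m \<le> d")
  case True
  have 1: "(\<lambda>z. x z m + c z m) \<in> M \<rightarrow>\<^sub>M count_space UNIV"
    by (rule measurable_count_space_comp2[OF x[OF True] c[OF True]])
  have "(\<lambda>z. x z m + c z m - (if m = n z then 1 else 0)) \<in> M \<rightarrow>\<^sub>M count_space UNIV"
    by (rule measurable_count_space_comp2[OF 1 n, of "\<lambda>k n. k - (if m = n then 1 else 0)"])
  from measurable_count_space_comp2[OF this rt, of "\<lambda>k rt. k + (if rt = Some m then 1 else 0)"]
  show ?thesis using True by (simp add: next_queues_def)
qed (simp add: next_queues_def)

lemma measurable_state_component:
  assumes "f \<in> M \<rightarrow>\<^sub>M state_space"
  shows "(\<lambda>z. fst (f z)) \<in> M \<rightarrow>\<^sub>M count_space UNIV" "(\<lambda>z. snd (f z) m) \<in> M \<rightarrow>\<^sub>M count_space UNIV"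
  using measurable_compose[OF assms measurable_fst]
    measurable_compose[OF measurable_compose[OF assms measurable_snd] measurable_component_singleton[of m UNIV]]
  by simp_all

lemma measurable_poll_step[measurable (raw)]:
  assumes y[measurable]: "y \<in> M \<rightarrow>\<^sub>M state_space" and c[measurable]: "c \<in> M \<rightarrow>\<^sub>M (\<Pi>\<^sub>M m\<in>{0..d}. count_space UNIV)"
    and u[measurable]: "u \<in> borel_measurable M"
  shows "(\<lambda>z. poll_step d q (y z) (c z) (u z)) \<in> M \<rightarrow>\<^sub>M state_space"
proof -
  note [measurable] = measurable_state_component[OF y]
  have cm: "(\<lambda>z. c z m) \<in> M \<rightarrow>\<^sub>M count_space UNIV" if "m \<le> d" for m
    using that by (intro measurable_compose[OF c measurable_component_singleton]) simp
  have rt: "(\<lambda>z. route d (fst (y z)) (snd (q (fst (y z)))) (u z)) \<in> M \<rightarrow>\<^sub>M count_space UNIV"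
    by (rule measurable_compose_countable[where f="\<lambda>n z. route d n (snd (q n)) (u z)"]) measurable
  let ?x = "\<lambda>z. next_queues d (fst (y z)) (snd (y z)) (c z) (route d (fst (y z)) (snd (q (fst (y z)))) (u z))"
  have x[measurable]: "(\<lambda>z. ?x z m) \<in> M \<rightarrow>\<^sub>M count_space UNIV" for m
    by (rule measurable_next_queues[OF _ cm _ rt]) measurable
  have x'[measurable]: "?x \<in> M \<rightarrow>\<^sub>M (\<Pi>\<^sub>M m\<in>UNIV. count_space UNIV)"
    by (rule measurable_PiM_single') auto
  have "(\<lambda>z. serving_visit d (?x z) (fst (y z))) \<in> M \<rightarrow>\<^sub>M count_space UNIV"
    by (rule measurable_serving_visit) measurable
  then have [measurable]: "(\<lambda>z. serving_visit d (?x z) (fst (y z)) mod (d + 1)) \<in> M \<rightarrow>\<^sub>M count_space UNIV"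
    by (rule measurable_count_space_comp) auto
  show ?thesis
    unfolding poll_step_def Let_def by measurable
qed

lemma poll_map_eq:
  "poll_map d q (y, \<omega>) = (poll_step d q y (poll_counts d q (fst y) (fst (fst \<omega>) 0) (snd \<omega>)) (snd (fst \<omega>) 0),
     ((\<lambda>i. fst (fst \<omega>) (Suc i), \<lambda>i. snd (fst \<omega>) (Suc i)), poll_resid d q (fst y) (fst (fst \<omega>) 0) (snd \<omega>)))"
  by (simp add: poll_map_def split: prod.splits)

lemma sets_arrival_laws[measurable_cong]:
  "sets (\<Pi>\<^sub>M m\<in>{0..d}. arrival_law (lam m)) = sets (\<Pi>\<^sub>M m\<in>{0..d}. \<Pi>\<^sub>M i\<in>(UNIV::nat set). borel :: real measure)"
  by (intro sets_PiM_cong) auto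

lemma measurable_service_time:
  assumes "n \<in> M \<rightarrow>\<^sub>M count_space UNIV" and [measurable]: "e \<in> borel_measurable M"
  shows "(\<lambda>z. service_time q (n z) (e z)) \<in> borel_measurable M"
proof -
  have [measurable]: "(\<lambda>z. fst (q (n z))) \<in> borel_measurable M"
    by (rule measurable_count_space_comp[OF assms(1)]) simp
  show ?thesis unfolding service_time_def by measurable
qed

lemma measurable_poll_counts_resid:
  assumes n: "n \<in> M \<rightarrow>\<^sub>M count_space UNIV" and e: "e \<in> borel_measurable M"
    and a: "a \<in> M \<rightarrow>\<^sub>M (\<Pi>\<^sub>M m\<in>{0..d}. arrival_law (lam m))"
  shows "(\<lambda>z. poll_counts d q (n z) (e z) (a z)) \<in> M \<rightarrow>\<^sub>M (\<Pi>\<^sub>M m\<in>{0..d}. count_space UNIV)"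
    and "(\<lambda>z. poll_resid d q (n z) (e z) (a z)) \<in> M \<rightarrow>\<^sub>M (\<Pi>\<^sub>M m\<in>{0..d}. arrival_law (lam m))"
proof -
  note s = measurable_service_time[OF n e, of q]
  have am: "(\<lambda>z. a z m) \<in> M \<rightarrow>\<^sub>M (\<Pi>\<^sub>M i\<in>(UNIV::nat set). borel :: real measure)" if "m \<in> {0..d}" for m
  proof -
    have "(\<lambda>z. a z m) \<in> M \<rightarrow>\<^sub>M arrival_law (lam m)"
      using that by (intro measurable_compose[OF a measurable_component_singleton]) simp
    moreover have "sets (arrival_law (lam m)) = sets (\<Pi>\<^sub>M i\<in>(UNIV::nat set). borel :: real measure)"
      by (intro sets_PiM_cong) auto
    ultimately show ?thesis
      using measurable_cong_sets[of M M] by blast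
  qed
  show "(\<lambda>z. poll_counts d q (n z) (e z) (a z)) \<in> M \<rightarrow>\<^sub>M (\<Pi>\<^sub>M m\<in>{0..d}. count_space UNIV)"
    unfolding poll_counts_def by (intro measurable_restrict measurable_arrivals am s)
  have "(\<lambda>z. poll_resid d q (n z) (e z) (a z)) \<in> M \<rightarrow>\<^sub>M (\<Pi>\<^sub>M m\<in>{0..d}. \<Pi>\<^sub>M i\<in>(UNIV::nat set). borel)"
    unfolding poll_resid_def by (intro measurable_restrict measurable_resid am s)
  then show "(\<lambda>z. poll_resid d q (n z) (e z) (a z)) \<in> M \<rightarrow>\<^sub>M (\<Pi>\<^sub>M m\<in>{0..d}. arrival_law (lam m))"
    by (simp add: measurable_cong_sets[OF refl sets_arrival_laws])
qed

lemma splits_arrival_laws: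
  assumes "\<And>m. m \<le> d \<Longrightarrow> 0 < lam m" "0 < fst (q n)"
  shows "splits (\<Pi>\<^sub>M m\<in>{0..d}. arrival_law (lam m)) (\<Pi>\<^sub>M m\<in>{0..d}. count_space UNIV)
    (poll_counts d q n e) (poll_resid d q n e)"
  unfolding poll_counts_def[abs_def] poll_resid_def[abs_def]
  by (rule splits_PiM) (use assms in \<open>auto intro!: prob_space_arrival_law splits_arrivals simp: service_time_def\<close>)

text \<open>An instance of \<open>splits_pair\<close>: first the heads of the two i.i.d. sequences
  are drawn, then the streams are cut at the service time which these heads determine.\<close>

lemma splits_env_law:
  assumes "\<And>m. m \<le> d \<Longrightarrow> 0 < lam m" "0 < fst (q n)"
  shows "splits (env_law d lam) ((exponential_law 1 \<Otimes>\<^sub>M unif_law) \<Otimes>\<^sub>M (\<Pi>\<^sub>M m\<in>{0..d}. count_space UNIV))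
    (\<lambda>\<omega>. ((fst (fst \<omega>) 0, snd (fst \<omega>) 0), poll_counts d q n (fst (fst \<omega>) 0) (snd \<omega>)))
    (\<lambda>\<omega>. ((\<lambda>i. fst (fst \<omega>) (Suc i), \<lambda>i. snd (fst \<omega>) (Suc i)), poll_resid d q n (fst (fst \<omega>) 0) (snd \<omega>)))"
proof -
  let ?E = "\<Pi>\<^sub>M j\<in>(UNIV::nat set). exponential_law 1" and ?U = "\<Pi>\<^sub>M j\<in>(UNIV::nat set). unif_law"
  have E: "prob_space ?E" "prob_space ?U"
    by (auto intro!: prob_space_PiM prob_space_exponential_law prob_space_unif_law)
  have EU: "splits (?E \<Otimes>\<^sub>M ?U) (exponential_law 1 \<Otimes>\<^sub>M unif_law) (\<lambda>(e, u). (e 0, u 0)) (\<lambda>(e, u). (\<lambda>i. e (Suc i), \<lambda>i. u (Suc i)))"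
    by (rule splits_pair[OF E splits_iid splits_iid])
      (auto intro!: prob_space_exponential_law prob_space_unif_law measurable_compose[OF measurable_snd measurable_PiM_single']
        measurable_compose[OF measurable_snd measurable_component_singleton] simp: case_prod_beta' space_PiM PiE_iff)
  have "splits (env_law d lam) ((exponential_law 1 \<Otimes>\<^sub>M unif_law) \<Otimes>\<^sub>M (\<Pi>\<^sub>M m\<in>{0..d}. count_space UNIV))
    (\<lambda>(x, y). ((\<lambda>(e, u). (e 0, u 0)) x, (\<lambda>z. poll_counts d q n (fst z)) ((\<lambda>(e, u). (e 0, u 0)) x) y))
    (\<lambda>(x, y). ((\<lambda>(e, u). (\<lambda>i. e (Suc i), \<lambda>i. u (Suc i))) x, (\<lambda>z. poll_resid d q n (fst z)) ((\<lambda>(e, u). (e 0, u 0)) x) y))"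
    unfolding env_law_def
  proof (rule splits_pair[OF _ _ EU])
    show "prob_space (\<Pi>\<^sub>M m\<in>{0..d}. arrival_law (lam m))"
      by (intro prob_space_PiM prob_space_exponential_law) (use assms in auto)
    show "prob_space (?E \<Otimes>\<^sub>M ?U)" by (intro prob_space_pair E)
    show "splits (\<Pi>\<^sub>M m\<in>{0..d}. arrival_law (lam m)) (\<Pi>\<^sub>M m\<in>{0..d}. count_space UNIV)
      (poll_counts d q n (fst z)) (poll_resid d q n (fst z))" for z :: "real \<times> real"
      by (rule splits_arrival_laws) (use assms in auto)
  qed (unfold case_prod_beta', (rule measurable_poll_counts_resid; measurable)+)
  then show ?thesis by (simp add: case_prod_beta')
qed

lemma measurable_env_components:
  "(\<lambda>\<omega>. fst (fst \<omega>) i) \<in> borel_measurable (env_law d lam)"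
  "(\<lambda>\<omega>. snd (fst \<omega>) i) \<in> borel_measurable (env_law d lam)"
  "snd \<in> env_law d lam \<rightarrow>\<^sub>M (\<Pi>\<^sub>M m\<in>{0..d}. arrival_law (lam m))"
  unfolding env_law_def
  using measurable_compose[OF measurable_compose[OF measurable_fst measurable_fst] measurable_component_singleton[of i UNIV]]
    measurable_compose[OF measurable_compose[OF measurable_fst measurable_snd] measurable_component_singleton[of i UNIV]]
  by (simp_all add: measurable_cong_sets[OF refl sets_exponential_law] measurable_cong_sets[OF refl sets_uniform_measure])

lemma measurable_poll_map[measurable]:
  "poll_map d q \<in> state_space \<Otimes>\<^sub>M env_law d lam \<rightarrow>\<^sub>M state_space \<Otimes>\<^sub>M env_law d lam"
proof -
  let ?M = "state_space \<Otimes>\<^sub>M env_law d lam"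
  have y: "fst \<in> ?M \<rightarrow>\<^sub>M state_space" by measurable
  have eu: "(\<lambda>z. fst (fst (snd z)) i) \<in> borel_measurable ?M" "(\<lambda>z. snd (fst (snd z)) i) \<in> borel_measurable ?M"
    "(\<lambda>z. snd (snd z)) \<in> ?M \<rightarrow>\<^sub>M (\<Pi>\<^sub>M m\<in>{0..d}. arrival_law (lam m))" for i
    using measurable_compose[OF measurable_snd measurable_env_components(1)]
      measurable_compose[OF measurable_snd measurable_env_components(2)]
      measurable_compose[OF measurable_snd measurable_env_components(3)] by auto
  note m = measurable_poll_counts_resid[OF measurable_state_component(1)[OF y] eu(1)[of 0] eu(3), of q]
  have e: "(\<lambda>z i. fst (fst (snd z)) (Suc i)) \<in> ?M \<rightarrow>\<^sub>M (\<Pi>\<^sub>M j\<in>UNIV. exponential_law 1)"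
    by (intro measurable_PiM_single'; simp add: eu measurable_cong_sets[OF refl sets_exponential_law])
  have u: "(\<lambda>z i. snd (fst (snd z)) (Suc i)) \<in> ?M \<rightarrow>\<^sub>M (\<Pi>\<^sub>M j\<in>UNIV. unif_law)"
    by (intro measurable_PiM_single'; simp add: eu measurable_cong_sets[OF refl sets_uniform_measure])
  have s: "(\<lambda>z. poll_step d q (fst z) (poll_counts d q (fst (fst z)) (fst (fst (snd z)) 0) (snd (snd z))) (snd (fst (snd z)) 0))
    \<in> ?M \<rightarrow>\<^sub>M state_space"
    by (rule measurable_poll_step[OF y m(1) eu(2)])
  have "(\<lambda>z. ((\<lambda>i. fst (fst (snd z)) (Suc i), \<lambda>i. snd (fst (snd z)) (Suc i)),
      poll_resid d q (fst (fst z)) (fst (fst (snd z)) 0) (snd (snd z)))) \<in> ?M \<rightarrow>\<^sub>M env_law d lam"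
    using measurable_Pair[OF measurable_Pair[OF e u] m(2)] by (fold env_law_def)
  from measurable_Pair[OF s this] have "(\<lambda>z. poll_map d q (fst z, snd z)) \<in> ?M \<rightarrow>\<^sub>M ?M"
    by (simp only: poll_map_eq)
  then show ?thesis by simp
qed

text \<open>The Markov property of the chain of services, in a form that avoids conditional
  expectations.\<close>

lemma nn_integral_poll_map:
  assumes "\<And>m. m \<le> d \<Longrightarrow> 0 < lam m" "0 < fst (q (fst y))"
    and H: "H \<in> borel_measurable (state_space \<Otimes>\<^sub>M env_law d lam)"
  shows "(\<integral>\<^sup>+\<omega>. H (poll_map d q (y, \<omega>)) \<partial>env_law d lam)
    = (\<integral>\<^sup>+\<omega>. \<integral>\<^sup>+\<omega>'. H (fst (poll_map d q (y, \<omega>)), \<omega>') \<partial>env_law d lam \<partial>env_law d lam)"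
proof -
  note [measurable] = H
  have [measurable]: "y \<in> space state_space" by (simp add: space_pair_measure space_PiM)
  have "(\<lambda>w. H (poll_step d q y (snd (fst w)) (snd (fst (fst w))), snd w))
    \<in> borel_measurable (((exponential_law 1 \<Otimes>\<^sub>M unif_law) \<Otimes>\<^sub>M (\<Pi>\<^sub>M m\<in>{0..d}. count_space UNIV)) \<Otimes>\<^sub>M env_law d lam)"
    by measurable
  from splitsD[OF splits_env_law this, of q "fst y"] assms
  show ?thesis by (simp add: poll_map_eq)
qed

section \<open>Emptying by a decreasing function\<close>

lemma measurable_poll_map_funpow[measurable]:
  "poll_map d q ^^ j \<in> state_space \<Otimes>\<^sub>M env_law d lam \<rightarrow>\<^sub>M state_space \<Otimes>\<^sub>M env_law d lam"
proof (induction j)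
  case (Suc j)
  from measurable_comp[OF this measurable_poll_map[of d q lam]] show ?case by simp
qed (simp add: id_def)

text \<open>The \<open>j\<close>-step transition operator, read off from the iterated flow;
  \<open>expect_after_Suc\<close> recovers the recursion of a Markov semigroup.\<close>

definition expect_after :: "nat \<Rightarrow> (nat \<Rightarrow> real) \<Rightarrow> (nat \<Rightarrow> regime) \<Rightarrow> nat \<Rightarrow> (nat \<times> (nat \<Rightarrow> nat) \<Rightarrow> ennreal) \<Rightarrow>
    nat \<times> (nat \<Rightarrow> nat) \<Rightarrow> ennreal" where
  "expect_after d lam q j g y = (\<integral>\<^sup>+\<omega>. g (fst ((poll_map d q ^^ j) (y, \<omega>))) \<partial>env_law d lam)"

lemma space_state_space[simp]: "space state_space = UNIV"
  by (auto simp: space_pair_measure space_PiM)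

context
  fixes d :: nat and lam :: "nat \<Rightarrow> real" and q :: "nat \<Rightarrow> regime"
  assumes lam: "\<And>m. m \<le> d \<Longrightarrow> 0 < lam m"
begin

lemma measurable_expect_after:
  assumes g[measurable]: "g \<in> borel_measurable state_space"
  shows "expect_after d lam q j g \<in> borel_measurable state_space"
proof -
  interpret prob_space "env_law d lam" using lam by (rule prob_space_env_law)
  have "(\<lambda>z. g (fst ((poll_map d q ^^ j) z))) \<in> borel_measurable (state_space \<Otimes>\<^sub>M env_law d lam)"
    by measurable
  then show ?thesis
    unfolding expect_after_def[abs_def] by (intro borel_measurable_nn_integral) (simp add: case_prod_beta')
qed

lemma measurable_poll_map_fst: "(\<lambda>\<omega>. fst ((poll_map d q ^^ j) (y, \<omega>))) \<in> env_law d lam \<rightarrow>\<^sub>M state_space"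
proof -
  have "(\<lambda>\<omega>. (y, \<omega>)) \<in> env_law d lam \<rightarrow>\<^sub>M state_space \<Otimes>\<^sub>M env_law d lam"
    by (intro measurable_Pair measurable_const) auto
  from measurable_compose[OF measurable_compose[OF this measurable_poll_map_funpow[where d=d and q=q and j=j and lam=lam]] measurable_fst]
  show ?thesis .
qed

lemma expect_after_Suc:
  assumes "0 < fst (q (fst y))" and g[measurable]: "g \<in> borel_measurable state_space"
  shows "expect_after d lam q (Suc j) g y
    = (\<integral>\<^sup>+\<omega>. expect_after d lam q j g (fst (poll_map d q (y, \<omega>))) \<partial>env_law d lam)"
  unfolding expect_after_def funpow_Suc_right comp_def
  by (rule nn_integral_poll_map[where H="\<lambda>z. g (fst ((poll_map d q ^^ j) z))"]) (use lam assms(1) in measurable)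

text \<open>The drift inequality telescoped along the chain, with \<open>c\<close> the guaranteed
  loss per step. The induction peels off the first step, since that is where the Markov property is
  available.\<close>

lemma expect_after_drift:
  assumes inv: "\<And>y \<omega>. y \<in> I \<Longrightarrow> fst (poll_map d q (y, \<omega>)) \<in> I" "\<And>y. y \<in> I \<Longrightarrow> 0 < fst (q (fst y))"
    and f[measurable]: "f \<in> borel_measurable state_space" and c[measurable]: "c \<in> borel_measurable state_space"
    and drift: "\<And>y. y \<in> I \<Longrightarrow> (\<integral>\<^sup>+\<omega>. f (fst (poll_map d q (y, \<omega>))) \<partial>env_law d lam) + c y \<le> f y"
    and "y \<in> I"
  shows "expect_after d lam q j f y + (\<Sum>i<j. expect_after d lam q i c y) \<le> f y"
  using \<open>y \<in> I\<close>
proof (induction j arbitrary: y)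
  interpret prob_space "env_law d lam" using lam by (rule prob_space_env_law)
  {
    case (0 y)
    then show ?case by (simp add: expect_after_def emeasure_space_1)
  next
    case (Suc j y)
    let ?E = "expect_after d lam q" and ?T = "\<lambda>\<omega>. fst (poll_map d q (y, \<omega>))"
    have T[measurable]: "?T \<in> env_law d lam \<rightarrow>\<^sub>M state_space"
      using measurable_poll_map_fst[of 1 y] by simp
    note [measurable] = measurable_expect_after[OF f] measurable_expect_after[OF c]
    have 0: "?E 0 c y = c y" by (simp add: expect_after_def emeasure_space_1)
    have "?E (Suc j) f y + (\<Sum>i<Suc j. ?E i c y)
      = (\<integral>\<^sup>+\<omega>. ?E j f (?T \<omega>) \<partial>env_law d lam) + ((\<Sum>i<j. \<integral>\<^sup>+\<omega>. ?E i c (?T \<omega>) \<partial>env_law d lam) + c y)"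
      unfolding sum.lessThan_Suc_shift 0 by (simp add: expect_after_Suc inv(2)[OF Suc.prems] add_ac)
    also have "\<dots> = (\<integral>\<^sup>+\<omega>. ?E j f (?T \<omega>) + (\<Sum>i<j. ?E i c (?T \<omega>)) \<partial>env_law d lam) + c y"
      by (simp add: nn_integral_add nn_integral_sum add_ac)
    also have "\<dots> \<le> (\<integral>\<^sup>+\<omega>. f (?T \<omega>) \<partial>env_law d lam) + c y"
      by (intro add_right_mono nn_integral_mono Suc.IH inv Suc.prems)
    also have "\<dots> \<le> f y" by (rule drift[OF Suc.prems])
    finally show ?case .
  }
qed

end

lemma ennreal_top_of_multiples:
  fixes x m :: ennreal
  assumes "0 < m" "\<And>k. of_nat k * m \<le> x"
  shows "x = \<infinity>"
proof (rule ccontr)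
  assume "x \<noteq> \<infinity>"
  then obtain x' where x': "x = ennreal x'" "0 \<le> x'" by (cases x) auto
  have "m \<le> x" using assms(2)[of 1] by simp
  then obtain m' where m': "m = ennreal m'" "0 \<le> m'" using x' by (cases m) (auto simp: top_unique)
  then have "0 < m'" using assms(1) by simp
  then obtain k where "x' < real k * m'" using reals_Archimedean3 by blast
  moreover have "ennreal (real k * m') \<le> ennreal x'"
    using assms(2)[of k] m' x' by (simp add: ennreal_mult ennreal_of_nat_eq_real_of_nat)
  ultimately show False using x' by simp
qed

lemma suminf_ennreal_infinite_lower_bound:
  fixes g :: "nat \<Rightarrow> ennreal"
  assumes "0 < m" "\<exists>\<^sub>\<infinity>j. m \<le> g j"
  shows "(\<Sum>j. g j) = \<infinity>"
proof (rule ennreal_top_of_multiples[OF assms(1)])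
  fix k
  have "infinite {j. m \<le> g j}" using assms(2) by (simp add: INFM_iff_infinite)
  then obtain F where F: "F \<subseteq> {j. m \<le> g j}" "finite F" "card F = k"
    using infinite_arbitrarily_large by blast
  have "of_nat k * m = (\<Sum>j\<in>F. m)" using F by simp
  also have "\<dots> \<le> (\<Sum>j\<in>F. g j)" using F by (intro sum_mono) auto
  also have "\<dots> \<le> (\<Sum>j. g j)" using F by (intro sum_le_suminf) auto
  finally show "of_nat k * m \<le> (\<Sum>j. g j)" .
qed

text \<open>The expected total decrease of \<open>f\<close> is finite, whereas a nonempty system whose \<open>f\<close>-values do
  not tend to infinity visits some state infinitely often.\<close>

lemma AE_eventually_empty:
  assumes lam: "\<And>m. m \<le> d \<Longrightarrow> 0 < lam m"
    and inv: "\<And>y \<omega>. y \<in> I \<Longrightarrow> fst (poll_map d q (y, \<omega>)) \<in> I" "\<And>y. y \<in> I \<Longrightarrow> 0 < fst (q (fst y))"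
    and f[measurable]: "f \<in> borel_measurable state_space" and f_fin: "\<And>y. f y < \<infinity>"
    and drift: "\<And>y. y \<in> I \<Longrightarrow> (\<integral>\<^sup>+\<omega>. f (fst (poll_map d q (y, \<omega>))) \<partial>env_law d lam) \<le> f y"
    and strict: "\<And>y. y \<in> I \<Longrightarrow> \<not> no_customers d (snd y) \<Longrightarrow>
      (\<integral>\<^sup>+\<omega>. f (fst (poll_map d q (y, \<omega>))) \<partial>env_law d lam) < f y"
    and fin: "\<And>k::nat. finite {y \<in> I. f y \<le> of_nat k}"
    and y: "y \<in> I"
  shows "AE \<omega> in env_law d lam. \<exists>j. no_customers d (snd (fst ((poll_map d q ^^ j) (y, \<omega>))))"
proof -
  interpret prob_space "env_law d lam" using lam by (rule prob_space_env_law)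
  \<comment> \<open>The exact mean loss in one step. By \<open>strict\<close> it is positive in
    nonempty states, but nothing bounds it below uniformly.\<close>
  define c where "c y = f y - expect_after d lam q 1 f y" for y
  have e1: "expect_after d lam q 1 f y = (\<integral>\<^sup>+\<omega>. f (fst (poll_map d q (y, \<omega>))) \<partial>env_law d lam)" for y
    by (simp add: expect_after_def)
  note [measurable] = measurable_expect_after[OF lam f]
  have c[measurable]: "c \<in> borel_measurable state_space"
    unfolding c_def by measurable
  let ?Y = "\<lambda>j \<omega>. fst ((poll_map d q ^^ j) (y, \<omega>))"
  have [measurable]: "(\<lambda>\<omega>. c (?Y j \<omega>)) \<in> borel_measurable (env_law d lam)"
    "(\<lambda>\<omega>. f (?Y j \<omega>)) \<in> borel_measurable (env_law d lam)" for j
    using measurable_compose[OF measurable_poll_map_fst c] measurable_compose[OF measurable_poll_map_fst f] lam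
    by blast+
  have Y_I: "?Y j \<omega> \<in> I" for j \<omega>
  proof (induction j)
    case (Suc j)
    then show ?case using inv(1)[of "?Y j \<omega>" "snd ((poll_map d q ^^ j) (y, \<omega>))"] by simp
  qed (use y in simp)
  have main: "expect_after d lam q j f y + (\<Sum>i<j. expect_after d lam q i c y) \<le> f y" for j
  proof (rule expect_after_drift[OF lam inv f c _ y])
    fix y assume "y \<in> I"
    then show "(\<integral>\<^sup>+\<omega>. f (fst (poll_map d q (y, \<omega>))) \<partial>env_law d lam) + c y \<le> f y"
      using drift unfolding c_def e1 by (simp add: add_diff_inverse_ennreal)
  qed
  have sumE: "(\<Sum>i<j. expect_after d lam q i c y) \<le> f y" and fE: "expect_after d lam q j f y \<le> f y" for j
    using order_trans[OF _ main[of j]] by (simp_all add: add_increasing add_increasing2)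
  have "(\<integral>\<^sup>+\<omega>. (\<Sum>i. c (?Y i \<omega>)) \<partial>env_law d lam) = (\<Sum>i. expect_after d lam q i c y)"
    unfolding expect_after_def by (rule nn_integral_suminf) measurable
  also have "\<dots> \<le> f y" by (intro suminf_le_const sumE) simp
  finally have AE1: "AE \<omega> in env_law d lam. (\<Sum>i. c (?Y i \<omega>)) \<noteq> \<infinity>"
    using f_fin[of y] by (intro nn_integral_PInf_AE) (auto simp: top_unique)
  have "(\<integral>\<^sup>+\<omega>. liminf (\<lambda>j. f (?Y j \<omega>)) \<partial>env_law d lam) \<le> liminf (\<lambda>j. expect_after d lam q j f y)"
    unfolding expect_after_def by (rule nn_integral_liminf) measurable
  also have "\<dots> \<le> f y"
    using fE by (intro Liminf_le) auto
  \<comment> \<open>Fatou's lemma: the means of \<open>f\<close> along the chain stay below the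
    initial value, so almost every path returns infinitely often below some finite level.\<close>
  finally have AE2: "AE \<omega> in env_law d lam. liminf (\<lambda>j. f (?Y j \<omega>)) \<noteq> \<infinity>"
    using f_fin[of y] by (intro nn_integral_PInf_AE) (auto simp: top_unique)
  from AE1 AE2 show ?thesis
  proof eventually_elim
    case (elim \<omega>)
    show ?case
    proof (rule ccontr)
      assume "\<not> ?case"
      then have nonempty: "\<not> no_customers d (snd (?Y j \<omega>))" for j by blast
      obtain k where k: "liminf (\<lambda>j. f (?Y j \<omega>)) < of_nat k"
        using ennreal_Ex_less_of_nat[of "liminf (\<lambda>j. f (?Y j \<omega>))"] elim(2) by (auto simp: less_top)
      define A where "A = {y \<in> I. f y \<le> of_nat k} \<inter> {y. \<not> no_customers d (snd y)}"
      have "\<not> eventually (\<lambda>j. of_nat k \<le> f (?Y j \<omega>)) sequentially"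
        using k Liminf_bounded[of "of_nat k" "\<lambda>j. f (?Y j \<omega>)" sequentially] by (auto simp: not_less[symmetric])
      then have freq: "\<exists>\<^sub>\<infinity>j. ?Y j \<omega> \<in> A"
        unfolding not_eventually cofinite_eq_sequentially
        by (rule frequently_elim1) (use Y_I nonempty in \<open>auto simp: A_def not_le\<close>)
      then have "A \<noteq> {}" using frequently_ex[OF freq] by auto
      have "finite A" unfolding A_def using fin by auto
      have cpos: "0 < c y" if "y \<in> A" for y
        using strict[of y] that unfolding A_def c_def e1 by (auto simp: diff_gt_0_iff_gt_ennreal)
      \<comment> \<open>Here finiteness replaces uniformity: infinitely many visits to the finite
        set \<open>A\<close> each cost at least the positive minimum \<open>m\<close>.\<close>
      define m where "m = Min (c ` A)"
      have "0 < m" unfolding m_def using \<open>finite A\<close> \<open>A \<noteq> {}\<close> cpos by simp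
      moreover have "\<exists>\<^sub>\<infinity>j. m \<le> c (?Y j \<omega>)"
        using freq by (rule frequently_elim1) (simp add: m_def \<open>finite A\<close>)
      ultimately have "(\<Sum>i. c (?Y i \<omega>)) = \<infinity>"
        by (rule suminf_ennreal_infinite_lower_bound)
      with elim(1) show False by simp
    qed
  qed
qed

section \<open>The value function\<close>

text \<open>The entries of the first column of the station matrix. A busy period started by one
  customer at \<open>n\<close> has mean length \<open>1 / (fst r - lam n)\<close>, during which
  customers arrive at the station \<open>k + 1\<close> places ahead at rate \<open>lam\<close> and
  are sent there at rate \<open>snd r (k + 1) * fst r\<close>. So this is the mean number of
  customers that clearing one customer at \<open>n\<close> adds to that station.\<close>

definition station_coeff :: "nat \<Rightarrow> (nat \<Rightarrow> real) \<Rightarrow> nat \<Rightarrow> regime \<Rightarrow> nat \<Rightarrow> real" where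
  "station_coeff d lam n r k = (lam ((n + k + 1) mod (d + 1)) + snd r (k + 1) * fst r) / (fst r - lam n)"

text \<open>The row vector \<open>w\<close> times the station matrix, as
  \<open>row_mul_station_matrix\<close> confirms. Written out on functions, so that the value
  function can be studied without matrices.\<close>

definition station_row :: "nat \<Rightarrow> (nat \<Rightarrow> real) \<Rightarrow> nat \<Rightarrow> regime \<Rightarrow> (nat \<Rightarrow> real) \<Rightarrow> nat \<Rightarrow> real" where
  "station_row d lam n r w i = (if i = 0 then (\<Sum>k<d. w k * station_coeff d lam n r k) else w (i - 1))"

text \<open>In the cycle matrix station \<open>d\<close> stands leftmost, so a row vector meets it
  first: stage \<open>j\<close> has passed stations \<open>d\<close> down to
  \<open>d - j + 1\<close>. The reindexed \<open>visit_row\<close> turns this into a recursion from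
  \<open>Suc n\<close> to \<open>n\<close> that starts with \<open>w\<close> at
  \<open>Suc d\<close>.\<close>

primrec stage_row :: "nat \<Rightarrow> (nat \<Rightarrow> real) \<Rightarrow> (nat \<Rightarrow> regime) \<Rightarrow> (nat \<Rightarrow> real) \<Rightarrow> nat \<Rightarrow> nat \<Rightarrow> real" where
  "stage_row d lam q w 0 = w"
| "stage_row d lam q w (Suc j) = station_row d lam (d - j) (q (d - j)) (stage_row d lam q w j)"

definition visit_row :: "nat \<Rightarrow> (nat \<Rightarrow> real) \<Rightarrow> (nat \<Rightarrow> regime) \<Rightarrow> (nat \<Rightarrow> real) \<Rightarrow> nat \<Rightarrow> nat \<Rightarrow> real" where
  "visit_row d lam q w n = stage_row d lam q w (d + 1 - n)"

lemma visit_row_end: "visit_row d lam q w (Suc d) = w"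
  by (simp add: visit_row_def)

lemma visit_row_rec:
  assumes "n \<le> d"
  shows "visit_row d lam q w n = station_row d lam n (q n) (visit_row d lam q w (Suc n))"
proof -
  have "d + 1 - n = Suc (d - n)" using assms by simp
  then show ?thesis using assms by (simp add: visit_row_def)
qed

text \<open>The cyclic distance from \<open>n\<close> to \<open>m\<close>; adding
  \<open>d + 1\<close> first keeps the subtraction on naturals exact for
  \<open>n \<le> d\<close>.\<close>

definition station_dist :: "nat \<Rightarrow> nat \<Rightarrow> nat \<Rightarrow> nat" where
  "station_dist d n m = (m + (d + 1) - n) mod (d + 1)"

text \<open>\<open>visit_row n\<close> lists the values of customers at stations \<open>n, \<dots>, n + d - 1\<close> when the server
  arrives at \<open>n\<close>. While it serves there, a customer at \<open>n\<close> keeps its value, and the others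
  already have the values they will have on arrival at \<open>n + 1\<close>.\<close>

definition station_weight :: "nat \<Rightarrow> (nat \<Rightarrow> real) \<Rightarrow> (nat \<Rightarrow> regime) \<Rightarrow> (nat \<Rightarrow> real) \<Rightarrow> nat \<Rightarrow> nat \<Rightarrow> real" where
  "station_weight d lam q w n m =
     (if m = n then visit_row d lam q w n 0 else visit_row d lam q w (Suc n) (station_dist d n m - 1))"

definition lyapunov :: "nat \<Rightarrow> (nat \<Rightarrow> real) \<Rightarrow> (nat \<Rightarrow> regime) \<Rightarrow> (nat \<Rightarrow> real) \<Rightarrow> nat \<times> (nat \<Rightarrow> nat) \<Rightarrow> real" where
  "lyapunov d lam q w y = (\<Sum>m\<le>d. station_weight d lam q w (fst y) m * real (snd y m))"

section \<open>Cyclic distances and the next station served\<close>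

lemma station_dist_less:
  assumes "n \<le> d" "m \<le> d"
  shows "station_dist d n m = (if n \<le> m then m - n else m + (d + 1) - n)"
proof (cases "n \<le> m")
  case True
  then have "m + (d + 1) - n = (m - n) + (d + 1)" by simp
  then have "station_dist d n m = ((m - n) + (d + 1)) mod (d + 1)" by (simp only: station_dist_def)
  also have "\<dots> = m - n" using assms by (simp only: mod_add_self2 mod_less)
  finally show ?thesis using True by simp
qed (use assms in \<open>simp add: station_dist_def\<close>)

lemma station_add_mod:
  fixes n d :: nat
  assumes "n \<le> d" "k < d"
  shows "(n + k + 1) mod (d + 1) = (if n + k + 1 \<le> d then n + k + 1 else n + k - d)"
proof (cases "n + k + 1 \<le> d")
  case False
  then have "n + k + 1 = (n + k - d) + (d + 1)" "n + k - d < d + 1" using assms by linarith+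
  then show ?thesis using False by (metis mod_add_self2 mod_less)
qed simp

lemma station_dist_add:
  assumes "n \<le> d" "k < d"
  shows "station_dist d n ((n + k + 1) mod (d + 1)) = k + 1"
proof -
  have "(n + k + 1) mod (d + 1) \<le> d" by (simp add: less_Suc_eq_le[symmetric])
  then show ?thesis
    using station_add_mod[OF assms] assms by (simp add: station_dist_less del: One_nat_def) auto
qed

lemma station_add_dist:
  assumes "n \<le> d" "m \<le> d" "m \<noteq> n"
  shows "station_dist d n m - 1 < d" "1 \<le> station_dist d n m" "(n + (station_dist d n m - 1) + 1) mod (d + 1) = m"
proof -
  show *: "station_dist d n m - 1 < d" "1 \<le> station_dist d n m"
    using assms by (auto simp: station_dist_less)
  show "(n + (station_dist d n m - 1) + 1) mod (d + 1) = m"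
    using assms by (subst station_add_mod[OF assms(1) *(1)]) (auto simp: station_dist_less)
qed

lemma bij_betw_stations:
  fixes n d :: nat
  assumes "n \<le> d"
  shows "bij_betw (\<lambda>k. (n + k + 1) mod (d + 1)) {..<d} ({..d} - {n})"
proof (rule bij_betw_byWitness[where f'="\<lambda>m. station_dist d n m - 1"])
  show "\<forall>k\<in>{..<d}. station_dist d n ((n + k + 1) mod (d + 1)) - 1 = k"
    using station_dist_add[OF assms] by simp
  show "\<forall>m\<in>{..d} - {n}. (n + (station_dist d n m - 1) + 1) mod (d + 1) = m"
    using station_add_dist(3)[OF assms] by simp
  show "(\<lambda>k. (n + k + 1) mod (d + 1)) ` {..<d} \<subseteq> {..d} - {n}"
    using station_add_mod[OF assms] assms by (auto split: if_splits)
  show "(\<lambda>m. station_dist d n m - 1) ` ({..d} - {n}) \<subseteq> {..<d}"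
    using station_add_dist(1)[OF assms] by auto
qed

text \<open>The search for the next nonempty queue commutes with shifts by multiples of
  \<open>d + 1\<close>. Hence the homogeneous chain may keep the station and forget the number of
  the visit.\<close>

lemma serving_visit_mod:
  "serving_visit d x v mod (d + 1) = serving_visit d x (v mod (d + 1)) mod (d + 1)"
proof (cases "\<exists>m\<le>d. 0 < x m")
  case True
  then obtain m where m: "m \<le> d" "0 < x m" by blast
  define a where "a = v div (d + 1) * (d + 1)"
  have v: "v = v mod (d + 1) + a" unfolding a_def by (rule mod_div_mult_eq[symmetric])
  have "v mod (d + 1) \<le> m + (d + 1)" "(m + (d + 1)) mod (d + 1) = m"
    using m by (simp add: less_Suc_eq_le trans_le_add2 less_imp_le)
      (use m in \<open>simp only: mod_add_self2 mod_less less_Suc_eq_le Suc_eq_plus1[symmetric]\<close>)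
  then have ex: "v mod (d + 1) \<le> m + (d + 1) \<and> 0 < x ((m + (d + 1)) mod (d + 1))" using m by simp
  have "serving_visit d x v = serving_visit d x (v mod (d + 1)) + a"
    unfolding serving_visit_def
  proof (rule Least_equality)
    let ?L = "LEAST u. v mod (d + 1) \<le> u \<and> 0 < x (u mod (d + 1))"
    have L: "v mod (d + 1) \<le> ?L \<and> 0 < x (?L mod (d + 1))" by (rule LeastI[where P="\<lambda>u. v mod (d + 1) \<le> u \<and> 0 < x (u mod (d + 1))", OF ex])
    moreover have "(?L + a) mod (d + 1) = ?L mod (d + 1)"
      unfolding a_def by (rule mod_mult_self1)
    ultimately show "v \<le> ?L + a \<and> 0 < x ((?L + a) mod (d + 1))"
      using v by (metis add_le_mono1)
    fix u assume u: "v \<le> u \<and> 0 < x (u mod (d + 1))"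
    have "a \<le> u" using u v by linarith
    then have "u mod (d + 1) = (u - a) mod (d + 1)"
      unfolding a_def by (metis le_add_diff_inverse2 mod_mult_self1)
    then have "0 < x ((u - a) mod (d + 1))" using u by (simp only:)
    moreover have "v mod (d + 1) \<le> u - a" using u v by linarith
    ultimately have "?L \<le> u - a" by (intro Least_le conjI)
    then show "?L + a \<le> u" using \<open>a \<le> u\<close> by linarith
  qed
  then show ?thesis by (simp only: a_def mod_mult_self1)
next
  case False
  then have "\<not> 0 < x (u mod (d + 1))" for u
    by (metis Suc_eq_plus1 less_Suc_eq_le mod_less_divisor zero_less_Suc)
  \<comment> \<open>Without customers both sides are \<open>LEAST\<close> of an unsatisfiable
    predicate, hence the same unspecified value.\<close>
  then show ?thesis by (simp add: serving_visit_def)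
qed

lemma serving_visit_props:
  assumes "\<not> no_customers d x"
  shows "v \<le> serving_visit d x v" "0 < x (serving_visit d x v mod (d + 1))"
    "\<And>u. v \<le> u \<Longrightarrow> u < serving_visit d x v \<Longrightarrow> x (u mod (d + 1)) = 0"
proof -
  obtain m where m: "m \<le> d" "0 < x m" using assms by (auto simp: no_customers_def)
  have "v \<le> m + v * (d + 1) \<and> 0 < x ((m + v * (d + 1)) mod (d + 1))"
    using m by (simp only: mod_mult_self1 mod_less less_Suc_eq_le Suc_eq_plus1[symmetric]) simp
  from LeastI[of "\<lambda>u. v \<le> u \<and> 0 < x (u mod (d + 1))", OF this]
  show "v \<le> serving_visit d x v" "0 < x (serving_visit d x v mod (d + 1))"
    by (simp_all add: serving_visit_def)
  show "x (u mod (d + 1)) = 0" if "v \<le> u" "u < serving_visit d x v" for u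
    using not_less_Least[of u "\<lambda>u. v \<le> u \<and> 0 < x (u mod (d + 1))"] that
    by (auto simp: serving_visit_def)
qed

lemma station_coeff_pos:
  assumes lam: "\<And>m. m \<le> d \<Longrightarrow> 0 < lam m" and r: "r \<in> regimes d" "lam n < fst r" and "n \<le> d" "k < d"
  shows "0 < station_coeff d lam n r k"
proof -
  have "0 < lam ((n + k + 1) mod (d + 1))" by (intro lam) (simp add: less_Suc_eq_le[symmetric])
  moreover have "0 \<le> snd r (k + 1)" "0 < fst r"
    using r(1) assms(5) by (auto simp: regimes_def)
  ultimately show ?thesis
    using r(2) by (simp add: station_coeff_def add_pos_nonneg)
qed

context
  fixes d :: nat and lam :: "nat \<Rightarrow> real" and q :: "nat \<Rightarrow> regime" and w :: "nat \<Rightarrow> real"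
  assumes d: "1 \<le> d" and lam: "\<And>m. m \<le> d \<Longrightarrow> 0 < lam m"
    and q: "\<And>n. n \<le> d \<Longrightarrow> q n \<in> regimes d" and stable: "\<And>n. n \<le> d \<Longrightarrow> lam n < fst (q n)"
    and w: "\<And>i. i < d \<Longrightarrow> 0 < w i"
    and w_le: "\<And>i. i < d \<Longrightarrow> visit_row d lam q w 0 i \<le> w i"
begin

lemma visit_row_pos:
  assumes "n \<le> Suc d" "i < d"
  shows "0 < visit_row d lam q w n i"
  using assms
proof (induction "Suc d - n" arbitrary: n i)
  case 0
  then have "n = Suc d" by simp
  then show ?case using 0 by (simp add: visit_row_end w)
next
  case (Suc j)
  then have n: "n \<le> d" by simp
  have IH: "0 < visit_row d lam q w (Suc n) i" if "i < d" for i
    using Suc n that by auto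
  have c: "0 < station_coeff d lam n (q n) k" if "k < d" for k
    using lam q[OF n] stable[OF n] n that by (rule station_coeff_pos)
  show ?case
    unfolding visit_row_rec[OF n] station_row_def
    using IH Suc.prems d c by (auto intro!: sum_pos simp: lessThan_empty_iff)
qed

lemma station_weight_pos:
  assumes "n \<le> d" "m \<le> d"
  shows "0 < station_weight d lam q w n m"
  using assms d visit_row_pos[of n 0] visit_row_pos[of "Suc n" "station_dist d n m - 1"]
  by (auto simp: station_weight_def station_dist_less)

lemma lyapunov_nonneg: "fst y \<le> d \<Longrightarrow> 0 \<le> lyapunov d lam q w y"
  unfolding lyapunov_def by (intro sum_nonneg mult_nonneg_nonneg) (auto intro: less_imp_le station_weight_pos)

text \<open>The zero drift identity: per unit of service time, the value removed at
  \<open>n\<close>, net of new arrivals there, equals the value that arrives at or is routed to the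
  other stations. It is the definition of coordinate 0 of \<open>visit_row n\<close>, cleared of its
  denominator.\<close>

lemma station_weight_balance:
  assumes n: "n \<le> d"
  shows "station_weight d lam q w n n * (fst (q n) - lam n)
    = (\<Sum>m\<in>{..d} - {n}. station_weight d lam q w n m * (lam m + snd (q n) (station_dist d n m) * fst (q n)))"
    (is "_ = (\<Sum>m\<in>_. ?g m)")
proof -
  have g: "?g ((n + k + 1) mod (d + 1))
    = visit_row d lam q w (Suc n) k * station_coeff d lam n (q n) k * (fst (q n) - lam n)" if "k < d" for k
  proof -
    have "(n + k + 1) mod (d + 1) \<noteq> n"
      using bij_betw_apply[OF bij_betw_stations[OF n], of k] that by auto
    then show ?thesis
      using station_dist_add[OF n that] stable[OF n] by (simp add: station_weight_def station_coeff_def)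
  qed
  have "(\<Sum>m\<in>{..d} - {n}. ?g m) = (\<Sum>k<d. ?g ((n + k + 1) mod (d + 1)))"
    by (rule sum.reindex_bij_betw[OF bij_betw_stations[OF n], symmetric])
  also have "\<dots> = (\<Sum>k<d. visit_row d lam q w (Suc n) k * station_coeff d lam n (q n) k) * (fst (q n) - lam n)"
    unfolding sum_distrib_right by (intro sum.cong refl g) simp
  also have "\<dots> = station_weight d lam q w n n * (fst (q n) - lam n)"
    by (simp add: station_weight_def visit_row_rec[OF n] station_row_def)
  finally show ?thesis by simp
qed

text \<open>Within a cycle the weights agree, because the station matrix merely shifts the
  coordinates after the first. Only the passage from \<open>d\<close> to 0, where a new cycle
  begins, can lower them, and this is where the hypothesis \<open>w_le\<close> enters.\<close>

lemma station_weight_switch: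
  assumes "n \<le> d" "m \<le> d" "m \<noteq> n"
  shows "station_weight d lam q w (Suc n mod (d + 1)) m \<le> station_weight d lam q w n m"
proof (cases "n = d")
  case True
  then have m: "m < d" using assms by simp
  have "station_weight d lam q w 0 m = visit_row d lam q w 0 m"
    using m visit_row_rec[of 0] by (simp add: station_weight_def station_dist_less station_row_def)
  also have "\<dots> \<le> w m" by (rule w_le[OF m])
  also have "w m = station_weight d lam q w n m"
    using m True by (simp add: station_weight_def station_dist_less visit_row_end)
  finally show ?thesis using True by simp
next
  case False
  then have n: "Suc n \<le> d" using assms by simp
  then have mod: "Suc n mod (d + 1) = Suc n" by simp
  show ?thesis
  proof (cases "m = Suc n")
    case True
    then show ?thesis using assms n by (simp add: mod station_weight_def station_dist_less)
  next
    case False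
    have "station_dist d (Suc n) m = station_dist d n m - 1"
      using assms False n by (auto simp: station_dist_less)
    moreover have "station_dist d n m - 1 \<noteq> 0"
      using assms False n by (auto simp: station_dist_less)
    ultimately show ?thesis
      unfolding mod using assms False by (simp add: station_weight_def visit_row_rec[OF n, of lam q w] station_row_def)
  qed
qed

text \<open>The server passes the skipped stations one by one. Each of them is empty, so its own
  weight, which \<open>station_weight_switch\<close> does not control, is multiplied by 0.\<close>

lemma lyapunov_serving_visit:
  assumes "n \<le> d" "\<not> no_customers d x"
  shows "lyapunov d lam q w (serving_visit d x n mod (d + 1), x) \<le> lyapunov d lam q w (n, x)"
proof -
  have "lyapunov d lam q w (u mod (d + 1), x) \<le> lyapunov d lam q w (n, x)"
    if "n \<le> u" "u \<le> serving_visit d x n" for u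
    using that
  proof (induction u rule: dec_induct)
    case base
    then show ?case using assms(1) by simp
  next
    case (step u)
    have x: "x (u mod (d + 1)) = 0"
      using serving_visit_props(3)[OF assms(2), of n u] step by simp
    have ud: "u mod (d + 1) \<le> d" by (simp add: less_Suc_eq_le[symmetric])
    have "lyapunov d lam q w (Suc u mod (d + 1), x) \<le> lyapunov d lam q w (u mod (d + 1), x)"
      unfolding lyapunov_def fst_conv snd_conv
    proof (rule sum_mono)
      fix m assume m: "m \<in> {..d}"
      show "station_weight d lam q w (Suc u mod (d + 1)) m * real (x m)
        \<le> station_weight d lam q w (u mod (d + 1)) m * real (x m)"
      proof (cases "m = u mod (d + 1)")
        case False
        then have "station_weight d lam q w (Suc (u mod (d + 1)) mod (d + 1)) m \<le> station_weight d lam q w (u mod (d + 1)) m"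
          using m by (intro station_weight_switch ud) auto
        then show ?thesis by (intro mult_right_mono) (simp_all add: mod_Suc_eq)
      qed (use x in simp)
    qed
    also have "\<dots> \<le> lyapunov d lam q w (n, x)" using step by simp
    finally show ?case .
  qed
  from this[OF serving_visit_props(1)[OF assms(2)] order_refl] show ?thesis .
qed

end

section \<open>Drift of the value function\<close>

lemma distr_env_law_arrivals:
  assumes lam: "\<And>m. m \<le> d \<Longrightarrow> 0 < lam m" and m: "m \<le> d"
  shows "distr (env_law d lam) (exponential_law 1 \<Otimes>\<^sub>M arrival_law (lam m)) (\<lambda>\<omega>. (fst (fst \<omega>) 0, snd \<omega> m))
    = exponential_law 1 \<Otimes>\<^sub>M arrival_law (lam m)"
proof -
  let ?E = "\<Pi>\<^sub>M j\<in>(UNIV::nat set). exponential_law 1" and ?U = "\<Pi>\<^sub>M j\<in>(UNIV::nat set). unif_law"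
  interpret U: prob_space ?U by (intro prob_space_PiM prob_space_unif_law)
  interpret L: prob_space "arrival_law (lam m)" using lam[OF m] by (rule prob_space_arrival_law)
  have E: "distr (?E \<Otimes>\<^sub>M ?U) (exponential_law 1) (\<lambda>x. fst x 0) = exponential_law 1"
  proof -
    have "distr (?E \<Otimes>\<^sub>M ?U) (exponential_law 1) (\<lambda>x. fst x 0) = distr (distr (?E \<Otimes>\<^sub>M ?U) ?E fst) (exponential_law 1) (\<lambda>e. e 0)"
      by (subst distr_distr) (auto simp: comp_def intro: measurable_component_singleton)
    also have "\<dots> = exponential_law 1"
      unfolding U.distr_pair_fst by (rule distr_PiM_component) (auto intro: prob_space_exponential_law)
    finally show ?thesis .
  qed
  have A: "distr (\<Pi>\<^sub>M m\<in>{0..d}. arrival_law (lam m)) (arrival_law (lam m)) (\<lambda>a. a m) = arrival_law (lam m)"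
    by (rule distr_PiM_component) (use assms in \<open>auto intro: prob_space_arrival_law\<close>)
  have "exponential_law 1 \<Otimes>\<^sub>M arrival_law (lam m)
    = distr (?E \<Otimes>\<^sub>M ?U) (exponential_law 1) (\<lambda>x. fst x 0) \<Otimes>\<^sub>M
      distr (\<Pi>\<^sub>M m\<in>{0..d}. arrival_law (lam m)) (arrival_law (lam m)) (\<lambda>a. a m)"
    unfolding E A ..
  also have "\<dots> = distr (env_law d lam) (exponential_law 1 \<Otimes>\<^sub>M arrival_law (lam m)) (\<lambda>(x, y). (fst x 0, y m))"
    unfolding env_law_def
  proof (rule pair_measure_distr)
    show "sigma_finite_measure (distr (\<Pi>\<^sub>M m\<in>{0..d}. arrival_law (lam m)) (arrival_law (lam m)) (\<lambda>a. a m))"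
      unfolding A by unfold_locales
    show "(\<lambda>x. fst x 0) \<in> ?E \<Otimes>\<^sub>M ?U \<rightarrow>\<^sub>M exponential_law 1"
      by (rule measurable_compose[OF measurable_fst measurable_component_singleton]) simp
  qed (use m in \<open>auto intro: measurable_component_singleton\<close>)
  finally show ?thesis by (simp add: case_prod_beta')
qed

lemma distr_env_law_routing:
  assumes lam: "\<And>m. m \<le> d \<Longrightarrow> 0 < lam m"
  shows "distr (env_law d lam) unif_law (\<lambda>\<omega>. snd (fst \<omega>) 0) = unif_law"
proof -
  let ?E = "\<Pi>\<^sub>M j\<in>(UNIV::nat set). exponential_law 1" and ?U = "\<Pi>\<^sub>M j\<in>(UNIV::nat set). unif_law"
  let ?A = "\<Pi>\<^sub>M m\<in>{0..d}. arrival_law (lam m)"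
  interpret E: prob_space ?E by (intro prob_space_PiM prob_space_exponential_law) simp
  interpret U: prob_space ?U by (intro prob_space_PiM prob_space_unif_law)
  interpret A: prob_space ?A by (intro prob_space_PiM prob_space_arrival_law) (use lam in auto)
  have snd: "distr (?E \<Otimes>\<^sub>M ?U) ?U snd = ?U"
  proof (rule measure_eqI)
    fix B assume "B \<in> sets (distr (?E \<Otimes>\<^sub>M ?U) ?U snd)"
    then have B: "B \<in> sets ?U" by simp
    have "snd -` B \<inter> space (?E \<Otimes>\<^sub>M ?U) = space ?E \<times> B"
      using sets.sets_into_space[OF B] by (auto simp: space_pair_measure)
    then have "emeasure (distr (?E \<Otimes>\<^sub>M ?U) ?U snd) B = emeasure (?E \<Otimes>\<^sub>M ?U) (space ?E \<times> B)"
      using B by (subst emeasure_distr) auto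
    also have "\<dots> = emeasure ?E (space ?E) * emeasure ?U B"
      by (rule U.emeasure_pair_measure_Times[OF sets.top B])
    finally show "emeasure (distr (?E \<Otimes>\<^sub>M ?U) ?U snd) B = emeasure ?U B"
      by (simp only: E.emeasure_space_1 mult_1)
  qed simp
  have "distr (env_law d lam) unif_law (\<lambda>\<omega>. snd (fst \<omega>) 0)
    = distr (distr (distr (env_law d lam) (?E \<Otimes>\<^sub>M ?U) fst) ?U snd) unif_law (\<lambda>u. u 0)"
    unfolding env_law_def
    by (subst distr_distr, simp, simp, subst distr_distr)
      (auto simp: comp_def intro!: measurable_compose[OF measurable_snd measurable_component_singleton] measurable_component_singleton)
  also have "distr (env_law d lam) (?E \<Otimes>\<^sub>M ?U) fst = ?E \<Otimes>\<^sub>M ?U"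
    unfolding env_law_def by (rule A.distr_pair_fst)
  also have "distr (?E \<Otimes>\<^sub>M ?U) ?U snd = ?U" by (rule snd)
  also have "distr ?U unif_law (\<lambda>u. u 0) = unif_law"
    by (rule distr_PiM_component) (auto intro: prob_space_unif_law)
  finally show ?thesis .
qed

lemma measurable_env_service_arrivals:
  assumes "m \<le> d"
  shows "(\<lambda>\<omega>. (fst (fst \<omega>) 0, snd \<omega> m)) \<in> env_law d lam \<rightarrow>\<^sub>M exponential_law 1 \<Otimes>\<^sub>M arrival_law (lam m)"
proof (intro measurable_Pair)
  show "(\<lambda>\<omega>. fst (fst \<omega>) 0) \<in> env_law d lam \<rightarrow>\<^sub>M exponential_law 1"
    using measurable_env_components(1)[of 0] by (simp add: measurable_cong_sets[OF refl sets_exponential_law])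
  show "(\<lambda>\<omega>. snd \<omega> m) \<in> env_law d lam \<rightarrow>\<^sub>M arrival_law (lam m)"
    using assms by (intro measurable_compose[OF measurable_env_components(3) measurable_component_singleton]) auto
qed

text \<open>Given the service time, the mean count is at most \<open>lam m\<close> times its length,
  and the mean service time is \<open>1 / fst (q n)\<close>. An upper bound is enough for a
  supermartingale.\<close>

lemma nn_integral_poll_counts_le:
  assumes lam: "\<And>m. m \<le> d \<Longrightarrow> 0 < lam m" and m: "m \<le> d" and \<mu>: "0 < fst (q n)"
  shows "(\<integral>\<^sup>+\<omega>. of_nat (poll_counts d q n (fst (fst \<omega>) 0) (snd \<omega>) m) \<partial>env_law d lam) \<le> ennreal (lam m / fst (q n))"
proof -
  let ?h = "\<lambda>z. of_nat (arrivals (snd z) (service_time q n (fst z))) :: ennreal"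
  interpret L: prob_space "arrival_law (lam m)" using lam[OF m] by (rule prob_space_arrival_law)
  have [measurable]: "(\<lambda>z. service_time q n (fst z)) \<in> borel_measurable (exponential_law 1 \<Otimes>\<^sub>M arrival_law (lam m))"
    by (rule measurable_service_time) auto
  have "(\<lambda>z. arrivals (snd z) (service_time q n (fst z))) \<in> exponential_law 1 \<Otimes>\<^sub>M arrival_law (lam m) \<rightarrow>\<^sub>M count_space UNIV"
    by measurable
  then have h[measurable]: "?h \<in> borel_measurable (exponential_law 1 \<Otimes>\<^sub>M arrival_law (lam m))"
    by (rule measurable_count_space_comp) simp
  note [measurable] = measurable_env_service_arrivals[OF m]
  have "(\<integral>\<^sup>+\<omega>. of_nat (poll_counts d q n (fst (fst \<omega>) 0) (snd \<omega>) m) \<partial>env_law d lam)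
    = (\<integral>\<^sup>+\<omega>. ?h (fst (fst \<omega>) 0, snd \<omega> m) \<partial>env_law d lam)"
    using m by (simp add: poll_counts_def)
  also have "\<dots> = (\<integral>\<^sup>+z. ?h z \<partial>(exponential_law 1 \<Otimes>\<^sub>M arrival_law (lam m)))"
  proof -
    have "(\<integral>\<^sup>+z. ?h z \<partial>distr (env_law d lam) (exponential_law 1 \<Otimes>\<^sub>M arrival_law (lam m)) (\<lambda>\<omega>. (fst (fst \<omega>) 0, snd \<omega> m)))
      = (\<integral>\<^sup>+\<omega>. ?h (fst (fst \<omega>) 0, snd \<omega> m) \<partial>env_law d lam)"
      by (rule nn_integral_distr) measurable
    moreover have "distr (env_law d lam) (exponential_law 1 \<Otimes>\<^sub>M arrival_law (lam m)) (\<lambda>\<omega>. (fst (fst \<omega>) 0, snd \<omega> m))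
      = exponential_law 1 \<Otimes>\<^sub>M arrival_law (lam m)"
      by (rule distr_env_law_arrivals) (use lam m in auto)
    ultimately show ?thesis by metis
  qed
  also have "\<dots> = (\<integral>\<^sup>+e. \<integral>\<^sup>+b. of_nat (arrivals b (service_time q n e)) \<partial>arrival_law (lam m) \<partial>exponential_law 1)"
    by (subst L.nn_integral_fst[symmetric]) simp_all
  also have "\<dots> \<le> (\<integral>\<^sup>+e. ennreal (lam m * service_time q n e) \<partial>exponential_law 1)"
    using lam[OF m] \<mu> by (intro nn_integral_mono nn_integral_arrivals_le) (auto simp: service_time_def)
  also have "\<dots> = (\<integral>\<^sup>+e. ennreal (lam m / fst (q n)) * ennreal e \<partial>exponential_law 1)"
  proof (rule nn_integral_cong_AE)
    show "AE e in exponential_law 1. ennreal (lam m * service_time q n e) = ennreal (lam m / fst (q n)) * ennreal e"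
      using AE_exponential_law_pos[of 1, simplified]
      by eventually_elim (use lam[OF m] \<mu> in \<open>simp add: service_time_def ennreal_mult'[symmetric]\<close>)
  qed
  also have "\<dots> = ennreal (lam m / fst (q n))"
    by (subst nn_integral_cmult) (auto simp: nn_integral_exponential_law_id)
  finally show ?thesis .
qed

lemma route_SomeD:
  assumes "route d n \<gamma> u = Some m" "0 \<le> u"
  obtains k where "k < d" "m = (n + k + 1) mod (d + 1)" "(\<Sum>i=1..k. \<gamma> i) \<le> u" "u < (\<Sum>i=1..k. \<gamma> i) + \<gamma> (k + 1)"
proof -
  let ?P = "\<lambda>k. u < (\<Sum>i=1..k. \<gamma> i)"
  have P: "?P d" and m: "m = (n + (LEAST k. ?P k)) mod (d + 1)"
    using assms(1) by (auto simp: route_def split: if_splits)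
  have L: "?P (LEAST k. ?P k)" "(LEAST k. ?P k) \<le> d" using P by (auto intro: LeastI Least_le)
  have "(LEAST k. ?P k) \<noteq> 0"
  proof
    assume "(LEAST k. ?P k) = 0"
    with L(1) have "?P 0" by simp
    then show False using assms(2) by simp
  qed
  then obtain k where k: "(LEAST k. ?P k) = Suc k" using not0_implies_Suc by blast
  have "\<not> ?P k" using not_less_Least[of k ?P] k by simp
  then show ?thesis
    using that[of k] L m unfolding k by simp
qed

text \<open>\<open>route\<close> cuts the unit interval into consecutive pieces; the one leading to
  \<open>m\<close> is \<open>?J\<close>, of length \<open>\<gamma>\<close> at the distance from
  \<open>n\<close> to \<open>m\<close>. No piece leads back to \<open>n\<close>, since the distances
  run from 1 to \<open>d\<close>.\<close>

lemma nn_integral_route_le: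
  assumes lam: "\<And>m. m \<le> d \<Longrightarrow> 0 < lam m" and n: "n \<le> d" and m: "m \<le> d"
    and \<gamma>: "\<And>i. 1 \<le> i \<Longrightarrow> i \<le> d \<Longrightarrow> 0 \<le> \<gamma> i"
  shows "(\<integral>\<^sup>+\<omega>. indicator {Some m} (route d n \<gamma> (snd (fst \<omega>) 0)) \<partial>env_law d lam)
    \<le> ennreal (if m = n then 0 else \<gamma> (station_dist d n m))"
proof -
  let ?k = "station_dist d n m - 1"
  let ?J = "if m = n then {} else {(\<Sum>i=1..?k. \<gamma> i)..<(\<Sum>i=1..?k. \<gamma> i) + \<gamma> (?k + 1)}"
  have [measurable]: "(\<lambda>\<omega>. snd (fst \<omega>) 0) \<in> env_law d lam \<rightarrow>\<^sub>M unif_law"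
    using measurable_env_components(2)[of 0] by (simp add: measurable_cong_sets[OF refl sets_uniform_measure])
  have "(\<integral>\<^sup>+\<omega>. indicator {Some m} (route d n \<gamma> (snd (fst \<omega>) 0)) \<partial>env_law d lam)
    = (\<integral>\<^sup>+u. indicator {Some m} (route d n \<gamma> u) \<partial>distr (env_law d lam) unif_law (\<lambda>\<omega>. snd (fst \<omega>) 0))"
    by (subst nn_integral_distr) auto
  also have "\<dots> = (\<integral>\<^sup>+u. indicator {Some m} (route d n \<gamma> u) \<partial>unif_law)"
    by (simp only: distr_env_law_routing[OF lam])
  also have "\<dots> = (\<integral>\<^sup>+u. indicator {Some m} (route d n \<gamma> u) * indicator {0..<1} u \<partial>lborel)"
    by (subst nn_integral_uniform_measure) (auto simp: divide_ennreal_def)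
  also have "\<dots> \<le> (\<integral>\<^sup>+u. indicator ?J u \<partial>lborel)"
  proof (rule nn_integral_mono)
    fix u :: real
    show "indicator {Some m} (route d n \<gamma> u) * indicator {0..<1} u \<le> (indicator ?J u :: ennreal)"
    proof (cases "route d n \<gamma> u = Some m \<and> 0 \<le> u")
      case True
      then obtain k where k: "k < d" "m = (n + k + 1) mod (d + 1)" "(\<Sum>i=1..k. \<gamma> i) \<le> u" "u < (\<Sum>i=1..k. \<gamma> i) + \<gamma> (k + 1)"
        using route_SomeD[of d n \<gamma> u m] by blast
      have "?k = k" using station_dist_add[OF n k(1)] k(2) by simp
      moreover have "m \<noteq> n" using bij_betw_apply[OF bij_betw_stations[OF n], of k] k by auto
      ultimately show ?thesis using k by (auto simp: indicator_def)
    qed (auto simp: indicator_def)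
  qed
  also have "\<dots> = ennreal (if m = n then 0 else \<gamma> (station_dist d n m))"
    using station_add_dist(1,2)[OF n m] \<gamma>[of "station_dist d n m"] by (auto simp: Suc_le_eq)
  finally show ?thesis .
qed

text \<open>Strict concavity of the logarithm turns the supermartingale property into a strict decrease.\<close>

lemma (in prob_space) nn_integral_ln_less:
  fixes X :: "'a \<Rightarrow> real"
  assumes [measurable]: "X \<in> borel_measurable M" and X: "\<And>x. 0 \<le> X x"
    and le: "(\<integral>\<^sup>+x. ennreal (X x) \<partial>M) \<le> ennreal v" and v: "0 \<le> v"
  shows "(\<integral>\<^sup>+x. ennreal (ln (1 + X x)) \<partial>M) \<le> ennreal (ln (1 + v))"
    and "\<not> (AE x in M. X x = v) \<Longrightarrow> (\<integral>\<^sup>+x. ennreal (ln (1 + X x)) \<partial>M) < ennreal (ln (1 + v))"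
proof -
  have int: "integrable M X"
    using X le by (intro integrableI_nonneg) (auto simp: less_top[symmetric] top_unique)
  have "ennreal (expectation X) \<le> ennreal v"
    using nn_integral_eq_integral[OF int] X le by simp
  then have EX: "expectation X \<le> v" using v by (simp add: ennreal_le_iff)
  have ln0: "0 \<le> ln (1 + X x)" for x using X[of x] by simp
  have lnX: "ln (1 + X x) \<le> X x" for x using X[of x] ln_add_one_self_le_self by blast
  have intl: "integrable M (\<lambda>x. ln (1 + X x))"
    by (rule Bochner_Integration.integrable_bound[OF int]) (use ln0 lnX X in \<open>auto simp: abs_of_nonneg\<close>)
  \<comment> \<open>The tangent to \<open>ln (1 + x)\<close> at \<open>v\<close>, evaluated at
    \<open>X\<close>. Its mean is at most \<open>ln (1 + v)\<close>, and the curve meets it only at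
    \<open>X x = v\<close>.\<close>
  let ?Y = "\<lambda>x. ln (1 + v) + (X x - v) / (1 + v)"
  have intY: "integrable M ?Y" using int by auto
  have r: "(1 + X x) / (1 + v) - 1 = (X x - v) / (1 + v)" for x using v by (simp add: field_simps)
  have lnr: "ln (1 + X x) = ln (1 + v) + ln ((1 + X x) / (1 + v))" for x
    using v X[of x] by (simp add: ln_div)
  have tangent: "ln (1 + X x) \<le> ?Y x" for x
    using ln_le_minus_one[of "(1 + X x) / (1 + v)"] X[of x] v lnr[of x] r[of x] by simp
  have tangent_eq: "X x = v" if "ln (1 + X x) = ?Y x" for x
  proof -
    have "(1 + X x) / (1 + v) = 1"
      using that lnr[of x] r[of x] X[of x] v by (intro ln_eq_minus_one) auto
    then show ?thesis using v by (simp add: field_simps)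
  qed
  have nn: "(\<integral>\<^sup>+x. ennreal (ln (1 + X x)) \<partial>M) = ennreal (expectation (\<lambda>x. ln (1 + X x)))"
    using ln0 by (intro nn_integral_eq_integral intl) auto
  have EY: "expectation ?Y \<le> ln (1 + v)"
    using int EX v by (simp add: prob_space divide_nonpos_pos)
  have "expectation (\<lambda>x. ln (1 + X x)) \<le> expectation ?Y"
    by (intro integral_mono intl intY tangent)
  then show "(\<integral>\<^sup>+x. ennreal (ln (1 + X x)) \<partial>M) \<le> ennreal (ln (1 + v))"
    unfolding nn using EY by (intro ennreal_leI) simp
  assume "\<not> (AE x in M. X x = v)"
  then have "emeasure M {x \<in> space M. X x \<noteq> v} \<noteq> 0"
    by (subst (asm) AE_iff_measurable[OF _ refl]) auto
  then have "expectation (\<lambda>x. ln (1 + X x)) < expectation ?Y"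
    using tangent tangent_eq by (intro integral_less_AE[OF intl intY, where A="{x \<in> space M. X x \<noteq> v}"]) auto
  moreover have "0 \<le> expectation (\<lambda>x. ln (1 + X x))" using ln0 by (intro Bochner_Integration.integral_nonneg)
  ultimately show "(\<integral>\<^sup>+x. ennreal (ln (1 + X x)) \<partial>M) < ennreal (ln (1 + v))"
    unfolding nn using EY by (simp add: ennreal_less_iff)
qed

text \<open>In terms of the Erlang distribution function this is
  \<open>1 + l * s < exp (l * s)\<close>. Two arrivals are considered because one of them only makes
  up for the departure at the end of the service.\<close>

lemma two_arrivals_positive:
  assumes "0 < l" "0 < s"
  shows "\<not> (AE b in arrival_law l. s < (\<Sum>j\<le>Suc 0. b j))"
proof
  interpret prob_space "arrival_law l" using assms(1) by (rule prob_space_arrival_law)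
  assume AE: "AE b in arrival_law l. s < (\<Sum>j\<le>Suc 0. b j)"
  have "{b \<in> space (arrival_law l). s < (\<Sum>j\<le>Suc 0. b j)} \<in> events"
    by measurable
  from prob_Collect_eq_1[OF this] AE have "prob {b \<in> space (arrival_law l). s < (\<Sum>j\<le>Suc 0. b j)} = 1"
    by blast
  moreover have "prob {b \<in> space (arrival_law l). s < (\<Sum>j\<le>Suc 0. b j)} = 1 - erlang_CDF (Suc 0) l s"
    by (rule erlang_distributed_gt[OF distributed_arrival_time]) (use assms in auto)
  ultimately have "erlang_CDF (Suc 0) l s = 0" by linarith
  moreover have "ln (1 + l * s) < l * s" using assms by (intro ln_add_one_self_less_self) simp
  then have "1 + l * s < exp (l * s)"
    using assms by (subst (asm) exp_less_cancel_iff[symmetric]) (simp add: add_pos_pos)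
  then have "exp (- (l * s)) * (1 + l * s) < 1" by (simp add: exp_minus divide_simps)
  then have "0 < erlang_CDF (Suc 0) l s"
    using assms by (simp add: erlang_CDF_def algebra_simps)
  ultimately show False by simp
qed

text \<open>An invariant set of the chain. Vanishing beyond \<open>d\<close> is needed for finite
  sublevel sets, and a nonempty served queue makes the subtraction in \<open>next_queues\<close>
  exact.\<close>

definition serving_states :: "nat \<Rightarrow> (nat \<times> (nat \<Rightarrow> nat)) set" where
  "serving_states d = {(n, x). n \<le> d \<and> (\<forall>m>d. x m = 0) \<and> (no_customers d x \<or> 0 < x n)}"

lemma poll_step_serving_states:
  assumes "y \<in> serving_states d"
  shows "poll_step d q y c u \<in> serving_states d"
proof (cases "no_customers d (snd y)")
  case False
  define x' where "x' = next_queues d (fst y) (snd y) c (route d (fst y) (snd (q (fst y))) u)"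
  have step: "poll_step d q y c u = (serving_visit d x' (fst y) mod (d + 1), x')"
    using False by (simp add: poll_step_def x'_def Let_def)
  have "serving_visit d x' (fst y) mod (d + 1) \<le> d" by (simp add: less_Suc_eq_le[symmetric])
  moreover have "\<forall>m>d. x' m = 0" by (simp add: x'_def next_queues_def)
  moreover have "no_customers d x' \<or> 0 < x' (serving_visit d x' (fst y) mod (d + 1))"
    using serving_visit_props(2)[of d x' "fst y"] by metis
  ultimately show ?thesis unfolding step serving_states_def by blast
qed (use assms in \<open>simp add: poll_step_def\<close>)

lemma fst_poll_map:
  "fst (poll_map d q (y, \<omega>)) = poll_step d q y (poll_counts d q (fst y) (fst (fst \<omega>) 0) (snd \<omega>)) (snd (fst \<omega>) 0)"
  by (simp add: poll_map_eq)

lemma measurable_poll_count: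
  assumes "m \<le> d"
  shows "(\<lambda>\<omega>. of_nat (poll_counts d q n (fst (fst \<omega>) 0) (snd \<omega>) m) :: ennreal) \<in> borel_measurable (env_law d lam)"
proof -
  have "(\<lambda>\<omega>. poll_counts d q n (fst (fst \<omega>) 0) (snd \<omega>)) \<in> env_law d lam \<rightarrow>\<^sub>M (\<Pi>\<^sub>M m\<in>{0..d}. count_space UNIV)"
    by (rule measurable_poll_counts_resid(1)[where n="\<lambda>_. n" and e="\<lambda>\<omega>. fst (fst \<omega>) 0" and a=snd,
        OF measurable_const measurable_env_components(1) measurable_env_components(3)]) simp
  from measurable_compose[OF this measurable_component_singleton[of m "{0..d}"]]
  have "(\<lambda>\<omega>. poll_counts d q n (fst (fst \<omega>) 0) (snd \<omega>) m) \<in> env_law d lam \<rightarrow>\<^sub>M count_space UNIV"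
    using assms by simp
  then show ?thesis by (rule measurable_count_space_comp) simp
qed
lemma measurable_lyapunov[measurable]: "lyapunov d lam q w \<in> borel_measurable state_space"
proof -
  have id: "(\<lambda>y. y) \<in> state_space \<rightarrow>\<^sub>M state_space" by simp
  have [measurable]: "(\<lambda>y. station_weight d lam q w (fst y) m) \<in> borel_measurable state_space" for m
    by (rule measurable_count_space_comp[OF measurable_state_component(1)[OF id]]) simp
  have [measurable]: "(\<lambda>y. real (snd y m)) \<in> borel_measurable state_space" for m
    by (rule measurable_count_space_comp[OF measurable_state_component(2)[OF id]]) simp
  show ?thesis unfolding lyapunov_def[abs_def] by measurable
qed

context
  fixes d :: nat and lam :: "nat \<Rightarrow> real" and q :: "nat \<Rightarrow> regime" and w :: "nat \<Rightarrow> real"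
  assumes d: "1 \<le> d" and lam: "\<And>m. m \<le> d \<Longrightarrow> 0 < lam m"
    and q: "\<And>n. n \<le> d \<Longrightarrow> q n \<in> regimes d" and stable: "\<And>n. n \<le> d \<Longrightarrow> lam n < fst (q n)"
    and w: "\<And>i. i < d \<Longrightarrow> 0 < w i"
    and w_le: "\<And>i. i < d \<Longrightarrow> visit_row d lam q w 0 i \<le> w i"
begin

private abbreviation (input) "W \<equiv> station_weight d lam q w"
private abbreviation (input) "V \<equiv> lyapunov d lam q w"

private lemma W_pos: "n \<le> d \<Longrightarrow> m \<le> d \<Longrightarrow> 0 < W n m"
  by (rule station_weight_pos[OF d lam q stable w w_le])

private lemma V_nonneg: "fst y \<le> d \<Longrightarrow> 0 \<le> V y"
  by (rule lyapunov_nonneg[OF d lam q stable w w_le])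

text \<open>A pathwise bound: the changes of the queues are accounted for exactly, and the
  inequality comes only from moving the server afterwards.\<close>

lemma lyapunov_poll_step_le:
  assumes y: "(n, x) \<in> serving_states d" "\<not> no_customers d x"
  shows "V (poll_step d q (n, x) c u) \<le> V (n, x) - W n n + (\<Sum>m\<le>d. W n m * real (c m))
    + (\<Sum>m\<le>d. W n m * indicator {Some m} (route d n (snd (q n)) u))"
proof -
  let ?rt = "route d n (snd (q n)) u"
  define x' where "x' = next_queues d n x c ?rt"
  have n: "n \<le> d" "0 < x n" using y by (auto simp: serving_states_def)
  have step: "poll_step d q (n, x) c u = (serving_visit d x' n mod (d + 1), x')"
    using y by (simp add: poll_step_def x'_def Let_def)
  have "V (serving_visit d x' n mod (d + 1), x') \<le> V (n, x')"
  proof (cases "no_customers d x'")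
    case True
    then have "V (k, x') = 0" for k by (simp add: lyapunov_def no_customers_def)
    then show ?thesis by simp
  next
    case False
    show ?thesis by (rule lyapunov_serving_visit) (fact d lam q stable w w_le n False)+
  qed
  also have "V (n, x') = (\<Sum>m\<le>d. W n m * real (x m) - (if m = n then W n n else 0) + W n m * real (c m)
      + W n m * indicator {Some m} ?rt)"
    unfolding lyapunov_def fst_conv snd_conv
  proof (rule sum.cong[OF refl])
    fix m assume "m \<in> {..d}"
    then have "real (x' m) = real (x m) - (if m = n then 1 else 0) + real (c m) + indicator {Some m} ?rt"
      using n by (auto simp: x'_def next_queues_def indicator_def of_nat_diff)
    note eq = this
    show "W n m * real (x' m) = W n m * real (x m) - (if m = n then W n n else 0) + W n m * real (c m)
      + W n m * indicator {Some m} ?rt"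
      unfolding eq by (simp add: algebra_simps)
  qed
  also have "\<dots> = V (n, x) - W n n + (\<Sum>m\<le>d. W n m * real (c m)) + (\<Sum>m\<le>d. W n m * indicator {Some m} ?rt)"
    using n by (simp add: lyapunov_def sum.distrib sum_subtractf)
  finally show ?thesis by (simp add: step)
qed

text \<open>Two arrivals lengthen the queue at \<open>n\<close> despite the departure. So the server
  stays, and no value can be lost by switching.\<close>

lemma lyapunov_poll_step_greater:
  assumes y: "(n, x) \<in> serving_states d" "\<not> no_customers d x" and c: "2 \<le> c n"
  shows "V (n, x) < V (poll_step d q (n, x) c u)"
proof -
  define x' where "x' = next_queues d n x c (route d n (snd (q n)) u)"
  have n: "n \<le> d" "0 < x n" using y by (auto simp: serving_states_def)
  have x'n: "x n + 1 \<le> x' n" using n c by (simp add: x'_def next_queues_def)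
  have x'm: "x m \<le> x' m" if "m \<le> d" for m
    using that n c by (cases "m = n") (simp_all add: x'_def next_queues_def)
  have "serving_visit d x' n = n"
    unfolding serving_visit_def using x'n n by (intro Least_equality) auto
  then have step: "poll_step d q (n, x) c u = (n, x')"
    using y n by (simp add: poll_step_def x'_def Let_def)
  have "V (n, x) < V (n, x')"
    unfolding lyapunov_def fst_conv snd_conv
  proof (rule sum_strict_mono_ex1)
    show "\<forall>m\<in>{..d}. W n m * real (x m) \<le> W n m * real (x' m)"
      using x'm W_pos[OF n(1)] by (auto intro!: mult_left_mono less_imp_le)
    show "\<exists>m\<in>{..d}. W n m * real (x m) < W n m * real (x' m)"
      using x'n W_pos[OF n(1) n(1)] n by (intro bexI[of _ n]) auto
  qed simp
  then show ?thesis by (simp add: step)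
qed

private lemma measurable_V_poll_map: "(\<lambda>\<omega>. V (fst (poll_map d q (y, \<omega>)))) \<in> borel_measurable (env_law d lam)"
  using measurable_compose[OF measurable_poll_map_fst[where j=1 and d=d and lam=lam and q=q and y=y, OF lam] measurable_lyapunov]
  by simp

lemma nn_integral_lyapunov_le:
  assumes y: "(n, x) \<in> serving_states d" "\<not> no_customers d x"
  shows "(\<integral>\<^sup>+\<omega>. ennreal (V (fst (poll_map d q ((n, x), \<omega>)))) \<partial>env_law d lam) \<le> ennreal (V (n, x))"
proof -
  interpret prob_space "env_law d lam" using lam by (rule prob_space_env_law)
  have n: "n \<le> d" "0 < x n" using y by (auto simp: serving_states_def)
  have W: "0 \<le> W n m" if "m \<le> d" for m using W_pos[OF n(1) that] by simp
  define \<mu> where "\<mu> = fst (q n)"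
  define \<gamma> where "\<gamma> = snd (q n)"
  have \<mu>: "0 < \<mu>" using lam[OF n(1)] stable[OF n(1)] by (simp add: \<mu>_def)
  have \<gamma>: "0 \<le> \<gamma> i" if "1 \<le> i" "i \<le> d" for i
    using q[OF n(1)] that by (auto simp: regimes_def \<gamma>_def)
  let ?cnt = "\<lambda>\<omega> m. poll_counts d q n (fst (fst \<omega>) 0) (snd \<omega>) m"
  let ?rt = "\<lambda>\<omega>. route d n \<gamma> (snd (fst \<omega>) 0)"
  let ?b = "V (n, x) - W n n"
  \<comment> \<open>The served customer is counted in \<open>x n\<close>, so \<open>?b\<close> is
    nonnegative and the bound can be split into summands in \<open>ennreal\<close>.\<close>
  have "W n n * 1 \<le> W n n * real (x n)" using n W[OF n(1)] by (intro mult_left_mono) auto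
  also have "\<dots> \<le> V (n, x)"
    unfolding lyapunov_def fst_conv snd_conv using n W by (intro member_le_sum) auto
  finally have b: "0 \<le> ?b" by simp
  have [measurable]: "(\<lambda>\<omega>. of_nat (?cnt \<omega> m) :: ennreal) \<in> borel_measurable (env_law d lam)" if "m \<le> d" for m
    by (rule measurable_poll_count[OF that])
  have [measurable]: "(\<lambda>\<omega>. indicator {Some m} (?rt \<omega>) :: ennreal) \<in> borel_measurable (env_law d lam)" for m
    by (rule measurable_indicator_count_space) (rule measurable_compose[OF measurable_env_components(2) measurable_route])
  have "(\<integral>\<^sup>+\<omega>. ennreal (V (fst (poll_map d q ((n, x), \<omega>)))) \<partial>env_law d lam)
    \<le> (\<integral>\<^sup>+\<omega>. ennreal ?b + (\<Sum>m\<le>d. ennreal (W n m) * of_nat (?cnt \<omega> m))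
        + (\<Sum>m\<le>d. ennreal (W n m) * indicator {Some m} (?rt \<omega>)) \<partial>env_law d lam)"
  proof (rule nn_integral_mono)
    fix \<omega> :: env
    have 1: "(\<Sum>m\<le>d. ennreal (W n m) * of_nat (?cnt \<omega> m)) = ennreal (\<Sum>m\<le>d. W n m * real (?cnt \<omega> m))"
      using W by (subst sum_ennreal[symmetric])
        (auto intro!: sum.cong simp: ennreal_mult ennreal_of_nat_eq_real_of_nat)
    have 2: "(\<Sum>m\<le>d. ennreal (W n m) * indicator {Some m} (?rt \<omega>)) = ennreal (\<Sum>m\<le>d. W n m * indicator {Some m} (?rt \<omega>))"
      using W by (subst sum_ennreal[symmetric]) (auto intro!: sum.cong simp: ennreal_mult ennreal_indicator)
    have 3: "0 \<le> (\<Sum>m\<le>d. W n m * real (?cnt \<omega> m))" "0 \<le> (\<Sum>m\<le>d. W n m * (indicator {Some m} (?rt \<omega>) :: real))"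
      using W by (auto intro!: sum_nonneg mult_nonneg_nonneg)
    show "ennreal (V (fst (poll_map d q ((n, x), \<omega>)))) \<le> ennreal ?b + (\<Sum>m\<le>d. ennreal (W n m) * of_nat (?cnt \<omega> m))
        + (\<Sum>m\<le>d. ennreal (W n m) * indicator {Some m} (?rt \<omega>))"
      unfolding 1 2 fst_poll_map fst_conv using b 3
        ennreal_leI[OF lyapunov_poll_step_le[OF y, of "poll_counts d q n (fst (fst \<omega>) 0) (snd \<omega>)" "snd (fst \<omega>) 0"]]
      by (simp add: \<gamma>_def ennreal_plus[symmetric] del: ennreal_plus)
  qed
  also have "\<dots> = ennreal ?b + (\<Sum>m\<le>d. ennreal (W n m) * (\<integral>\<^sup>+\<omega>. of_nat (?cnt \<omega> m) \<partial>env_law d lam))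
      + (\<Sum>m\<le>d. ennreal (W n m) * (\<integral>\<^sup>+\<omega>. indicator {Some m} (?rt \<omega>) \<partial>env_law d lam))"
  proof -
    have [measurable]: "(\<lambda>\<omega>. \<Sum>m\<le>d. ennreal (W n m) * of_nat (?cnt \<omega> m)) \<in> borel_measurable (env_law d lam)"
      by (rule borel_measurable_sum) (auto intro: borel_measurable_times)
    have [measurable]: "(\<lambda>\<omega>. \<Sum>m\<le>d. ennreal (W n m) * indicator {Some m} (?rt \<omega>)) \<in> borel_measurable (env_law d lam)"
      by (rule borel_measurable_sum) measurable
    have "(\<integral>\<^sup>+\<omega>. (\<Sum>m\<le>d. ennreal (W n m) * of_nat (?cnt \<omega> m)) \<partial>env_law d lam)
      = (\<Sum>m\<le>d. ennreal (W n m) * (\<integral>\<^sup>+\<omega>. of_nat (?cnt \<omega> m) \<partial>env_law d lam))"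
      by (subst nn_integral_sum) (auto intro!: sum.cong nn_integral_cmult)
    moreover have "(\<integral>\<^sup>+\<omega>. (\<Sum>m\<le>d. ennreal (W n m) * indicator {Some m} (?rt \<omega>)) \<partial>env_law d lam)
      = (\<Sum>m\<le>d. ennreal (W n m) * (\<integral>\<^sup>+\<omega>. indicator {Some m} (?rt \<omega>) \<partial>env_law d lam))"
      by (subst nn_integral_sum, measurable, intro sum.cong refl nn_integral_cmult) measurable
    ultimately show ?thesis
      by (subst nn_integral_add, measurable, subst nn_integral_add) (simp_all only: nn_integral_const emeasure_space_1 mult_1_right, measurable)
  qed
  also have "\<dots> \<le> ennreal ?b + (\<Sum>m\<le>d. ennreal (W n m) * ennreal (lam m / \<mu>))
      + (\<Sum>m\<le>d. ennreal (W n m) * ennreal (if m = n then 0 else \<gamma> (station_dist d n m)))"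
  proof (intro add_mono order_refl sum_mono mult_left_mono)
    fix m assume "m \<in> {..d}"
    then have m: "m \<le> d" by simp
    show "(\<integral>\<^sup>+\<omega>. of_nat (?cnt \<omega> m) \<partial>env_law d lam) \<le> ennreal (lam m / \<mu>)"
      unfolding \<mu>_def using lam m \<mu>[unfolded \<mu>_def] by (rule nn_integral_poll_counts_le)
    show "(\<integral>\<^sup>+\<omega>. indicator {Some m} (?rt \<omega>) \<partial>env_law d lam) \<le> ennreal (if m = n then 0 else \<gamma> (station_dist d n m))"
      using lam n(1) m \<gamma> by (rule nn_integral_route_le)
  qed simp_all
  also have "\<dots> = ennreal (?b + (\<Sum>m\<le>d. W n m * (lam m / \<mu>))
      + (\<Sum>m\<le>d. W n m * (if m = n then 0 else \<gamma> (station_dist d n m))))"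
  proof -
    have g: "0 \<le> (if m = n then 0 else \<gamma> (station_dist d n m))" if "m \<le> d" for m
      using \<gamma>[of "station_dist d n m"] station_add_dist(1,2)[OF n(1) that] by auto
    have 1: "(\<Sum>m\<le>d. ennreal (W n m) * ennreal (lam m / \<mu>)) = ennreal (\<Sum>m\<le>d. W n m * (lam m / \<mu>))"
      using W \<mu> lam by (subst sum_ennreal[symmetric]) (auto intro!: sum.cong simp: ennreal_mult'[symmetric] less_imp_le)
    have 2: "(\<Sum>m\<le>d. ennreal (W n m) * ennreal (if m = n then 0 else \<gamma> (station_dist d n m)))
      = ennreal (\<Sum>m\<le>d. W n m * (if m = n then 0 else \<gamma> (station_dist d n m)))"
      using W g by (subst sum_ennreal[symmetric]) (auto intro!: sum.cong mult_nonneg_nonneg simp: ennreal_mult'[symmetric])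
    have "0 \<le> (\<Sum>m\<le>d. W n m * (lam m / \<mu>))" "0 \<le> (\<Sum>m\<le>d. W n m * (if m = n then 0 else \<gamma> (station_dist d n m)))"
      using W g \<mu> lam by (auto intro!: sum_nonneg mult_nonneg_nonneg divide_nonneg_nonneg intro: less_imp_le)
    then show ?thesis
      unfolding 1 2 using b by (simp add: ennreal_plus[symmetric] del: ennreal_plus)
  qed
  also have "?b + (\<Sum>m\<le>d. W n m * (lam m / \<mu>)) + (\<Sum>m\<le>d. W n m * (if m = n then 0 else \<gamma> (station_dist d n m))) = V (n, x)"
  proof -
    \<comment> \<open>Divided by \<open>\<mu>\<close>, the balance identity says that one service
      brings in, by the above bounds on the means, exactly the value \<open>W n n\<close> that it
      removes.\<close>
    have "W n n * (\<mu> - lam n) = (\<Sum>m\<in>{..d} - {n}. W n m * (lam m + \<gamma> (station_dist d n m) * \<mu>))"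
      unfolding \<mu>_def \<gamma>_def by (rule station_weight_balance[OF d lam q stable w w_le n(1)])
    also have "\<dots> = \<mu> * (\<Sum>m\<in>{..d} - {n}. W n m * (lam m / \<mu>) + W n m * \<gamma> (station_dist d n m))"
      unfolding sum_distrib_left using \<mu> by (intro sum.cong) (auto simp: field_simps)
    finally have "W n n = W n n * (lam n / \<mu>) + (\<Sum>m\<in>{..d} - {n}. W n m * (lam m / \<mu>) + W n m * \<gamma> (station_dist d n m))"
      using \<mu> by (simp add: field_simps)
    moreover have "(\<Sum>m\<le>d. W n m * (lam m / \<mu>)) = W n n * (lam n / \<mu>) + (\<Sum>m\<in>{..d} - {n}. W n m * (lam m / \<mu>))"
      "(\<Sum>m\<le>d. W n m * (if m = n then 0 else \<gamma> (station_dist d n m))) = (\<Sum>m\<in>{..d} - {n}. W n m * \<gamma> (station_dist d n m))"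
      using n by (simp_all add: sum.remove[of "{..d}" n] cong: if_cong)
    ultimately show ?thesis by (simp add: sum.distrib)
  qed
  finally show ?thesis .
qed

text \<open>Strictness in the logarithmic inequality rests on this. A constant value would almost
  surely rule out two arrivals at \<open>n\<close> during the service; Fubini fixes a positive
  service time, for which \<open>two_arrivals_positive\<close> says otherwise.\<close>

lemma lyapunov_not_constant:
  assumes y: "(n, x) \<in> serving_states d" "\<not> no_customers d x"
  shows "\<not> (AE \<omega> in env_law d lam. V (fst (poll_map d q ((n, x), \<omega>))) = V (n, x))"
proof
  have n: "n \<le> d" "0 < x n" using y by (auto simp: serving_states_def)
  interpret E: prob_space "exponential_law 1" by (rule prob_space_exponential_law) simp
  interpret L: prob_space "arrival_law (lam n)" using lam[OF n(1)] by (rule prob_space_arrival_law)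
  interpret pair_prob_space "exponential_law 1" "arrival_law (lam n)" ..
  let ?P = "\<lambda>z :: real \<times> (nat \<Rightarrow> real). arrivals (snd z) (service_time q n (fst z)) < 2"
  assume const: "AE \<omega> in env_law d lam. V (fst (poll_map d q ((n, x), \<omega>))) = V (n, x)"
  have [measurable]: "(\<lambda>z. service_time q n (fst z)) \<in> borel_measurable (exponential_law 1 \<Otimes>\<^sub>M arrival_law (lam n))"
    by (rule measurable_service_time) auto
  have [measurable]: "(\<lambda>z. arrivals (snd z) (service_time q n (fst z))) \<in> exponential_law 1 \<Otimes>\<^sub>M arrival_law (lam n) \<rightarrow>\<^sub>M count_space UNIV"
    by measurable
  have P: "{z \<in> space (exponential_law 1 \<Otimes>\<^sub>M arrival_law (lam n)). ?P z} \<in> sets (exponential_law 1 \<Otimes>\<^sub>M arrival_law (lam n))"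
    by measurable
  note distr_iff = AE_distr_iff[OF measurable_env_service_arrivals[where lam=lam, OF n(1)] P]
  have D: "distr (env_law d lam) (exponential_law 1 \<Otimes>\<^sub>M arrival_law (lam n)) (\<lambda>\<omega>. (fst (fst \<omega>) 0, snd \<omega> n))
    = exponential_law 1 \<Otimes>\<^sub>M arrival_law (lam n)"
    by (rule distr_env_law_arrivals) (use lam n in auto)
  have "AE \<omega> in env_law d lam. ?P (fst (fst \<omega>) 0, snd \<omega> n)"
    using const
  proof eventually_elim
    case (elim \<omega>)
    let ?c = "poll_counts d q n (fst (fst \<omega>) 0) (snd \<omega>)"
    have "\<not> 2 \<le> ?c n"
    proof
      assume "2 \<le> ?c n"
      from lyapunov_poll_step_greater[where c="?c" and u="snd (fst \<omega>) 0", OF y this] elim show False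
        by (simp add: fst_poll_map)
    qed
    then show ?case using n by (simp add: poll_counts_def)
  qed
  then have "AE z in exponential_law 1 \<Otimes>\<^sub>M arrival_law (lam n). ?P z"
    using distr_iff unfolding D by blast
  from AE_pair[OF this] AE_exponential_law_pos[of 1, simplified]
  have "AE e in exponential_law 1. False"
  proof eventually_elim
    case (elim e)
    have s: "0 < service_time q n e"
      using elim(2) lam[OF n(1)] stable[OF n(1)] by (simp add: service_time_def)
    have "AE b in arrival_law (lam n). service_time q n e < (\<Sum>j\<le>Suc 0. b j)"
      using elim(1) AE_good_arrivals[OF lam[OF n(1)]]
    proof eventually_elim
      case (elim b)
      then show ?case
        using good_arrivals_le_iff[OF elim(2), of "Suc 0" "service_time q n e"] by (simp add: not_le[symmetric])
    qed
    with two_arrivals_positive[OF lam[OF n(1)] s] show False by simp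
  qed
  then show False by simp
qed

text \<open>All weights are at least the positive minimum \<open>\<delta>\<close>, so every queue
  length is at most \<open>C / \<delta>\<close>.\<close>

lemma finite_lyapunov_sublevel: "finite {y \<in> serving_states d. V y \<le> C}"
proof -
  define \<delta> where "\<delta> = Min ((\<lambda>(n, m). W n m) ` ({..d} \<times> {..d}))"
  have \<delta>: "0 < \<delta>" unfolding \<delta>_def using W_pos by (subst Min_gr_iff) auto
  have \<delta>_le: "\<delta> \<le> W n m" if "n \<le> d" "m \<le> d" for n m
    unfolding \<delta>_def using that by (intro Min_le) force+
  define K where "K = nat \<lceil>C / \<delta>\<rceil>"
  have "{y \<in> serving_states d. V y \<le> C} \<subseteq> {..d} \<times> {x. \<forall>m. (m \<in> {..d} \<longrightarrow> x m \<in> {..K}) \<and> (m \<notin> {..d} \<longrightarrow> x m = 0)}"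
  proof (rule subsetI)
    fix z assume z: "z \<in> {y \<in> serving_states d. V y \<le> C}"
    obtain n x where nx: "z = (n, x)" by (cases z)
    have y: "(n, x) \<in> serving_states d" "V (n, x) \<le> C" using z by (auto simp: nx)
    have n: "n \<le> d" using y by (simp add: serving_states_def)
    have "x m \<le> K" if "m \<le> d" for m
    proof -
      have "\<delta> * real (x m) \<le> W n m * real (x m)" using \<delta>_le[OF n that] by (intro mult_right_mono) auto
      also have "\<dots> \<le> V (n, x)"
        unfolding lyapunov_def fst_conv snd_conv using that
        by (intro member_le_sum mult_nonneg_nonneg less_imp_le[OF W_pos[OF n]]) auto
      finally have "real (x m) \<le> C / \<delta>" using y \<delta> by (simp add: field_simps)
      then show ?thesis unfolding K_def by linarith
    qed
    then show "z \<in> {..d} \<times> {x. \<forall>m. (m \<in> {..d} \<longrightarrow> x m \<in> {..K}) \<and> (m \<notin> {..d} \<longrightarrow> x m = 0)}"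
      using y n by (auto simp: nx serving_states_def)
  qed
  moreover have "finite ({..d} \<times> {x. \<forall>m. (m \<in> {..d} \<longrightarrow> x m \<in> {..K}) \<and> (m \<notin> {..d} \<longrightarrow> x m = 0)})"
    by (intro finite_cartesian_product finite_set_of_finite_funs) auto
  ultimately show ?thesis by (rule finite_subset)
qed

theorem AE_polling_empties:
  assumes "y \<in> serving_states d"
  shows "AE \<omega> in env_law d lam. \<exists>j. no_customers d (snd (fst ((poll_map d q ^^ j) (y, \<omega>))))"
proof -
  interpret prob_space "env_law d lam" using lam by (rule prob_space_env_law)
  let ?f = "\<lambda>y. ennreal (ln (1 + V y))"
  have stat: "fst y \<le> d" if "y \<in> serving_states d" for y using that by (auto simp: serving_states_def)
  have X: "(\<integral>\<^sup>+\<omega>. ?f (fst (poll_map d q (y, \<omega>))) \<partial>env_law d lam) \<le> ?f y \<and>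
      (\<not> no_customers d (snd y) \<longrightarrow> (\<integral>\<^sup>+\<omega>. ?f (fst (poll_map d q (y, \<omega>))) \<partial>env_law d lam) < ?f y)"
    if y: "y \<in> serving_states d" for y
  proof (cases "no_customers d (snd y)")
    case True
    then show ?thesis by (simp add: fst_poll_map poll_step_def emeasure_space_1)
  next
    case False
    obtain n x where nx: "y = (n, x)" by (cases y)
    let ?X = "\<lambda>\<omega>. V (fst (poll_map d q ((n, x), \<omega>)))"
    have X0: "0 \<le> ?X \<omega>" for \<omega>
      unfolding fst_poll_map by (intro V_nonneg stat poll_step_serving_states y[unfolded nx])
    have le: "(\<integral>\<^sup>+\<omega>. ennreal (?X \<omega>) \<partial>env_law d lam) \<le> ennreal (V (n, x))"
      using y False by (intro nn_integral_lyapunov_le) (auto simp: nx)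
    have V0: "0 \<le> V (n, x)" using V_nonneg[OF stat[OF y]] nx by simp
    have "\<not> (AE \<omega> in env_law d lam. ?X \<omega> = V (n, x))"
      using y False by (intro lyapunov_not_constant) (auto simp: nx)
    with nn_integral_ln_less[OF measurable_V_poll_map X0 le V0] show ?thesis by (simp add: nx)
  qed
  show ?thesis
  proof (rule AE_eventually_empty[where I="serving_states d" and f="?f"])
    show "finite {y \<in> serving_states d. ?f y \<le> of_nat k}" for k
    proof (rule finite_subset[OF _ finite_lyapunov_sublevel])
      show "{y \<in> serving_states d. ?f y \<le> of_nat k} \<subseteq> {y \<in> serving_states d. V y \<le> exp (real k)}"
      proof (rule subsetI)
        fix y assume "y \<in> {y \<in> serving_states d. ?f y \<le> of_nat k}"
        then have y: "y \<in> serving_states d" "?f y \<le> of_nat k" by auto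
        have V0: "0 \<le> V y" using V_nonneg[OF stat[OF y(1)]] .
        then have "ln (1 + V y) \<le> real k"
          using y(2) by (simp add: ennreal_of_nat_eq_real_of_nat)
        then have "1 + V y \<le> exp (real k)"
          using V0 by (subst (asm) exp_le_cancel_iff[symmetric]) simp
        then show "y \<in> {y \<in> serving_states d. V y \<le> exp (real k)}" using y(1) by simp
      qed
    qed
    show "0 < fst (q (fst y))" if "y \<in> serving_states d" for y
      using stat[OF that] lam[of "fst y"] stable[of "fst y"] by simp
    show "fst (poll_map d q (y, \<omega>)) \<in> serving_states d" if "y \<in> serving_states d" for y \<omega>
      unfolding fst_poll_map by (rule poll_step_serving_states[OF that])
  qed (use lam X assms in auto)
qed

end

section \<open>The polling process\<close>

text \<open>An initial configuration may have arbitrary entries beyond \<open>d\<close>, which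
  \<open>polling_state\<close> clears only at the first service. They have to be removed beforehand
  to start in \<open>serving_states\<close>.\<close>

definition truncate :: "nat \<Rightarrow> (nat \<Rightarrow> nat) \<Rightarrow> nat \<Rightarrow> nat" where
  "truncate d x m = (if m \<le> d then x m else 0)"

lemma no_customers_truncate: "no_customers d (truncate d x) \<longleftrightarrow> no_customers d x"
  by (simp add: no_customers_def truncate_def)

text \<open>In \<open>poll_map\<close> the environment is restarted after every service; for regular arrival
  streams this reproduces the absolute clock of the polling process.\<close>

lemma poll_map_funpow_polling_state:
  assumes a: "\<And>m. m \<le> d \<Longrightarrow> good_arrivals (a m)" and e: "\<And>i. 0 < e i" and r: "\<And>v. r v = q (v mod (d + 1))"
    and \<mu>: "\<And>n. n \<le> d \<Longrightarrow> 0 < fst (q n)"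
    and nonempty: "\<And>j. \<not> no_customers d (snd (snd (polling_state d x0 a e u r j)))"
  shows "\<exists>t v x. polling_state d x0 a e u r j = (t, v, x) \<and> 0 \<le> t \<and>
    (poll_map d q ^^ j) ((serving_visit d x0 0 mod (d + 1), truncate d x0), ((e, u), \<lambda>m\<in>{0..d}. a m))
      = ((v mod (d + 1), truncate d x), ((\<lambda>i. e (i + j), \<lambda>i. u (i + j)), \<lambda>m\<in>{0..d}. resid (a m) t))"
proof (induction j)
  case 0
  have "(\<lambda>m\<in>{0..d}. a m) = (\<lambda>m\<in>{0..d}. resid (a m) 0)"
    using a by (auto simp: fun_eq_iff resid_0 restrict_def)
  then show ?case by simp
next
  case (Suc j)
  then obtain t v x where IH: "polling_state d x0 a e u r j = (t, v, x)" "0 \<le> t"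
    "(poll_map d q ^^ j) ((serving_visit d x0 0 mod (d + 1), truncate d x0), ((e, u), \<lambda>m\<in>{0..d}. a m))
      = ((v mod (d + 1), truncate d x), ((\<lambda>i. e (i + j), \<lambda>i. u (i + j)), \<lambda>m\<in>{0..d}. resid (a m) t))"
    by blast
  define n where "n = v mod (d + 1)"
  have n: "n \<le> d" by (simp add: n_def less_Suc_eq_le[symmetric])
  \<comment> \<open>Once the system is empty, \<open>polling_state\<close> stops its clock while
    \<open>poll_map\<close> keeps consuming the environment, so the two agree only as long as
    customers are present.\<close>
  have ne: "\<not> no_customers d x" using nonempty[of j] IH(1) by simp
  define s where "s = e j / fst (q n)"
  have s: "0 \<le> s" "service_time q n (e j) = s"
    using e[of j] \<mu>[OF n] by (simp_all add: s_def service_time_def)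
  define x' where "x' = (\<lambda>m. if m \<le> d
      then x m + (arrivals (a m) (t + s) - arrivals (a m) t) - (if m = n then 1 else 0)
        + (if route d n (snd (q n)) (u j) = Some m then 1 else 0)
      else 0)"
  have st: "polling_state d x0 a e u r (Suc j) = (t + s, serving_visit d x' v, x')"
  proof -
    have rv: "r v = (fst (q (v mod (d + 1))), snd (q (v mod (d + 1))))" using r[of v] by simp
    show ?thesis
      unfolding x'_def s_def n_def polling_state.simps IH(1) Let_def prod.case rv using ne by simp
  qed
  have nq: "next_queues d n (truncate d x) (\<lambda>m\<in>{0..d}. arrivals ((\<lambda>m\<in>{0..d}. resid (a m) t) m) s) (route d n (snd (q n)) (u j)) = x'"
    using a s by (auto simp: fun_eq_iff next_queues_def x'_def truncate_def arrivals_resid)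
  have tr: "truncate d x' = x'" by (auto simp: fun_eq_iff truncate_def x'_def)
  have res: "(\<lambda>m\<in>{0..d}. resid ((\<lambda>m\<in>{0..d}. resid (a m) t) m) s) = (\<lambda>m\<in>{0..d}. resid (a m) (t + s))"
    using a s by (auto simp: fun_eq_iff restrict_def resid_resid)
  have "(poll_map d q ^^ Suc j) ((serving_visit d x0 0 mod (d + 1), truncate d x0), ((e, u), \<lambda>m\<in>{0..d}. a m))
    = poll_map d q ((n, truncate d x), ((\<lambda>i. e (i + j), \<lambda>i. u (i + j)), \<lambda>m\<in>{0..d}. resid (a m) t))"
    using IH(3) by (simp add: n_def)
  also have "\<dots> = ((serving_visit d x' n mod (d + 1), x'), ((\<lambda>i. e (i + Suc j), \<lambda>i. u (i + Suc j)), \<lambda>m\<in>{0..d}. resid (a m) (t + s)))"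
    unfolding poll_map_def poll_counts_def poll_resid_def poll_step_def prod.case fst_conv snd_conv no_customers_truncate Let_def add_0 s(2) nq res
    using ne by simp
  also have "serving_visit d x' n mod (d + 1) = serving_visit d x' v mod (d + 1)"
    unfolding n_def by (rule serving_visit_mod[symmetric])
  finally show ?case
    using st IH(2) s(1) by (intro exI[of _ "t + s"] exI[of _ "serving_visit d x' v"] exI[of _ x']) (simp add: tr)
qed

lemma AE_pair_fstI:
  assumes "prob_space M2" "AE x in M1. P x"
  shows "AE z in M1 \<Otimes>\<^sub>M M2. P (fst z)"
proof -
  interpret prob_space M2 by fact
  show ?thesis by (rule AE_distrD[OF measurable_fst]) (subst distr_pair_fst, rule assms(2))
qed

lemma AE_pair_sndI:
  assumes "prob_space M1" "prob_space M2" "AE x in M2. P x"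
  shows "AE z in M1 \<Otimes>\<^sub>M M2. P (snd z)"
proof -
  interpret M1: prob_space M1 by fact
  interpret M2: prob_space M2 by fact
  interpret Q: pair_prob_space M2 M1 ..
  have "AE z in M2 \<Otimes>\<^sub>M M1. P (fst z)" by (rule AE_pair_fstI[OF assms(1,3)])
  then have "AE z in distr (M1 \<Otimes>\<^sub>M M2) (M2 \<Otimes>\<^sub>M M1) (\<lambda>(x, y). (y, x)). P (fst z)"
    by (subst Q.distr_pair_swap[symmetric])
  from AE_distrD[OF measurable_pair_swap' this] show ?thesis
    by (simp add: case_prod_beta')
qed

lemma emptying_time_finite:
  assumes "no_customers d (snd (snd (polling_state d x0 a e u r j)))"
  shows "emptying_time d x0 a e u r \<noteq> \<infinity>"
proof -
  obtain t v x where "polling_state d x0 a e u r j = (t, v, x)" by (metis prod_cases3)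
  then have "emptying_time d x0 a e u r \<le> ereal t"
    unfolding emptying_time_def using assms by (intro Inf_lower) auto
  then show ?thesis by auto
qed

text \<open>The event is only known to lie inside a null set, which is enough:
  \<open>emeasure_mono\<close> asks for measurability of the larger set alone.\<close>

lemma not_transientI:
  assumes "AE \<omega> in polling_space d lam \<nu>. case \<omega> of (a, e, u, r) \<Rightarrow> emptying_time d x0 a e u r \<noteq> \<infinity>"
  shows "\<not> transient d lam \<nu> x0"
proof -
  let ?A = "{(a, e, u, r) \<in> space (polling_space d lam \<nu>). emptying_time d x0 a e u r = \<infinity>}"
  obtain N where N: "{\<omega> \<in> space (polling_space d lam \<nu>). \<not> (case \<omega> of (a, e, u, r) \<Rightarrow> emptying_time d x0 a e u r \<noteq> \<infinity>)} \<subseteq> N"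
    "emeasure (polling_space d lam \<nu>) N = 0" "N \<in> sets (polling_space d lam \<nu>)"
    using AE_E[OF assms] by blast
  then have "?A \<subseteq> N" by auto
  then have "emeasure (polling_space d lam \<nu>) ?A = 0"
    using emeasure_mono[of ?A N "polling_space d lam \<nu>"] N by simp
  then show ?thesis by (simp add: transient_def measure_def)
qed

text \<open>By \<open>w_le\<close>, the row \<open>w\<close> times the cycle matrix is at most
  \<open>w\<close>, so the chain empties almost surely. What remains is to transport this to
  \<open>polling_space\<close>, whose factors are ordered differently and include the regimes,
  almost surely equal to those of \<open>q\<close>.\<close>

theorem not_transient_of_supersolution:
  assumes d: "1 \<le> d" and lam: "\<And>m. m \<le> d \<Longrightarrow> 0 < lam m"
    and q: "\<And>n. n \<le> d \<Longrightarrow> q n \<in> regimes d" and stable: "\<And>n. n \<le> d \<Longrightarrow> lam n < fst (q n)"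
    and w: "\<And>i. i < d \<Longrightarrow> 0 < w i"
    and w_le: "\<And>i. i < d \<Longrightarrow> visit_row d lam q w 0 i \<le> w i"
    and x0: "\<not> no_customers d x0"
  shows "\<not> transient d lam (\<lambda>n. return borel (q n)) x0"
proof (rule not_transientI)
  let ?E = "\<Pi>\<^sub>M j\<in>(UNIV::nat set). exponential_law 1" and ?U = "\<Pi>\<^sub>M j\<in>(UNIV::nat set). unif_law"
  let ?A = "\<Pi>\<^sub>M m\<in>{0..d}. arrival_law (lam m)" and ?R = "\<Pi>\<^sub>M v\<in>(UNIV::nat set). return borel (q (v mod (d + 1)))"
  interpret E: prob_space ?E by (intro prob_space_PiM prob_space_exponential_law) simp
  interpret U: prob_space ?U by (intro prob_space_PiM prob_space_unif_law)
  interpret A: prob_space ?A by (intro prob_space_PiM prob_space_arrival_law) (use lam in auto)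
  interpret R: prob_space ?R by (intro prob_space_PiM prob_space_return) auto
  interpret UR: pair_prob_space ?U ?R ..
  interpret EUR: pair_prob_space ?E "?U \<Otimes>\<^sub>M ?R" ..
  interpret AEUR: pair_prob_space ?A "?E \<Otimes>\<^sub>M (?U \<Otimes>\<^sub>M ?R)" ..
  interpret EU: pair_prob_space ?E ?U ..
  interpret EUA: pair_prob_space "?E \<Otimes>\<^sub>M ?U" ?A ..
  define y0 where "y0 = (serving_visit d x0 0 mod (d + 1), truncate d x0)"
  have "y0 \<in> serving_states d"
    using serving_visit_props(2)[OF x0, of 0] by (simp add: y0_def serving_states_def truncate_def less_Suc_eq_le[symmetric])
  then have main: "AE \<omega> in env_law d lam. \<exists>j. no_customers d (snd (fst ((poll_map d q ^^ j) (y0, \<omega>))))"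
    using d lam q stable w w_le by (intro AE_polling_empties)
  have mu: "0 < fst (q n)" if "n \<le> d" for n using lam[OF that] stable[OF that] by simp
  show "AE \<omega> in polling_space d lam (\<lambda>n. return borel (q n)). case \<omega> of (a, e, u, r) \<Rightarrow> emptying_time d x0 a e u r \<noteq> \<infinity>"
  proof -
    have space: "polling_space d lam (\<lambda>n. return borel (q n)) = ?A \<Otimes>\<^sub>M (?E \<Otimes>\<^sub>M (?U \<Otimes>\<^sub>M ?R))"
      by (simp add: polling_space_def)
    \<comment> \<open>Projecting away the regimes leaves the law of service requirements and routing
      variables unchanged, since the regimes form a probability factor.\<close>
    have EU_distr: "distr (?E \<Otimes>\<^sub>M (?U \<Otimes>\<^sub>M ?R)) (?E \<Otimes>\<^sub>M ?U) (\<lambda>(e, z). (e, fst z)) = ?E \<Otimes>\<^sub>M ?U"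
      using pair_measure_distr[OF measurable_ident_sets[OF refl] measurable_fst, of ?U ?R ?E]
        U.sigma_finite_measure_axioms unfolding R.distr_pair_fst distr_id by metis
    have AEU_distr: "distr (?A \<Otimes>\<^sub>M (?E \<Otimes>\<^sub>M (?U \<Otimes>\<^sub>M ?R))) (?A \<Otimes>\<^sub>M (?E \<Otimes>\<^sub>M ?U)) (\<lambda>(a, z). (a, case z of (e, z) \<Rightarrow> (e, fst z)))
      = ?A \<Otimes>\<^sub>M (?E \<Otimes>\<^sub>M ?U)"
    proof -
      have "(\<lambda>(e, z). (e, fst z)) \<in> ?E \<Otimes>\<^sub>M (?U \<Otimes>\<^sub>M ?R) \<rightarrow>\<^sub>M ?E \<Otimes>\<^sub>M ?U" by measurable
      from pair_measure_distr[OF measurable_ident_sets[OF refl] this, of ?A] show ?thesis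
        using EU.P.sigma_finite_measure_axioms unfolding EU_distr distr_id by metis
    qed
    have "AE \<omega> in ?A \<Otimes>\<^sub>M (?E \<Otimes>\<^sub>M ?U). \<exists>j. no_customers d (snd (fst ((poll_map d q ^^ j) (y0, case \<omega> of (a, eu) \<Rightarrow> (eu, a)))))"
      using main unfolding env_law_def
      by (subst (asm) EUA.distr_pair_swap) (rule AE_distrD[OF measurable_pair_swap'])
    then have 1: "AE \<omega> in ?A \<Otimes>\<^sub>M (?E \<Otimes>\<^sub>M (?U \<Otimes>\<^sub>M ?R)). \<exists>j. no_customers d
        (snd (fst ((poll_map d q ^^ j) (y0, ((fst (snd \<omega>), fst (snd (snd \<omega>))), fst \<omega>)))))"
      by (subst (asm) AEU_distr[symmetric]) (drule AE_distrD[rotated], simp_all add: case_prod_beta')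
    have "AE a in ?A. \<forall>m\<in>{0..d}. good_arrivals (a m)"
      using lam by (intro AE_finite_allI AE_PiM_component[where P=good_arrivals] AE_good_arrivals prob_space_arrival_law) auto
    then have 2: "AE \<omega> in ?A \<Otimes>\<^sub>M (?E \<Otimes>\<^sub>M (?U \<Otimes>\<^sub>M ?R)). \<forall>m\<in>{0..d}. good_arrivals (fst \<omega> m)"
      by (rule AE_pair_fstI[OF EUR.P.prob_space_axioms])
    have "AE e in ?E. \<forall>i. 0 < e i"
      by (rule AE_arrival_law_pos) simp
    then have 3: "AE \<omega> in ?A \<Otimes>\<^sub>M (?E \<Otimes>\<^sub>M (?U \<Otimes>\<^sub>M ?R)). \<forall>i. 0 < fst (snd \<omega>) i"
      by (intro AE_pair_sndI[where P="\<lambda>z. \<forall>i. 0 < fst z i"] AE_pair_fstI A.prob_space_axioms EUR.P.prob_space_axioms UR.P.prob_space_axioms)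
    have "AE r in ?R. r v = q (v mod (d + 1))" for v
      by (rule AE_PiM_component) (auto intro!: prob_space_return simp: AE_return)
    then have "AE r in ?R. \<forall>v. r v = q (v mod (d + 1))"
      by (simp add: AE_all_countable)
    then have 4: "AE \<omega> in ?A \<Otimes>\<^sub>M (?E \<Otimes>\<^sub>M (?U \<Otimes>\<^sub>M ?R)). \<forall>v. snd (snd (snd \<omega>)) v = q (v mod (d + 1))"
      by (intro AE_pair_sndI[where P="\<lambda>z. \<forall>v. snd (snd z) v = q (v mod (d + 1))"] AE_pair_sndI[where P="\<lambda>z. \<forall>v. snd z v = q (v mod (d + 1))"]
          AE_pair_sndI[where P="\<lambda>r. \<forall>v. r v = q (v mod (d + 1))"]
          A.prob_space_axioms EUR.P.prob_space_axioms UR.P.prob_space_axioms E.prob_space_axioms U.prob_space_axioms R.prob_space_axioms)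
    show ?thesis
      unfolding space using 1 2 3 4 AE_space
    proof eventually_elim
      case (elim \<omega>)
      obtain a e u r where \<omega>: "\<omega> = (a, e, u, r)" by (metis prod_cases4)
      have "a \<in> extensional {0..d}"
        using elim(5) by (auto simp: \<omega> space_pair_measure space_PiM PiE_iff)
      then have ext: "(\<lambda>m\<in>{0..d}. a m) = a" by (rule extensional_restrict)
      have good: "good_arrivals (a m)" if "m \<le> d" for m using elim(2) that by (simp add: \<omega>)
      have e: "0 < e i" for i using elim(3) by (simp add: \<omega>)
      have r: "r v = q (v mod (d + 1))" for v using elim(4) by (simp only: \<omega> snd_conv)
      obtain j where j: "no_customers d (snd (fst ((poll_map d q ^^ j) (y0, ((e, u), a)))))"
        using elim(1) by (auto simp: \<omega>)
      have "emptying_time d x0 a e u r \<noteq> \<infinity>"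
      proof
        assume "emptying_time d x0 a e u r = \<infinity>"
        then have "\<not> no_customers d (snd (snd (polling_state d x0 a e u r j)))" for j
          using emptying_time_finite by blast
        then obtain t v x where "polling_state d x0 a e u r j = (t, v, x)"
          "snd (fst ((poll_map d q ^^ j) (y0, ((e, u), a)))) = truncate d x" "\<not> no_customers d x"
          using poll_map_funpow_polling_state[of d a e r q x0 u j, OF good e r mu] unfolding ext y0_def
          by (metis fst_conv snd_conv)
        with j show False by (simp add: no_customers_truncate)
      qed
      then show ?case by (simp add: \<omega>)
    qed
  qed
qed

section \<open>Positive matrices\<close>

definition row_op :: "nat \<Rightarrow> (nat \<Rightarrow> nat \<Rightarrow> real) \<Rightarrow> (nat \<Rightarrow> real) \<Rightarrow> nat \<Rightarrow> real" where
  "row_op d B w i = (\<Sum>k<d. w k * B k i)"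

lemma row_op_pos:
  assumes "\<And>k i. k < d \<Longrightarrow> i < d \<Longrightarrow> 0 < B k i" "\<And>k. k < d \<Longrightarrow> 0 \<le> w k" "\<exists>k<d. w k \<noteq> 0" "i < d"
  shows "0 < row_op d B w i"
proof -
  obtain k where k: "k < d" "w k \<noteq> 0" using assms(3) by blast
  then have "0 < w k * B k i" using assms(1)[of k i] assms(2)[of k] assms(4) by (simp add: less_le)
  moreover have "0 \<le> w j * B j i" if "j < d" for j
    using assms(1)[OF that assms(4)] assms(2)[OF that] by simp
  ultimately show ?thesis
    unfolding row_op_def using k(1) by (intro sum_pos2[where i=k]) auto
qed

lemma row_op_mult: "row_op d B (\<lambda>k. c * w k) i = c * row_op d B w i"
  by (simp add: row_op_def sum_distrib_left mult_ac)

lemma row_op_diff: "row_op d B (\<lambda>k. v k - w k) i = row_op d B v i - row_op d B w i"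
  by (simp add: row_op_def sum_subtractf algebra_simps)

lemma row_op_cong: "(\<And>k. k < d \<Longrightarrow> v k = w k) \<Longrightarrow> row_op d B v i = row_op d B w i"
  by (simp add: row_op_def)

lemma continuous_on_Max_atMost:
  fixes g :: "nat \<Rightarrow> 'a::topological_space \<Rightarrow> real"
  assumes "\<And>i. i \<le> n \<Longrightarrow> continuous_on S (g i)"
  shows "continuous_on S (\<lambda>w. Max ((\<lambda>i. g i w) ` {..n}))"
  using assms
proof (induction n)
  case (Suc n)
  have "Max ((\<lambda>i. g i w) ` {..Suc n}) = max (g (Suc n) w) (Max ((\<lambda>i. g i w) ` {..n}))" for w
    unfolding atMost_Suc image_insert by (subst Max_insert) auto
  then show ?case using Suc by (auto intro!: continuous_on_max)
qed simp

text \<open>Vectors are functions on \<open>nat\<close>. Fixing the coordinates from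
  \<open>d\<close> on at 0 makes the surrounding box a product of compact sets, so Tychonoff's
  theorem applies.\<close>

lemma compact_standard_simplex:
  "compact {w :: nat \<Rightarrow> real. (\<forall>i. 0 \<le> w i) \<and> (\<forall>i\<ge>d. w i = 0) \<and> (\<Sum>i<d. w i) = 1}" (is "compact ?K")
proof -
  let ?P = "PiE UNIV (\<lambda>i. if i < d then {0..1::real} else {0})"
  have "compactin (product_topology (\<lambda>i. euclidean) UNIV) ?P"
    by (subst compactin_PiE) auto
  then have "compact ?P"
    by (simp add: euclidean_product_topology)
  moreover have "closed {w :: nat \<Rightarrow> real. (\<Sum>i<d. w i) = 1}"
    by (intro closed_Collect_eq continuous_on_sum continuous_on_product_coordinates continuous_on_const)
  ultimately have "compact (?P \<inter> {w. (\<Sum>i<d. w i) = 1})"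
    by (rule compact_Int_closed)
  also have "?P \<inter> {w. (\<Sum>i<d. w i) = 1} = ?K"
  proof (intro equalityI subsetI)
    fix w assume w: "w \<in> ?K"
    have "w i \<le> 1" if "i < d" for i
      using member_le_sum[of i "{..<d}" w] w that by auto
    with w show "w \<in> ?P \<inter> {w. (\<Sum>i<d. w i) = 1}"
      by (auto simp: PiE_iff)
  next
    fix w assume w: "w \<in> ?P \<inter> {w. (\<Sum>i<d. w i) = 1}"
    then have *: "w i \<in> (if i < d then {0..1} else {0})" for i by (auto simp: PiE_iff)
    have "0 \<le> w i" for i using *[of i] by (cases "i < d") auto
    moreover have "w i = 0" if "d \<le> i" for i using *[of i] that by auto
    ultimately
    show "w \<in> ?K" using w by auto
  qed
  finally show ?thesis .
qed

text \<open>Minimising the Collatz--Wielandt quotient over the image of the simplex: if it were not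
  constant in the coordinates at the minimum, one more application of the operator would
  decrease it.\<close>

lemma positive_matrix_left_eigenvector:
  assumes d: "1 \<le> d" and B: "\<And>k i. k < d \<Longrightarrow> i < d \<Longrightarrow> 0 < B k i"
  obtains w \<rho> where "\<And>i. i < d \<Longrightarrow> 0 < w i" "0 < \<rho>" "\<And>i. i < d \<Longrightarrow> row_op d B w i = \<rho> * w i"
proof -
  define F where "F = row_op d B"
  define K where "K = {w :: nat \<Rightarrow> real. (\<forall>i. 0 \<le> w i) \<and> (\<forall>i\<ge>d. w i = 0) \<and> (\<Sum>i<d. w i) = 1}"
  \<comment> \<open>The quotient is taken at \<open>F w\<close>, which is strictly positive even
    when \<open>w\<close> lies on the boundary of the simplex. Hence \<open>\<phi>\<close> is
    continuous on all of \<open>K\<close>.\<close>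
  define \<phi> where "\<phi> w = Max ((\<lambda>i. F (F w) i / F w i) ` {..d - 1})" for w
  have lt: "i \<le> d - 1 \<longleftrightarrow> i < d" for i using d by auto
  have Kpos: "\<exists>k<d. w k \<noteq> 0" if "w \<in> K" for w
    using that unfolding K_def by (metis (mono_tags, lifting) lessThan_iff mem_Collect_eq sum.neutral zero_neq_one)
  have Fpos: "0 < F w i" if "w \<in> K" "i < d" for w i
    unfolding F_def using that Kpos[OF that(1)] by (intro row_op_pos B) (auto simp: K_def)
  have contF: "continuous_on S (\<lambda>w. F (G w) i)" if "\<And>k. continuous_on S (\<lambda>w. G w k)"
    for S :: "(nat \<Rightarrow> real) set" and G :: "(nat \<Rightarrow> real) \<Rightarrow> nat \<Rightarrow> real" and i
    unfolding F_def row_op_def by (intro continuous_intros that)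
  have contF1: "continuous_on S (\<lambda>w. F w i)" for S i
    by (rule contF) (rule continuous_on_subset[OF continuous_on_product_coordinates], simp)
  have "continuous_on K \<phi>"
    unfolding \<phi>_def
  proof (rule continuous_on_Max_atMost)
    fix i assume "i \<le> d - 1"
    then show "continuous_on K (\<lambda>w. F (F w) i / F w i)"
      using Fpos lt by (intro continuous_on_divide contF contF1) (auto simp: less_le)
  qed
  moreover have "K \<noteq> {}"
  proof -
    have "(\<lambda>i. if i = 0 then 1 else 0) \<in> K"
      using d by (auto simp: K_def sum.delta)
    then show ?thesis by blast
  qed
  moreover have "compact K" unfolding K_def by (rule compact_standard_simplex)
  ultimately obtain w0 where w0: "w0 \<in> K" "\<And>w. w \<in> K \<Longrightarrow> \<phi> w0 \<le> \<phi> w"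
    using continuous_attains_inf[of K \<phi>] by blast
  define v where "v = F w0"
  define \<rho> where "\<rho> = \<phi> w0"
  have v: "0 < v i" if "i < d" for i using Fpos[OF w0(1) that] by (simp add: v_def)
  have Fv: "0 < F v i" if "i < d" for i
    unfolding F_def using that v d by (intro row_op_pos B) (auto intro: less_imp_le simp: less_le)
  have le: "F v i \<le> \<rho> * v i" if "i < d" for i
  proof -
    have "F v i / v i \<le> \<rho>"
      unfolding \<rho>_def \<phi>_def v_def using that lt by (intro Max_ge) auto
    then show ?thesis using v[OF that] by (simp add: field_simps)
  qed
  have "0 < \<rho>"
  proof -
    have "0 < \<rho> * v 0" using le[of 0] Fv[of 0] d by simp
    then show ?thesis using v[of 0] d by (simp add: zero_less_mult_iff)
  qed
  moreover have "F v i = \<rho> * v i" if "i < d" for i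
  proof (rule ccontr)
    assume ne: "F v i \<noteq> \<rho> * v i"
    define s where "s = (\<Sum>i<d. v i)"
    have s: "0 < s" unfolding s_def using d v by (intro sum_pos) (auto simp: lessThan_empty_iff)
    \<comment> \<open>The competitor is \<open>v\<close> scaled back into the simplex; the scaling
      cancels in the quotient.\<close>
    define w1 where "w1 = (\<lambda>i. if i < d then inverse s * v i else 0)"
    have "(\<Sum>i<d. w1 i) = inverse s * s"
      by (simp add: w1_def s_def sum_distrib_left)
    then have w1: "w1 \<in> K"
      using s v by (auto simp: K_def w1_def less_imp_le)
    have F1: "F w1 k = inverse s * F v k" for k
      unfolding F_def row_op_mult[symmetric] by (rule row_op_cong) (simp add: w1_def)
    have F2: "F (F w1) k = inverse s * F (F v) k" for k
      using F1 row_op_mult[of d B "inverse s" "F v" k] by (simp add: F_def row_op_def)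
    \<comment> \<open>The defect \<open>\<rho> * v k - F v k\<close> is nonnegative and nonzero at
      \<open>i\<close>, so the positive operator makes it positive in every coordinate.\<close>
    have strict: "F (F v) k < \<rho> * F v k" if "k < d" for k
    proof -
      have "0 < F (\<lambda>k. \<rho> * v k - F v k) k"
        unfolding F_def using le ne that \<open>i < d\<close> by (intro row_op_pos B) (auto simp: F_def)
      also have "\<dots> = \<rho> * F v k - F (F v) k"
        by (simp add: F_def row_op_diff row_op_mult)
      finally show ?thesis by simp
    qed
    have "\<phi> w1 < \<rho>"
      unfolding \<phi>_def
    proof (subst Max_less_iff)
      show "\<forall>a\<in>(\<lambda>i. F (F w1) i / F w1 i) ` {..d - 1}. a < \<rho>"
        using strict Fv s lt by (auto simp: F1 F2 divide_less_eq)
    qed auto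
    with w0(2)[OF w1] show False by (simp add: \<rho>_def)
  qed
  ultimately show ?thesis
    using that[of v \<rho>] v by (simp add: F_def)
qed

section \<open>Norms of matrix products\<close>

text \<open>Fekete's lemma; the limit is the infimum of the quotients. The lower bound
  \<open>C\<close> keeps this infimum finite.\<close>

lemma subadditive_quotient_tendsto:
  fixes b :: "nat \<Rightarrow> real"
  assumes sub: "\<And>m n. b (m + n) \<le> b m + b n" and bdd: "\<And>n. 1 \<le> n \<Longrightarrow> C \<le> b n / real n"
  shows "\<exists>L. (\<lambda>n. b n / real n) \<longlonglongrightarrow> L"
proof (rule exI)
  define L where "L = (INF n\<in>{1..}. b n / real n)"
  have bb: "bdd_below ((\<lambda>n. b n / real n) ` {1..})"
    using bdd by (intro bdd_belowI[of _ C]) auto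
  show "(\<lambda>n. b n / real n) \<longlonglongrightarrow> L"
  proof (rule LIMSEQ_I)
    fix e :: real assume e: "0 < e"
    have "\<exists>x\<in>(\<lambda>n. b n / real n) ` {1..}. x < L + e / 2"
      using e unfolding L_def by (intro cInf_lessD) auto
    then obtain m where m: "1 \<le> m" "b m / real m < L + e / 2" by auto
    \<comment> \<open>With \<open>n = k * m + s\<close>, this bounds both the remainder term
      \<open>b s\<close> and the error made in replacing \<open>k * m\<close> by
      \<open>n\<close>.\<close>
    define K where "K = Max ((\<lambda>s. \<bar>b s\<bar>) ` {..<m}) + \<bar>b m\<bar>"
    have mult: "b (k * m + s) \<le> real k * b m + b s" for k s
    proof (induction k)
      case (Suc k)
      have "b (Suc k * m + s) \<le> b m + b (k * m + s)" using sub[of m "k * m + s"] by (simp add: add_ac)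
      then show ?case using Suc by (simp add: algebra_simps)
    qed simp
    have upper: "b n / real n \<le> b m / real m + K / real n" if n: "1 \<le> n" for n
    proof -
      define k s where "k = n div m" and "s = n mod m"
      have ns: "n = k * m + s" and s: "s < m" using m by (simp_all add: k_def s_def)
      have "\<bar>b s\<bar> \<le> Max ((\<lambda>s. \<bar>b s\<bar>) ` {..<m})" using s by (intro Max_ge) auto
      moreover have "real k * b m \<le> real n * (b m / real m) + \<bar>b m\<bar>"
      proof -
        have "real n * (b m / real m) = real k * b m + real s / real m * b m"
          using m by (simp add: ns field_simps)
        moreover have "- (real s / real m * b m) \<le> \<bar>real s / real m * b m\<bar>" by (rule abs_ge_minus_self)
        moreover have "\<bar>real s / real m * b m\<bar> \<le> 1 * \<bar>b m\<bar>"
          unfolding abs_mult using s by (intro mult_right_mono) auto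
        ultimately show ?thesis by linarith
      qed
      ultimately have "b n \<le> real n * (b m / real m) + K"
        using mult[of k s] unfolding ns[symmetric] K_def by linarith
      then show ?thesis using n by (simp add: field_simps)
    qed
    obtain N :: nat where N: "2 * K / e < real N" using reals_Archimedean2 by blast
    have "norm (b n / real n - L) < e" if n: "max 1 N \<le> n" for n
    proof -
      have "L \<le> b n / real n" unfolding L_def using n by (intro cINF_lower bb) auto
      moreover have "K / real n < e / 2"
      proof -
        have "2 * K / e < real n" using N n by linarith
        then show ?thesis using e n by (simp add: field_simps)
      qed
      moreover have "b n / real n \<le> b m / real m + K / real n" using n by (intro upper) simp
      ultimately show ?thesis using m(2) unfolding real_norm_def by linarith
    qed
    then show "\<exists>no. \<forall>n\<ge>no. norm (b n / real n - L) < e" by blast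
  qed
qed

text \<open>Convergence has to be proved first, as \<open>lim\<close> of a divergent sequence is
  unspecified. Fekete's lemma applies to \<open>ln (a n)\<close>, which \<open>lower\<close> bounds
  below linearly; in the limit the factor \<open>c\<close> disappears under the \<open>n\<close>-th
  root.\<close>

lemma submultiplicative_root_limit:
  fixes a :: "nat \<Rightarrow> real"
  assumes sub: "\<And>m n. a (m + n) \<le> a m * a n" and c: "0 < c" and r: "0 < r"
    and lower: "\<And>n. c * r ^ n \<le> a n"
  shows "r \<le> lim (\<lambda>n. a n powr (1 / real n))"
proof -
  have pos: "0 < a n" for n using lower[of n] c r by (meson less_le_trans mult_pos_pos zero_less_power)
  define b where "b n = ln (a n)" for n
  have "ln (a (m + n)) \<le> ln (a m) + ln (a n)" for m n
    using sub[of m n] pos by (simp add: ln_mult_pos[symmetric])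
  moreover have "- \<bar>ln c\<bar> + ln r \<le> b n / real n" if n: "1 \<le> n" for n
  proof -
    have "ln (c * r ^ n) \<le> b n" unfolding b_def using lower[of n] c r pos by simp
    then have "ln c + real n * ln r \<le> b n" using c r by (simp add: ln_mult_pos ln_realpow)
    moreover have "- (real n * \<bar>ln c\<bar>) \<le> ln c"
      using n mult_right_mono[of 1 "real n" "\<bar>ln c\<bar>"] by linarith
    ultimately show ?thesis using n by (simp add: field_simps)
  qed
  ultimately obtain L where L: "(\<lambda>n. b n / real n) \<longlonglongrightarrow> L"
    using subadditive_quotient_tendsto[of b] unfolding b_def by blast
  have root: "a n powr (1 / real n) = exp (b n / real n)" for n
    using pos[of n] by (simp add: powr_def b_def)
  have lim: "(\<lambda>n. a n powr (1 / real n)) \<longlonglongrightarrow> exp L"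
    unfolding root by (intro tendsto_exp L)
  have "(\<lambda>n. exp (ln c * (1 / real n) + ln r)) \<longlonglongrightarrow> exp (ln c * 0 + ln r)"
    by (intro tendsto_intros lim_1_over_n)
  then have "(\<lambda>n. exp (ln c * (1 / real n) + ln r)) \<longlonglongrightarrow> r" using r by simp
  then have "r \<le> exp L"
  proof (rule LIMSEQ_le[OF _ lim], intro exI allI impI)
    fix n :: nat assume n: "1 \<le> n"
    have "ln (c * r ^ n) \<le> b n" unfolding b_def using lower[of n] c r pos by simp
    then have "ln c + real n * ln r \<le> b n" using c r by (simp add: ln_mult_pos ln_realpow)
    then have "(ln c + real n * ln r) / real n \<le> b n / real n" using n by (intro divide_right_mono) auto
    then have "ln c * (1 / real n) + ln r \<le> b n / real n" using n by (simp add: add_divide_distrib)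
    then show "exp (ln c * (1 / real n) + ln r) \<le> a n powr (1 / real n)" unfolding root by simp
  qed
  then show ?thesis using limI[OF lim] by simp
qed

section \<open>The operator norm induced by the L1 norm\<close>

definition col_sum :: "real mat \<Rightarrow> nat \<Rightarrow> real" where
  "col_sum B j = (\<Sum>i<dim_row B. \<bar>B $$ (i, j)\<bar>)"

lemma col_sum_nonneg: "0 \<le> col_sum B j"
  by (simp add: col_sum_def sum_nonneg)

text \<open>A matrix maps a vector of norm 1 to a combination of its columns whose absolute weights
  add up to 1, and unit vectors attain the largest column sum. This also gives the boundedness that
  a supremum of reals requires.\<close>

lemma l1_norm_mat_eq:
  assumes B: "B \<in> carrier_mat d d" and d: "1 \<le> d"
  shows "l1_norm_mat B = Max (col_sum B ` {..<d})"
proof -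
  let ?V = "{v \<in> carrier_vec (dim_col B). l1_norm_vec v = 1}" and ?M = "Max (col_sum B ` {..<d})"
  have dim: "dim_row B = d" "dim_col B = d" using B by auto
  have upper: "l1_norm_vec (B *\<^sub>v v) \<le> ?M" if "v \<in> ?V" for v
  proof -
    have v: "dim_vec v = d" "(\<Sum>j<d. \<bar>vec_index v j\<bar>) = 1" using that dim by (auto simp: l1_norm_vec_def)
    have "l1_norm_vec (B *\<^sub>v v) = (\<Sum>i<d. \<bar>\<Sum>j<d. B $$ (i, j) * vec_index v j\<bar>)"
      using dim v by (simp add: l1_norm_vec_def scalar_prod_def lessThan_atLeast0)
    also have "\<dots> \<le> (\<Sum>i<d. \<Sum>j<d. \<bar>B $$ (i, j)\<bar> * \<bar>vec_index v j\<bar>)"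
      by (intro sum_mono order_trans[OF sum_abs]) (simp add: abs_mult)
    also have "\<dots> = (\<Sum>j<d. col_sum B j * \<bar>vec_index v j\<bar>)"
      unfolding col_sum_def dim sum_distrib_right by (rule sum.swap)
    also have "\<dots> \<le> (\<Sum>j<d. ?M * \<bar>vec_index v j\<bar>)"
      by (intro sum_mono mult_right_mono Max_ge) auto
    also have "\<dots> = ?M" using v by (simp add: sum_distrib_left[symmetric])
    finally show ?thesis .
  qed
  have unit: "unit_vec d j \<in> ?V" "l1_norm_vec (B *\<^sub>v unit_vec d j) = col_sum B j" if j: "j < d" for j
  proof -
    have "(\<Sum>i<d. \<bar>vec_index (unit_vec d j) i\<bar>) = (\<Sum>i<d. if i = j then 1 else 0 :: real)"
      by (rule sum.cong) (use j in auto)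
    then show "unit_vec d j \<in> ?V" using j dim by (simp add: l1_norm_vec_def)
    have "vec_index (B *\<^sub>v unit_vec d j) i = B $$ (i, j)" if "i < d" for i
      using dim j that scalar_prod_right_unit[of j d "row B i"] by simp
    then show "l1_norm_vec (B *\<^sub>v unit_vec d j) = col_sum B j"
      using dim by (simp add: l1_norm_vec_def col_sum_def)
  qed
  show ?thesis
    unfolding l1_norm_mat_def
  proof (rule antisym)
    show "(SUP v\<in>?V. l1_norm_vec (B *\<^sub>v v)) \<le> ?M"
      using unit(1)[of 0] d upper by (intro cSUP_least) auto
    have bb: "bdd_above ((\<lambda>v. l1_norm_vec (B *\<^sub>v v)) ` ?V)"
      using upper by (intro bdd_aboveI[of _ ?M]) auto
    have "col_sum B j \<le> (SUP v\<in>?V. l1_norm_vec (B *\<^sub>v v))" if "j < d" for j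
      using cSUP_upper[OF unit(1)[OF that] bb] unit(2)[OF that] by simp
    then show "?M \<le> (SUP v\<in>?V. l1_norm_vec (B *\<^sub>v v))"
      using d by (intro Max.boundedI) (auto simp: lessThan_empty_iff)
  qed
qed

lemma col_sum_le_l1_norm_mat:
  assumes "B \<in> carrier_mat d d" "j < d"
  shows "col_sum B j \<le> l1_norm_mat B"
  using assms l1_norm_mat_eq[OF assms(1)] by (auto intro!: Max_ge)

lemma l1_norm_mat_leI:
  assumes "B \<in> carrier_mat d d" "1 \<le> d" "\<And>j. j < d \<Longrightarrow> col_sum B j \<le> c"
  shows "l1_norm_mat B \<le> c"
  using assms by (simp add: l1_norm_mat_eq lessThan_empty_iff)

lemma l1_norm_mat_nonneg:
  assumes "B \<in> carrier_mat d d" "1 \<le> d"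
  shows "0 \<le> l1_norm_mat B"
  using order_trans[OF col_sum_nonneg col_sum_le_l1_norm_mat[OF assms(1), of 0]] assms(2) by simp

lemma index_mult_mat_sum:
  assumes "B \<in> carrier_mat d d" "C \<in> carrier_mat d d" "i < d" "j < d"
  shows "(B * C) $$ (i, j) = (\<Sum>k<d. B $$ (i, k) * C $$ (k, j))"
  using assms by (simp add: scalar_prod_def lessThan_atLeast0)

lemma l1_norm_mat_mult_le:
  assumes B: "B \<in> carrier_mat d d" and C: "C \<in> carrier_mat d d" and d: "1 \<le> d"
  shows "l1_norm_mat (B * C) \<le> l1_norm_mat B * l1_norm_mat C"
proof (rule l1_norm_mat_leI[OF _ d])
  show "B * C \<in> carrier_mat d d" using B C by simp
  fix j assume j: "j < d"
  have dim: "dim_row B = d" "dim_row C = d" using B C by auto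
  have "col_sum (B * C) j = (\<Sum>i<d. \<bar>\<Sum>k<d. B $$ (i, k) * C $$ (k, j)\<bar>)"
    unfolding col_sum_def using B j by (intro sum.cong) (auto simp: index_mult_mat_sum[OF B C] simp del: index_mult_mat(1))
  also have "\<dots> \<le> (\<Sum>i<d. \<Sum>k<d. \<bar>B $$ (i, k)\<bar> * \<bar>C $$ (k, j)\<bar>)"
    by (intro sum_mono order_trans[OF sum_abs]) (simp add: abs_mult)
  also have "\<dots> = (\<Sum>k<d. col_sum B k * \<bar>C $$ (k, j)\<bar>)"
    unfolding col_sum_def dim sum_distrib_right by (rule sum.swap)
  also have "\<dots> \<le> (\<Sum>k<d. l1_norm_mat B * \<bar>C $$ (k, j)\<bar>)"
    by (intro sum_mono mult_right_mono col_sum_le_l1_norm_mat[OF B]) auto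
  also have "\<dots> = l1_norm_mat B * col_sum C j" by (simp add: col_sum_def dim sum_distrib_left)
  also have "\<dots> \<le> l1_norm_mat B * l1_norm_mat C"
    by (intro mult_left_mono col_sum_le_l1_norm_mat[OF C j] l1_norm_mat_nonneg[OF B d])
  finally show "col_sum (B * C) j \<le> l1_norm_mat B * l1_norm_mat C" .
qed

lemma left_prod_carrier:
  assumes "\<And>i. i < n \<Longrightarrow> B i \<in> carrier_mat d d"
  shows "left_prod d B n \<in> carrier_mat d d"
  using assms
proof (induction n)
  case (Suc n)
  then have "B n \<in> carrier_mat d d" "left_prod d B n \<in> carrier_mat d d" by auto
  then show ?case by simp
qed simp

lemma left_prod_cong:
  assumes "\<And>i. i < n \<Longrightarrow> B i = C i"
  shows "left_prod d B n = left_prod d C n"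
  using assms by (induction n) auto

lemma left_prod_add:
  assumes B: "\<And>i. B i \<in> carrier_mat d d"
  shows "left_prod d B (m + n) = left_prod d (\<lambda>i. B (m + i)) n * left_prod d B m"
proof (induction n)
  case 0
  then show ?case using left_prod_carrier[of m B d] B by simp
next
  case (Suc n)
  have "left_prod d B (m + Suc n) = B (m + n) * (left_prod d (\<lambda>i. B (m + i)) n * left_prod d B m)"
    using Suc by simp
  also have "\<dots> = B (m + n) * left_prod d (\<lambda>i. B (m + i)) n * left_prod d B m"
    by (rule assoc_mult_mat[symmetric]) (auto intro: B left_prod_carrier)
  finally show ?case by simp
qed

lemma l1_norm_mat_left_prod_le:
  assumes B: "\<And>i. i < n \<Longrightarrow> B i \<in> carrier_mat d d" and d: "1 \<le> d"
    and K: "\<And>i. i < n \<Longrightarrow> l1_norm_mat (B i) \<le> K" "0 \<le> K"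
  shows "l1_norm_mat (left_prod d B n) \<le> K ^ n"
  using B K(1)
proof (induction n)
  case 0
  have "col_sum (1\<^sub>m d) j = 1" if "j < d" for j
  proof -
    have "col_sum (1\<^sub>m d) j = (\<Sum>i<d. if i = j then 1 else 0)"
      unfolding col_sum_def using that by (intro sum.cong) auto
    then show ?thesis using that by simp
  qed
  then show ?case using d by (auto intro!: l1_norm_mat_leI[of _ d])
next
  case (Suc n)
  have "l1_norm_mat (B n * left_prod d B n) \<le> l1_norm_mat (B n) * l1_norm_mat (left_prod d B n)"
    using Suc.prems by (intro l1_norm_mat_mult_le[OF _ _ d] left_prod_carrier) auto
  also have "\<dots> \<le> K * K ^ n"
    using Suc K(2) by (intro mult_mono l1_norm_mat_nonneg[OF _ d] left_prod_carrier) auto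
  finally show ?case by simp
qed

section \<open>Row vectors and cycle matrices\<close>

abbreviation row_mul :: "nat \<Rightarrow> real mat \<Rightarrow> (nat \<Rightarrow> real) \<Rightarrow> nat \<Rightarrow> real" where
  "row_mul d A \<equiv> row_op d (\<lambda>k i. A $$ (k, i))"

lemma station_matrix_carrier: "station_matrix d lam n r \<in> carrier_mat d d"
  by (simp add: station_matrix_def case_prod_beta')

lemma station_matrix_index:
  assumes "i < d" "j < d"
  shows "station_matrix d lam n r $$ (i, j)
    = (if j = 0 then station_coeff d lam n r i else if j = i + 1 then 1 else 0)"
  using assms by (simp add: station_matrix_def station_coeff_def case_prod_beta')

lemma cycle_matrix_carrier: "cycle_matrix d lam q \<in> carrier_mat d d"
  unfolding cycle_matrix_def by (intro left_prod_carrier station_matrix_carrier)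

lemma row_mul_station_matrix:
  assumes "j < d"
  shows "row_mul d (station_matrix d lam n r) w j = station_row d lam n r w j"
proof (cases j)
  case 0
  then show ?thesis using assms by (simp add: row_op_def station_row_def station_matrix_index)
next
  case (Suc k)
  have "row_mul d (station_matrix d lam n r) w j = (\<Sum>i<d. if i = k then w i else 0)"
    unfolding row_op_def using assms Suc by (intro sum.cong) (auto simp: station_matrix_index)
  then show ?thesis using assms Suc by (simp add: station_row_def)
qed

lemma row_mul_mult:
  assumes "B \<in> carrier_mat d d" "C \<in> carrier_mat d d" "j < d"
  shows "row_mul d (B * C) w j = row_mul d C (row_mul d B w) j"
proof -
  have "row_mul d (B * C) w j = (\<Sum>i<d. \<Sum>k<d. w i * B $$ (i, k) * C $$ (k, j))"
    unfolding row_op_def using assms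
    by (intro sum.cong) (auto simp: index_mult_mat_sum[OF assms(1,2)] sum_distrib_left mult_ac simp del: index_mult_mat(1))
  also have "\<dots> = row_mul d C (row_mul d B w) j"
    unfolding row_op_def sum_distrib_right by (rule sum.swap)
  finally show ?thesis .
qed

text \<open>The quantity \<open>visit_row n\<close> times the product of the matrices of stations
  below \<open>n\<close> does not depend on \<open>n\<close>: the product grows at its left end,
  exactly where \<open>visit_row_rec\<close> absorbs a factor.\<close>

lemma row_mul_cycle_matrix:
  assumes "j < d"
  shows "row_mul d (cycle_matrix d lam q) w j = visit_row d lam q w 0 j"
proof -
  let ?st = "\<lambda>n. station_matrix d lam n (q n)"
  have "row_mul d (left_prod d ?st n) (visit_row d lam q w n) j = visit_row d lam q w 0 j"
    if "n \<le> d + 1" "j < d" for n j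
    using that
  proof (induction n arbitrary: j)
    case 0
    have "row_mul d (1\<^sub>m d) v j = (\<Sum>k<d. if k = j then v k else 0)" for v
      unfolding row_op_def using 0 by (intro sum.cong) auto
    then show ?case using 0 by simp
  next
    case (Suc n)
    have "row_mul d (left_prod d ?st (Suc n)) (visit_row d lam q w (Suc n)) j
      = row_mul d (left_prod d ?st n) (row_mul d (?st n) (visit_row d lam q w (Suc n))) j"
      using Suc.prems by (simp add: row_mul_mult station_matrix_carrier left_prod_carrier)
    also have "\<dots> = row_mul d (left_prod d ?st n) (visit_row d lam q w n) j"
      using Suc.prems by (intro row_op_cong) (simp add: row_mul_station_matrix visit_row_rec)
    finally show ?case using Suc by simp
  qed
  from this[of "d + 1" j] assms show ?thesis
    by (simp add: cycle_matrix_def visit_row_end)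
qed

lemma visit_row_nonneg:
  assumes c: "\<And>n k. n \<le> d \<Longrightarrow> k < d \<Longrightarrow> 0 \<le> station_coeff d lam n (q n) k"
    and w: "\<And>i. i < d \<Longrightarrow> 0 \<le> w i" and "n \<le> Suc d" "i < d"
  shows "0 \<le> visit_row d lam q w n i"
  using assms(3,4)
proof (induction "Suc d - n" arbitrary: n i)
  case 0
  then have "n = Suc d" by simp
  then show ?case using 0 by (simp add: visit_row_end w)
next
  case (Suc j)
  then have n: "n \<le> d" by simp
  have IH: "0 \<le> visit_row d lam q w (Suc n) i" if "i < d" for i
    using Suc n that by auto
  show ?case
    unfolding visit_row_rec[OF n] station_row_def
    using IH Suc.prems c[OF n] by (auto intro!: sum_nonneg mult_nonneg_nonneg)
qed

text \<open>Every visit makes one more coordinate positive.\<close>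

lemma visit_row_strictly_pos:
  assumes c: "\<And>n k. n \<le> d \<Longrightarrow> k < d \<Longrightarrow> 0 < station_coeff d lam n (q n) k" and d: "1 \<le> d"
    and w: "\<And>i. i < d \<Longrightarrow> 0 \<le> w i" "\<exists>i<d. w i \<noteq> 0" and "n \<le> Suc d"
  shows "(\<exists>i<d. visit_row d lam q w n i \<noteq> 0) \<and> (\<forall>i<d. i < Suc d - n \<longrightarrow> 0 < visit_row d lam q w n i)"
  using assms(5)
proof (induction "Suc d - n" arbitrary: n)
  case 0
  then have "n = Suc d" by simp
  then show ?case using w by (simp add: visit_row_end)
next
  case (Suc j)
  then have n: "n \<le> d" by simp
  let ?u = "visit_row d lam q w (Suc n)"
  have nn: "0 \<le> ?u i" if "i < d" for i
    using n that by (intro visit_row_nonneg less_imp_le[OF c] w) auto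
  have IH: "\<exists>i<d. ?u i \<noteq> 0" "\<And>i. i < d \<Longrightarrow> i < d - n \<Longrightarrow> 0 < ?u i"
    using Suc n by auto
  obtain k where k: "k < d" "0 < ?u k" using IH(1) nn by (metis less_le)
  have 0: "0 < visit_row d lam q w n 0"
    unfolding visit_row_rec[OF n] station_row_def
    using k c[OF n] nn by (auto intro!: sum_pos2[where i=k] mult_nonneg_nonneg less_imp_le[OF c[OF n]])
  have "0 < visit_row d lam q w n i" if "i < d" "i < Suc d - n" for i
  proof (cases i)
    case (Suc l)
    then show ?thesis using IH(2)[of l] that n by (simp add: visit_row_rec[OF n] station_row_def)
  qed (use 0 in simp)
  then show ?case using 0 d by (auto intro!: exI[of _ 0])
qed

text \<open>Row \<open>k\<close> is the image of the \<open>k\<close>-th unit row vector, and the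
  \<open>d + 1\<close> visits of a cycle suffice to make all \<open>d\<close> coordinates
  positive.\<close>

lemma cycle_matrix_pos:
  assumes c: "\<And>n k. n \<le> d \<Longrightarrow> k < d \<Longrightarrow> 0 < station_coeff d lam n (q n) k" and d: "1 \<le> d"
    and "k < d" "i < d"
  shows "0 < cycle_matrix d lam q $$ (k, i)"
proof -
  let ?e = "\<lambda>l. if l = k then 1 else 0 :: real"
  have "cycle_matrix d lam q $$ (k, i) = row_mul d (cycle_matrix d lam q) ?e i"
    unfolding row_op_def using assms(3) by (simp add: if_distrib[of "\<lambda>x. x * _"] cong: if_cong)
  also have "\<dots> = visit_row d lam q ?e 0 i" by (rule row_mul_cycle_matrix[OF assms(4)])
  also have "0 < \<dots>"
    using visit_row_strictly_pos[where q=q and w="?e" and n=0, OF c d] assms(3,4) by auto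
  finally show ?thesis .
qed

lemma cycle_matrix_nonneg:
  assumes c: "\<And>n k. n \<le> d \<Longrightarrow> k < d \<Longrightarrow> 0 \<le> station_coeff d lam n (q n) k" and "k < d" "i < d"
  shows "0 \<le> cycle_matrix d lam q $$ (k, i)"
proof -
  let ?e = "\<lambda>l. if l = k then 1 else 0 :: real"
  have "cycle_matrix d lam q $$ (k, i) = row_mul d (cycle_matrix d lam q) ?e i"
    unfolding row_op_def using assms(2) by (simp add: if_distrib[of "\<lambda>x. x * _"] cong: if_cong)
  also have "\<dots> = visit_row d lam q ?e 0 i" by (rule row_mul_cycle_matrix[OF assms(3)])
  also have "0 \<le> \<dots>"
    using assms(3) by (intro visit_row_nonneg c) auto
  finally show ?thesis .
qed

text \<open>Every visit costs at most one factor \<open>\<theta>\<close>: coordinate 0 loses it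
  through the coefficients, and the shifted coordinates can afford it because
  \<open>\<theta> \<le> 1\<close>.\<close>

lemma visit_row_perturb:
  assumes c: "\<And>n k. n \<le> d \<Longrightarrow> k < d \<Longrightarrow> 0 \<le> station_coeff d lam n (q n) k"
    and c': "\<And>n k. n \<le> d \<Longrightarrow> k < d \<Longrightarrow> \<theta> * station_coeff d lam n (q n) k \<le> station_coeff d lam n (q' n) k"
    and \<theta>: "0 \<le> \<theta>" "\<theta> \<le> 1" and w: "\<And>i. i < d \<Longrightarrow> 0 \<le> w i" and "n \<le> Suc d" "i < d"
  shows "\<theta> ^ (Suc d - n) * visit_row d lam q w n i \<le> visit_row d lam q' w n i"
  using assms(6,7)
proof (induction "Suc d - n" arbitrary: n i)
  case 0
  then have "n = Suc d" by simp
  then show ?case by (simp add: visit_row_end)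
next
  case (Suc j)
  then have n: "n \<le> d" by simp
  let ?u = "visit_row d lam q w (Suc n)" and ?u' = "visit_row d lam q' w (Suc n)"
  have j: "Suc d - Suc n = j" "Suc d - n = Suc j" using Suc.hyps(2) by auto
  have IH: "\<theta> ^ j * ?u i \<le> ?u' i" if "i < d" for i
    using Suc.hyps(1)[of "Suc n" i] n that j by auto
  have nn: "0 \<le> ?u i" if "i < d" for i
    using n that by (intro visit_row_nonneg c w) auto
  show ?case
  proof (cases i)
    case 0
    have "\<theta> ^ Suc j * (\<Sum>k<d. ?u k * station_coeff d lam n (q n) k)
      = (\<Sum>k<d. (\<theta> ^ j * ?u k) * (\<theta> * station_coeff d lam n (q n) k))"
      by (simp add: sum_distrib_left mult_ac)
    also have "\<dots> \<le> (\<Sum>k<d. ?u' k * station_coeff d lam n (q' n) k)"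
    proof (intro sum_mono mult_mono)
      fix k assume "k \<in> {..<d}"
      then have k: "k < d" by simp
      show "\<theta> ^ j * ?u k \<le> ?u' k" by (rule IH[OF k])
      show "\<theta> * station_coeff d lam n (q n) k \<le> station_coeff d lam n (q' n) k" by (rule c'[OF n k])
      show "0 \<le> ?u' k" using IH[OF k] nn[OF k] \<theta> by (meson order_trans mult_nonneg_nonneg zero_le_power)
      show "0 \<le> \<theta> * station_coeff d lam n (q n) k" using c[OF n k] \<theta> by simp
    qed
    finally show ?thesis using 0 by (simp add: visit_row_rec[OF n] station_row_def j)
  next
    case (Suc l)
    then have l: "l < d" using Suc.prems by simp
    have "\<theta> ^ Suc j * ?u l \<le> \<theta> ^ j * ?u l"
      using \<theta> nn[OF l] by (intro mult_right_mono) (auto simp: mult_left_le_one_le)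
    then show ?thesis using Suc IH[OF l] by (simp add: visit_row_rec[OF n] station_row_def j)
  qed
qed

text \<open>The same test vector \<open>w\<close> serves all factors, so nonnegativity lets the
  growth \<open>r\<close> accumulate although the matrices differ. Coordinate 0 of the resulting row
  is at most the sum of the \<open>w i\<close> times the column sum of column 0, which the norm
  dominates.\<close>

lemma l1_norm_mat_left_prod_ge:
  assumes C: "\<And>i. i < n \<Longrightarrow> C i \<in> carrier_mat d d"
    and nn: "\<And>i k l. i < n \<Longrightarrow> k < d \<Longrightarrow> l < d \<Longrightarrow> 0 \<le> C i $$ (k, l)"
    and grow: "\<And>i j. i < n \<Longrightarrow> j < d \<Longrightarrow> r * w j \<le> row_mul d (C i) w j"
    and w: "\<And>i. i < d \<Longrightarrow> 0 < w i" and d: "1 \<le> d" and r: "0 \<le> r"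
  shows "w 0 / (\<Sum>i<d. w i) * r ^ n \<le> l1_norm_mat (left_prod d C n)"
proof -
  have P: "left_prod d C n \<in> carrier_mat d d" using C by (rule left_prod_carrier)
  have nnP: "0 \<le> left_prod d C m $$ (k, l)" if "m \<le> n" "k < d" "l < d" for m k l
    using that
  proof (induction m arbitrary: k l)
    case (Suc m)
    have "C m \<in> carrier_mat d d" "left_prod d C m \<in> carrier_mat d d"
      using Suc.prems C by (auto intro!: left_prod_carrier)
    from index_mult_mat_sum[OF this Suc.prems(2,3)] show ?case
      using Suc nn by (auto intro!: sum_nonneg mult_nonneg_nonneg simp del: index_mult_mat(1))
  qed auto
  have "r ^ m * w j \<le> row_mul d (left_prod d C m) w j" if "m \<le> n" "j < d" for m j
    using that
  proof (induction m arbitrary: j)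
    case 0
    have "row_mul d (1\<^sub>m d) w j = (\<Sum>k<d. if k = j then w k else 0)"
      unfolding row_op_def using 0 by (intro sum.cong) auto
    then show ?case using 0 by simp
  next
    case (Suc m)
    have cm: "C m \<in> carrier_mat d d" "left_prod d C m \<in> carrier_mat d d"
      using Suc.prems C by (auto intro!: left_prod_carrier)
    have "r ^ Suc m * w j \<le> r * row_mul d (left_prod d C m) w j"
      using mult_left_mono[OF Suc.IH[of j] r] Suc.prems by (simp add: mult_ac)
    also have "\<dots> = row_mul d (left_prod d C m) (\<lambda>k. r * w k) j" by (simp add: row_op_mult)
    also have "\<dots> \<le> row_mul d (left_prod d C m) (row_mul d (C m) w) j"
      unfolding row_op_def[of d "\<lambda>k i. left_prod d C m $$ (k, i)"]
      using Suc.prems nnP[of m] grow[of m] by (intro sum_mono mult_right_mono) auto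
    also have "\<dots> = row_mul d (left_prod d C (Suc m)) w j"
      using Suc.prems by (simp add: row_mul_mult[OF cm])
    finally show ?case .
  qed
  from this[of n 0] d have "r ^ n * w 0 \<le> row_mul d (left_prod d C n) w 0" by simp
  also have "\<dots> \<le> (\<Sum>k<d. (\<Sum>i<d. w i) * \<bar>left_prod d C n $$ (k, 0)\<bar>)"
    unfolding row_op_def
  proof (intro sum_mono mult_mono)
    fix k assume k: "k \<in> {..<d}"
    then show "w k \<le> (\<Sum>i<d. w i)" using w by (intro member_le_sum) (auto intro: less_imp_le)
    show "0 \<le> (\<Sum>i<d. w i)" using w by (intro sum_nonneg) (auto intro: less_imp_le)
    show "0 \<le> left_prod d C n $$ (k, 0)" using nnP[of n k 0] k d by simp
  qed simp
  also have "\<dots> = (\<Sum>i<d. w i) * col_sum (left_prod d C n) 0"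
    using P by (simp add: col_sum_def sum_distrib_left)
  also have "\<dots> \<le> (\<Sum>i<d. w i) * l1_norm_mat (left_prod d C n)"
    using w d by (intro mult_left_mono col_sum_le_l1_norm_mat[OF P] sum_nonneg) (auto intro: less_imp_le)
  finally have "r ^ n * w 0 \<le> (\<Sum>i<d. w i) * l1_norm_mat (left_prod d C n)" .
  moreover have "0 < (\<Sum>i<d. w i)" using w d by (intro sum_pos) (auto simp: lessThan_empty_iff)
  ultimately show ?thesis by (simp add: field_simps)
qed

lemma supersolution_or_growth:
  assumes c: "\<And>n k. n \<le> d \<Longrightarrow> k < d \<Longrightarrow> 0 < station_coeff d lam n (q n) k" and d: "1 \<le> d"
  shows "(\<exists>w. \<forall>i<d. 0 < w i \<and> visit_row d lam q w 0 i \<le> w i) \<or>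
    (\<exists>w \<rho>. 1 < \<rho> \<and> (\<forall>i<d. 0 < w i \<and> visit_row d lam q w 0 i = \<rho> * w i))"
proof -
  obtain w \<rho> where w: "\<And>i. i < d \<Longrightarrow> 0 < w i" "0 < \<rho>" "\<And>i. i < d \<Longrightarrow> row_mul d (cycle_matrix d lam q) w i = \<rho> * w i"
    using positive_matrix_left_eigenvector[OF d, of "\<lambda>k i. cycle_matrix d lam q $$ (k, i)"] cycle_matrix_pos[where q=q, OF c d]
    by metis
  then have eig: "visit_row d lam q w 0 i = \<rho> * w i" if "i < d" for i
    using that by (simp add: row_mul_cycle_matrix)
  show ?thesis
  proof (cases "\<rho> \<le> 1")
    case True
    then have "visit_row d lam q w 0 i \<le> w i" if "i < d" for i
      using w(1)[OF that] by (simp add: eig[OF that])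
    then show ?thesis using w(1) by blast
  next
    case False
    then have "1 < \<rho>" by simp
    then show ?thesis using w(1) eig by blast
  qed
qed

section \<open>Moments of random matrix products\<close>

lemma borel_measurable_station_coeff[measurable]:
  "(\<lambda>r. station_coeff d lam n r k) \<in> borel_measurable borel"
proof -
  have "continuous_on UNIV (\<lambda>r :: regime. snd r (k + 1))"
    by (rule continuous_on_compose2[OF continuous_on_product_coordinates]) (auto intro: continuous_intros)
  then have "(\<lambda>r :: regime. snd r (k + 1)) \<in> borel_measurable borel"
    by (rule borel_measurable_continuous_onI)
  moreover have "(\<lambda>r :: regime. fst r) \<in> borel_measurable borel"
    by (intro borel_measurable_continuous_onI continuous_intros)
  ultimately show ?thesis unfolding station_coeff_def by measurable
qed

lemma borel_measurable_left_prod: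
  assumes C: "\<And>i \<omega>. B i \<omega> \<in> carrier_mat d d"
    and B: "\<And>i k l. i < n \<Longrightarrow> k < d \<Longrightarrow> l < d \<Longrightarrow> (\<lambda>\<omega>. B i \<omega> $$ (k, l)) \<in> borel_measurable M"
    and "k < d" "l < d"
  shows "(\<lambda>\<omega>. left_prod d (\<lambda>i. B i \<omega>) n $$ (k, l)) \<in> borel_measurable M"
  using B assms(3,4)
proof (induction n arbitrary: k l)
  case (Suc n)
  have "left_prod d (\<lambda>i. B i \<omega>) (Suc n) $$ (k, l)
    = (\<Sum>j<d. B n \<omega> $$ (k, j) * left_prod d (\<lambda>i. B i \<omega>) n $$ (j, l))" for \<omega>
    using index_mult_mat_sum[OF C left_prod_carrier[OF C] Suc.prems(2,3)] by simp
  then show ?case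
    using Suc by (auto intro!: borel_measurable_sum borel_measurable_times)
qed simp

lemma borel_measurable_l1_norm_mat:
  assumes C: "\<And>\<omega>. F \<omega> \<in> carrier_mat d d" and d: "1 \<le> d"
    and F: "\<And>k l. k < d \<Longrightarrow> l < d \<Longrightarrow> (\<lambda>\<omega>. F \<omega> $$ (k, l)) \<in> borel_measurable M"
  shows "(\<lambda>\<omega>. l1_norm_mat (F \<omega>)) \<in> borel_measurable M"
proof -
  have dim: "dim_row (F \<omega>) = d" for \<omega> using C[of \<omega>] by auto
  have "(\<lambda>\<omega>. Max ((\<lambda>j. col_sum (F \<omega>) j) ` {..<d})) \<in> borel_measurable M"
    unfolding col_sum_def dim using F by (intro borel_measurable_Max borel_measurable_sum borel_measurable_abs) auto
  then show ?thesis by (simp add: l1_norm_mat_eq[OF C d])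
qed

context
  fixes d :: nat and lam :: "nat \<Rightarrow> real" and \<nu> :: "nat \<Rightarrow> regime measure"
  assumes d: "1 \<le> d" and law: "\<And>n. n \<le> d \<Longrightarrow> regime_law d (\<nu> n)"
begin

private abbreviation (input) "cyc \<equiv> cycle_matrix d lam"
private abbreviation (input) "S \<equiv> \<Pi>\<^sub>M i\<in>(UNIV::nat set). cycle_space d \<nu>"
private abbreviation (input) "N n \<omega> \<equiv> l1_norm_mat (left_prod d (\<lambda>i. cyc (\<omega> i)) n)"

lemma prob_space_cycle_space: "prob_space (cycle_space d \<nu>)"
  unfolding cycle_space_def using law by (intro prob_space_PiM) (auto simp: regime_law_def)

lemma borel_measurable_cycle_matrix:
  assumes "k < d" "l < d"
  shows "(\<lambda>\<omega>. cyc \<omega> $$ (k, l)) \<in> borel_measurable (cycle_space d \<nu>)"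
  unfolding cycle_matrix_def
proof (rule borel_measurable_left_prod[OF station_matrix_carrier _ assms])
  fix n k l assume n: "n < d + 1" and kl: "k < d" "l < d"
  have "(\<lambda>\<omega>. \<omega> n) \<in> cycle_space d \<nu> \<rightarrow>\<^sub>M \<nu> n"
    unfolding cycle_space_def using n by (intro measurable_component_singleton) auto
  moreover have "sets (\<nu> n) = sets borel" using law[of n] n by (simp add: regime_law_def)
  ultimately have [measurable]: "(\<lambda>\<omega>. \<omega> n) \<in> borel_measurable (cycle_space d \<nu>)"
    using measurable_cong_sets by blast
  show "(\<lambda>\<omega>. station_matrix d lam n (\<omega> n) $$ (k, l)) \<in> borel_measurable (cycle_space d \<nu>)"
    unfolding station_matrix_index[OF kl] by measurable
qed

lemma borel_measurable_norm_prod: "N n \<in> borel_measurable S"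
proof (rule borel_measurable_l1_norm_mat[OF left_prod_carrier[OF cycle_matrix_carrier] d])
  fix k l assume kl: "k < d" "l < d"
  have "(\<lambda>\<omega>. cyc (\<omega> i) $$ (k, l)) \<in> borel_measurable S" if "k < d" "l < d" for i k l
    by (rule measurable_compose[OF _ borel_measurable_cycle_matrix[OF that]], rule measurable_component_singleton) simp
  then show "(\<lambda>\<omega>. left_prod d (\<lambda>i. cyc (\<omega> i)) n $$ (k, l)) \<in> borel_measurable S"
    using kl by (intro borel_measurable_left_prod[OF cycle_matrix_carrier]) auto
qed

lemma norm_prod_nonneg: "0 \<le> N n \<omega>"
  by (rule l1_norm_mat_nonneg[OF left_prod_carrier[OF cycle_matrix_carrier] d])

lemma norm_prod_add_le:
  "N (m + n) \<omega> \<le> N n (\<lambda>i. \<omega> (m + i)) * N m \<omega>"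
  unfolding left_prod_add[OF cycle_matrix_carrier]
  by (rule l1_norm_mat_mult_le[OF left_prod_carrier[OF cycle_matrix_carrier] left_prod_carrier[OF cycle_matrix_carrier] d])

text \<open>Both halves of \<open>condition_E\<close> are needed: the margin keeps the denominators
  of the coefficients away from 0, and the upper bound on the service rates controls the
  numerators.\<close>

lemma AE_l1_norm_cycle_matrix_le:
  assumes "condition_E d lam \<nu>"
  obtains K where "0 \<le> K" "AE \<omega> in cycle_space d \<nu>. l1_norm_mat (cyc \<omega>) \<le> K"
proof -
  obtain \<epsilon> M where \<epsilon>: "0 < \<epsilon>" "\<And>n. n \<le> d \<Longrightarrow> AE r in \<nu> n. fst r > lam n + \<epsilon>"
    and M: "\<And>n. n \<le> d \<Longrightarrow> AE r in \<nu> n. fst r \<le> M"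
    using assms by (auto simp: condition_E_def)
  define L where "L = (\<Sum>n\<le>d. \<bar>lam n\<bar>)"
  define c where "c = (L + \<bar>M\<bar>) / \<epsilon>"
  have L: "\<bar>lam n\<bar> \<le> L" if "n \<le> d" for n
    unfolding L_def using that by (intro member_le_sum) auto
  have c0: "0 \<le> c" using L[of 0] \<epsilon>(1) by (simp add: c_def)
  have coeff: "AE r in \<nu> n. \<forall>k<d. \<bar>station_coeff d lam n r k\<bar> \<le> c" if n: "n \<le> d" for n
  proof -
    have "AE r in \<nu> n. r \<in> regimes d" using law[OF n] by (simp add: regime_law_def)
    with \<epsilon>(2)[OF n] M[OF n] show ?thesis
    proof eventually_elim
      case (elim r)
      show ?case
      proof (intro allI impI)
        fix k assume k: "k < d"
        obtain \<mu> \<gamma> where r: "r = (\<mu>, \<gamma>)" by (cases r)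
        have \<gamma>: "0 < \<mu>" "\<forall>i\<in>{1..d}. 0 \<le> \<gamma> i" "(\<Sum>j=1..d. \<gamma> j) \<le> 1" using elim(3) by (auto simp: r regimes_def)
        have "\<gamma> (k + 1) \<le> (\<Sum>j=1..d. \<gamma> j)" using k \<gamma> by (intro member_le_sum) auto
        with \<gamma> k have \<gamma>1: "0 \<le> \<gamma> (k + 1)" "\<gamma> (k + 1) \<le> 1" by auto
        have \<mu>: "\<mu> \<le> \<bar>M\<bar>" using elim(2) by (simp add: r)
        have "\<bar>lam ((n + k + 1) mod (d + 1)) + \<gamma> (k + 1) * \<mu>\<bar> \<le> L + 1 * \<bar>M\<bar>"
        proof (rule order_trans[OF abs_triangle_ineq], rule add_mono)
          show "\<bar>lam ((n + k + 1) mod (d + 1))\<bar> \<le> L" by (rule L) (simp add: less_Suc_eq_le[symmetric])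
          show "\<bar>\<gamma> (k + 1) * \<mu>\<bar> \<le> 1 * \<bar>M\<bar>"
            unfolding abs_mult using \<gamma>1 \<gamma>(1) \<mu> by (intro mult_mono) auto
        qed
        moreover have "\<epsilon> \<le> \<mu> - lam n" using elim(1) by (simp add: r)
        ultimately show "\<bar>station_coeff d lam n r k\<bar> \<le> c"
          unfolding station_coeff_def c_def r fst_conv snd_conv abs_divide using \<epsilon>(1)
          by (intro frac_le) auto
      qed
    qed
  qed
  \<comment> \<open>The added 1 covers the unit entries above the diagonal.\<close>
  define K where "K = real d * (c + 1)"
  have "AE \<omega> in cycle_space d \<nu>. \<forall>n\<in>{0..d}. \<forall>k<d. \<bar>station_coeff d lam n (\<omega> n) k\<bar> \<le> c"
    unfolding cycle_space_def using coeff law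
    by (intro AE_finite_allI AE_PiM_component) (auto simp: regime_law_def)
  then have "AE \<omega> in cycle_space d \<nu>. l1_norm_mat (cyc \<omega>) \<le> K ^ (d + 1)"
  proof eventually_elim
    case (elim \<omega>)
    show ?case
      unfolding cycle_matrix_def
    proof (rule l1_norm_mat_left_prod_le[OF station_matrix_carrier d])
      fix n assume n: "n < d + 1"
      have "col_sum (station_matrix d lam n (\<omega> n)) j \<le> (\<Sum>i<d. c + 1)" if j: "j < d" for j
      proof -
        have "col_sum (station_matrix d lam n (\<omega> n)) j = (\<Sum>i<d. \<bar>station_matrix d lam n (\<omega> n) $$ (i, j)\<bar>)"
          using station_matrix_carrier[of d lam n "\<omega> n"] by (simp add: col_sum_def)
        also have "\<dots> \<le> (\<Sum>i<d. c + 1)"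
        proof (rule sum_mono)
          fix i assume i: "i \<in> {..<d}"
          have "\<bar>station_coeff d lam n (\<omega> n) i\<bar> \<le> c" using elim n i by auto
          then show "\<bar>station_matrix d lam n (\<omega> n) $$ (i, j)\<bar> \<le> c + 1"
            using i j c0 by (auto simp: station_matrix_index)
        qed
        finally show ?thesis .
      qed
      then show "l1_norm_mat (station_matrix d lam n (\<omega> n)) \<le> K"
        by (intro l1_norm_mat_leI[OF station_matrix_carrier d]) (simp add: K_def)
    qed (simp add: K_def c0)
  qed
  then show ?thesis using c0 by (intro that[of "K ^ (d + 1)"]) (auto simp: K_def)
qed

private abbreviation (input) "moment s n \<equiv> (LINT \<omega>|S. N n \<omega> powr s)"

text \<open>The Bochner integral of a non-integrable function is 0 by convention, so lower bounds on
  moments depend on this.\<close>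

lemma integrable_norm_prod:
  assumes E: "condition_E d lam \<nu>" and s: "0 \<le> s"
  shows "integrable S (\<lambda>\<omega>. N n \<omega> powr s)"
proof -
  interpret C: prob_space "cycle_space d \<nu>" by (rule prob_space_cycle_space)
  interpret S: prob_space S by (intro prob_space_PiM prob_space_cycle_space)
  obtain K where K: "0 \<le> K" "AE \<omega> in cycle_space d \<nu>. l1_norm_mat (cyc \<omega>) \<le> K"
    using AE_l1_norm_cycle_matrix_le[OF E] by blast
  have "AE \<omega> in S. l1_norm_mat (cyc (\<omega> i)) \<le> K" for i
    using K(2) by (intro AE_PiM_component) (auto intro: prob_space_cycle_space)
  then have "AE \<omega> in S. \<forall>i. l1_norm_mat (cyc (\<omega> i)) \<le> K" by (simp add: AE_all_countable)
  then have "AE \<omega> in S. norm (N n \<omega> powr s) \<le> (K ^ n) powr s"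
  proof eventually_elim
    case (elim \<omega>)
    have "N n \<omega> \<le> K ^ n"
      using elim K(1) by (intro l1_norm_mat_left_prod_le cycle_matrix_carrier d) auto
    then show ?case using norm_prod_nonneg[where n=n and \<omega>=\<omega>] s by (simp add: powr_mono2)
  qed
  then show ?thesis
  proof (rule S.integrable_const_bound)
    note [measurable] = borel_measurable_norm_prod
    show "(\<lambda>\<omega>. N n \<omega> powr s) \<in> borel_measurable S" by measurable
  qed
qed

text \<open>The first \<open>m\<close> cycles and the following \<open>n\<close> occupy disjoint
  blocks of an i.i.d. sequence. Gluing two independent sequences with \<open>comb_seq\<close>
  preserves the law, which turns this independence into a product of integrals.\<close>

lemma moment_add_le:
  assumes E: "condition_E d lam \<nu>" and s: "0 \<le> s"
  shows "moment s (m + n) \<le> moment s m * moment s n"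
proof -
  interpret C: prob_space "cycle_space d \<nu>" by (rule prob_space_cycle_space)
  interpret S: prob_space S by (intro prob_space_PiM prob_space_cycle_space)
  interpret seq: sequence_space "cycle_space d \<nu>" ..
  interpret SS: pair_prob_space S S ..
  note [measurable] = borel_measurable_norm_prod
  have int: "integrable S (\<lambda>\<omega>. N n \<omega> powr s)" for n by (rule integrable_norm_prod[OF E s])
  have nn: "(\<integral>\<^sup>+\<omega>. ennreal (N n \<omega> powr s) \<partial>S) = ennreal (moment s n)" for n
    by (intro nn_integral_eq_integral int) simp
  have "ennreal (moment s (m + n)) = (\<integral>\<^sup>+\<omega>. ennreal (N (m + n) \<omega> powr s) \<partial>distr (S \<Otimes>\<^sub>M S) S (\<lambda>(\<omega>, \<omega>'). comb_seq m \<omega> \<omega>'))"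
    by (simp only: seq.PiM_comb_seq nn)
  also have "\<dots> = (\<integral>\<^sup>+z. ennreal (N (m + n) (case z of (\<omega>, \<omega>') \<Rightarrow> comb_seq m \<omega> \<omega>') powr s) \<partial>(S \<Otimes>\<^sub>M S))"
    by (intro nn_integral_distr measurable_comb_seq) measurable
  also have "\<dots> \<le> (\<integral>\<^sup>+z. ennreal (N m (fst z) powr s) * ennreal (N n (snd z) powr s) \<partial>(S \<Otimes>\<^sub>M S))"
  proof (rule nn_integral_mono)
    fix z
    obtain \<omega> \<omega>' :: "nat \<Rightarrow> nat \<Rightarrow> regime" where z: "z = (\<omega>, \<omega>')" by (cases z)
    have 1: "N n (\<lambda>i. comb_seq m \<omega> \<omega>' (m + i)) = N n \<omega>'" by (simp add: comb_seq_def)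
    have "left_prod d (\<lambda>i. cyc (comb_seq m \<omega> \<omega>' i)) m = left_prod d (\<lambda>i. cyc (\<omega> i)) m"
      by (rule left_prod_cong) (simp add: comb_seq_def)
    then have "N (m + n) (comb_seq m \<omega> \<omega>') \<le> N n \<omega>' * N m \<omega>"
      using norm_prod_add_le[where m=m and n=n and \<omega>="comb_seq m \<omega> \<omega>'"] by (simp add: 1)
    then have "N (m + n) (comb_seq m \<omega> \<omega>') powr s \<le> (N n \<omega>' * N m \<omega>) powr s"
      by (intro powr_mono2 s norm_prod_nonneg)
    also have "\<dots> = N m \<omega> powr s * N n \<omega>' powr s"
      by (subst powr_mult) (auto simp: norm_prod_nonneg mult.commute)
    finally show "ennreal (N (m + n) (case z of (\<omega>, \<omega>') \<Rightarrow> comb_seq m \<omega> \<omega>') powr s)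
      \<le> ennreal (N m (fst z) powr s) * ennreal (N n (snd z) powr s)"
      by (simp add: z ennreal_mult'[symmetric])
  qed
  also have "\<dots> = (\<integral>\<^sup>+\<omega>. \<integral>\<^sup>+\<omega>'. ennreal (N m \<omega> powr s) * ennreal (N n \<omega>' powr s) \<partial>S \<partial>S)"
    by (subst S.nn_integral_fst[symmetric]) simp_all
  also have "\<dots> = ennreal (moment s m) * ennreal (moment s n)"
    by (simp add: nn_integral_cmult nn_integral_multc nn)
  also have "\<dots> = ennreal (moment s m * moment s n)"
    by (simp add: ennreal_mult)
  finally show ?thesis by (simp add: ennreal_le_iff)
qed

text \<open>The integral is restricted to the cylinder where the first \<open>n\<close> cycles lie
  in \<open>D\<close>; by independence its probability is the \<open>n\<close>-th power of that of
  \<open>D\<close>.\<close>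

lemma moment_ge:
  assumes E: "condition_E d lam \<nu>" and s: "0 < s"
    and D: "D \<in> sets (cycle_space d \<nu>)"
    and grow: "\<And>n \<omega>. (\<And>i. i < n \<Longrightarrow> \<omega> i \<in> D) \<Longrightarrow> c * r ^ n \<le> N n \<omega>" and c: "0 < c" "0 < r"
  shows "c powr s * (measure (cycle_space d \<nu>) D * r powr s) ^ n \<le> moment s n"
proof -
  interpret C: prob_space "cycle_space d \<nu>" by (rule prob_space_cycle_space)
  interpret S: prob_space S by (intro prob_space_PiM prob_space_cycle_space)
  let ?G = "prod_emb UNIV (\<lambda>_. cycle_space d \<nu>) {..<n} (\<Pi>\<^sub>E i\<in>{..<n}. D)"
  have G: "?G \<in> sets S" using D by (intro sets_PiM_I) auto
  have "emeasure S ?G = (\<Prod>i<n. emeasure (cycle_space d \<nu>) D)"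
    using D by (intro emeasure_PiM_emb) (auto intro: prob_space_cycle_space)
  then have "measure S ?G = measure (cycle_space d \<nu>) D ^ n"
    by (simp add: S.emeasure_eq_measure C.emeasure_eq_measure ennreal_power)
  have "(c * r ^ n) powr s * measure S ?G = (LINT \<omega>|S. (c * r ^ n) powr s * indicator ?G \<omega>)"
    using G by simp
  also have "\<dots> \<le> moment s n"
  proof (intro integral_mono)
    show "integrable S (\<lambda>\<omega>. (c * r ^ n) powr s * indicator ?G \<omega>)"
      using G by (intro integrable_mult_right integrable_real_indicator) (auto simp: S.emeasure_eq_measure)
    show "integrable S (\<lambda>\<omega>. N n \<omega> powr s)" using s by (intro integrable_norm_prod[OF E]) simp
    fix \<omega>
    show "(c * r ^ n) powr s * indicator ?G \<omega> \<le> N n \<omega> powr s"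
    proof (cases "\<omega> \<in> ?G")
      case True
      then have "c * r ^ n \<le> N n \<omega>" by (intro grow) (auto simp: prod_emb_def PiE_iff)
      then show ?thesis using True c s by (simp add: powr_mono2)
    qed simp
  qed
  finally have "(c * r ^ n) powr s * measure S ?G \<le> moment s n" .
  moreover have "(r ^ n) powr s = (r powr s) ^ n"
    using c by (simp add: powr_realpow[symmetric] powr_powr mult.commute)
  ultimately show ?thesis
    using c \<open>measure S ?G = _\<close> by (simp add: powr_mult power_mult_distrib mult_ac)
qed

lemma s_zero_finite:
  assumes E: "condition_E d lam \<nu>"
    and D: "D \<in> sets (cycle_space d \<nu>)" "0 < measure (cycle_space d \<nu>) D"
    and grow: "\<And>n \<omega>. (\<And>i. i < n \<Longrightarrow> \<omega> i \<in> D) \<Longrightarrow> c * r ^ n \<le> N n \<omega>" and c: "0 < c" "1 < r"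
  shows "s_zero d lam \<nu> < \<infinity>"
proof -
  interpret C: prob_space "cycle_space d \<nu>" by (rule prob_space_cycle_space)
  define p where "p = measure (cycle_space d \<nu>) D"
  have p: "0 < p" "p \<le> 1" using D by (auto simp: p_def)
  \<comment> \<open>Chosen so that \<open>p * r powr s = exp 1\<close>; the rare event is outweighed
    by taking a large moment.\<close>
  define s where "s = (1 - ln p) / ln r"
  have s: "0 < s" using p c by (auto simp: s_def intro!: divide_pos_pos add_pos_nonneg)
      (use ln_le_zero_iff[of p] in linarith)
  have "ln r * s = 1 - ln p" using c by (simp add: s_def)
  then have ps: "p * r powr s = exp 1"
    using p c by (simp add: powr_def mult.commute exp_diff)
  have "p * r powr s \<le> lim (\<lambda>n. moment s n powr (1 / real n))"
  proof (rule submultiplicative_root_limit)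
    show "moment s (m + n) \<le> moment s m * moment s n" for m n
      using s by (intro moment_add_le[OF E]) simp
    show "c powr s * (p * r powr s) ^ n \<le> moment s n" for n
      unfolding p_def by (rule moment_ge[OF E s D(1) grow]) (use c in auto)
    show "0 < c powr s" "0 < p * r powr s" using c p by auto
  qed
  then have "1 < k_fun d lam \<nu> s"
    unfolding k_fun_def ps using exp_gt_one[of 1] by linarith
  then have "s_zero d lam \<nu> \<le> ereal s"
    unfolding s_zero_def using s by (intro Inf_lower) auto
  then show ?thesis using le_less_trans by fastforce
qed

end

text \<open>An almost sure bound passes to a point of the support only up to closure: the point
  cannot lie in the open null set \<open>?U\<close>. The margin \<open>\<epsilon>\<close> is what
  leaves a strict inequality.\<close>

lemma regime_support_stable:
  assumes "condition_E d lam \<nu>" "n \<le> d" "sets (\<nu> n) = sets borel" "r \<in> regime_support d (\<nu> n)"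
  shows "lam n < fst r"
proof -
  obtain \<epsilon> where \<epsilon>: "0 < \<epsilon>" "AE r in \<nu> n. fst r > lam n + \<epsilon>"
    using assms(1,2) by (auto simp: condition_E_def)
  let ?U = "{r :: regime. fst r < lam n + \<epsilon>}"
  have U: "open ?U" by (intro open_Collect_less continuous_intros)
  have "AE r in \<nu> n. r \<notin> ?U" using \<epsilon>(2) by eventually_elim auto
  moreover have "?U \<in> sets (\<nu> n)" using U assms(3) by simp
  moreover have "space (\<nu> n) = UNIV" using sets_eq_imp_space_eq[OF assms(3)] by simp
  ultimately have "emeasure (\<nu> n) ?U = 0"
    using AE_iff_measurable[of ?U "\<nu> n" "\<lambda>r. r \<notin> ?U"] by simp
  then have "r \<notin> ?U" using U assms(4) by (auto simp: regime_support_def)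
  then show ?thesis using \<epsilon>(1) by simp
qed

text \<open>The coefficients are continuous where the denominator does not vanish, and a positive
  coefficient strictly exceeds its own \<open>\<theta>\<close>-fraction.\<close>

lemma nearby_regimes:
  assumes "lam n < fst r" "\<And>k. k < d \<Longrightarrow> 0 < station_coeff d lam n r k" "\<theta> < 1"
  shows "\<exists>U. open U \<and> r \<in> U \<and> (\<forall>r'\<in>U. \<forall>k<d. \<theta> * station_coeff d lam n r k \<le> station_coeff d lam n r' k)"
proof -
  have "\<forall>\<^sub>F r' in nhds r. \<theta> * station_coeff d lam n r k \<le> station_coeff d lam n r' k" if k: "k < d" for k
  proof -
    have id: "((\<lambda>r'. r') \<longlongrightarrow> r) (nhds r)" by (simp add: filterlim_ident)
    have "((\<lambda>r'. snd r' (k + 1)) \<longlongrightarrow> snd r (k + 1)) (nhds r)"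
      by (rule continuous_on_tendsto_compose[OF continuous_on_product_coordinates tendsto_snd[OF id]]) auto
    then have "((\<lambda>r'. station_coeff d lam n r' k) \<longlongrightarrow> station_coeff d lam n r k) (nhds r)"
      unfolding station_coeff_def using assms(1) by (intro tendsto_intros id) auto
    moreover have "\<theta> * station_coeff d lam n r k < station_coeff d lam n r k"
      using assms(2)[OF k] assms(3) by simp
    ultimately have "\<forall>\<^sub>F r' in nhds r. \<theta> * station_coeff d lam n r k < station_coeff d lam n r' k"
      by (rule order_tendstoD(1))
    then show ?thesis by (rule eventually_mono) simp
  qed
  then have "\<forall>\<^sub>F r' in nhds r. \<forall>k\<in>{..<d}. \<theta> * station_coeff d lam n r k \<le> station_coeff d lam n r' k"
    by (intro eventually_ball_finite) auto
  then show ?thesis unfolding eventually_nhds by (simp add: Ball_def)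
qed

theorem corollary1p1:
  fixes d :: nat and lam :: "nat \<Rightarrow> real" and \<nu> :: "nat \<Rightarrow> regime measure"
    and q :: "nat \<Rightarrow> regime" and x\<^sub>0 :: "nat \<Rightarrow> nat"
  assumes "1 \<le> d"
    and "\<forall>n\<le>d. 0 < lam n"
    and "\<forall>n\<le>d. regime_law d (\<nu> n)"
    and "condition_E d lam \<nu>"
    and "\<not> (\<exists>B. AE \<omega> in cycle_space d \<nu>. cycle_matrix d lam \<omega> = B)"
    and "\<forall>n\<le>d. q n \<in> regime_support d (\<nu> n)"
    and "\<not> no_customers d x\<^sub>0"
    and "transient d lam (\<lambda>n. return borel (q n)) x\<^sub>0"
  shows "s_zero d lam \<nu> < \<infinity>"
proof -
  note d = assms(1) and E = assms(4)
  have lam: "0 < lam n" if "n \<le> d" for n using assms(2) that by simp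
  have law: "regime_law d (\<nu> n)" if "n \<le> d" for n using assms(3) that by simp
  have sets: "sets (\<nu> n) = sets borel" and prob: "prob_space (\<nu> n)" if "n \<le> d" for n
    using law[OF that] by (simp_all add: regime_law_def)
  have supp: "q n \<in> regime_support d (\<nu> n)" if "n \<le> d" for n using assms(6) that by simp
  have reg: "q n \<in> regimes d" if "n \<le> d" for n using supp[OF that] by (simp add: regime_support_def)
  have stable: "lam n < fst (q n)" if "n \<le> d" for n
    using E that sets[OF that] supp[OF that] by (rule regime_support_stable)
  have c: "0 < station_coeff d lam n (q n) k" if "n \<le> d" "k < d" for n k
    using lam reg[OF that(1)] stable[OF that(1)] that by (rule station_coeff_pos)
  consider (super) w where "\<And>i. i < d \<Longrightarrow> 0 < w i" "\<And>i. i < d \<Longrightarrow> visit_row d lam q w 0 i \<le> w i"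
    | (growth) w \<rho> where "\<And>i. i < d \<Longrightarrow> 0 < w i" "1 < \<rho>" "\<And>i. i < d \<Longrightarrow> visit_row d lam q w 0 i = \<rho> * w i"
    using supersolution_or_growth[OF c d] by blast
  then show ?thesis
  proof cases
    case super
    have "\<not> transient d lam (\<lambda>n. return borel (q n)) x\<^sub>0"
      using d lam reg stable super assms(7) by (rule not_transient_of_supersolution)
    then show ?thesis using assms(8) by simp
  next
    case growth
    \<comment> \<open>One factor \<open>\<theta>\<close> is lost at each of the \<open>d + 1\<close>
      visits of a cycle. With this choice the growth per cycle is still
      \<open>2 * \<rho> / (1 + \<rho>)\<close>, which exceeds 1.\<close>
    define \<theta> where "\<theta> = (2 / (1 + \<rho>)) powr (1 / real (Suc d))"
    have base: "0 < 2 / (1 + \<rho>)" "2 / (1 + \<rho>) < 1" using growth(2) by simp_all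
    have \<theta>: "0 < \<theta>" "\<theta> < 1"
      using base powr_less_mono2[of "1 / real (Suc d)" "2 / (1 + \<rho>)" 1] by (simp_all add: \<theta>_def)
    have \<theta>d: "\<theta> ^ Suc d = 2 / (1 + \<rho>)"
    proof -
      have "\<theta> ^ Suc d = \<theta> powr real (Suc d)" by (rule powr_realpow[symmetric, OF \<theta>(1)])
      also have "\<dots> = (2 / (1 + \<rho>)) powr (1 / real (Suc d) * real (Suc d))"
        unfolding \<theta>_def by (rule powr_powr)
      also have "1 / real (Suc d) * real (Suc d) = 1" by simp
      finally show ?thesis using base by (simp only: powr_one)
    qed
    have r: "1 < \<theta> ^ Suc d * \<rho>"
      unfolding \<theta>d using growth(2) by (simp add: field_simps)
    let ?near = "\<lambda>n V. open V \<and> q n \<in> V \<and>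
      (\<forall>r'\<in>V. \<forall>k<d. \<theta> * station_coeff d lam n (q n) k \<le> station_coeff d lam n r' k)"
    have "\<exists>V. ?near n V" if n: "n \<le> d" for n
      using stable[OF n] c[OF n] \<theta>(2) by (rule nearby_regimes)
    then have "\<forall>n\<in>{..d}. \<exists>V. ?near n V" by simp
    from bchoice[OF this] obtain U where near: "\<forall>n\<in>{..d}. ?near n (U n)" by blast
    have U: "open (U n)" "q n \<in> U n" if "n \<le> d" for n
      using near that by auto
    have U_le: "\<theta> * station_coeff d lam n (q n) k \<le> station_coeff d lam n r' k"
      if "n \<le> d" "r' \<in> U n" "k < d" for n r' k
      using near that by auto
    \<comment> \<open>The cycles in which the regime drawn at every station is close to that of the
      homogeneous model. They have positive probability because each \<open>q n\<close> lies in the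
      support.\<close>
    define D where "D = Pi\<^sub>E {0..d} U"
    have UM: "U n \<in> sets (\<nu> n)" if "n \<in> {0..d}" for n using U(1)[of n] sets[of n] that by simp
    have D: "D \<in> sets (cycle_space d \<nu>)"
      unfolding D_def cycle_space_def using UM by (intro sets_PiM_I_finite) auto
    have "emeasure (cycle_space d \<nu>) D = (\<Prod>n\<in>{0..d}. emeasure (\<nu> n) (U n))"
      unfolding D_def cycle_space_def
      using emeasure_PiM_emb[of "{0..d}" \<nu> "{0..d}" U] prob UM by (simp add: prod_emb_PiE_same_index sets.sets_into_space)
    moreover have "emeasure (\<nu> n) (U n) \<noteq> 0" if "n \<in> {0..d}" for n
      using supp[of n] U(1,2)[of n] that by (auto simp: regime_support_def)
    ultimately have "emeasure (cycle_space d \<nu>) D \<noteq> 0"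
      by (simp add: prod_zero_iff)
    then have pD: "0 < measure (cycle_space d \<nu>) D"
      using finite_measure.emeasure_eq_measure[OF prob_space.finite_measure[OF prob_space_cycle_space[where d=d and \<nu>=\<nu>]]]
        d law by (simp add: zero_less_measure_iff)
    show ?thesis
    proof (rule s_zero_finite[OF d law E D pD _ _ r])
      show "0 < w 0 / (\<Sum>i<d. w i)"
        using growth(1) d by (intro divide_pos_pos sum_pos) (auto simp: lessThan_empty_iff)
      fix n and \<omega> :: "nat \<Rightarrow> nat \<Rightarrow> regime"
      assume \<omega>: "\<And>i. i < n \<Longrightarrow> \<omega> i \<in> D"
      have near_\<omega>: "\<theta> * station_coeff d lam m (q m) k \<le> station_coeff d lam m (\<omega> i m) k" if "i < n" "m \<le> d" "k < d" for i m k
        using U_le[of m "\<omega> i m" k] \<omega>[OF that(1)] that by (auto simp: D_def PiE_iff)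
      \<comment> \<open>Points of \<open>U n\<close> may lie outside \<open>regimes d\<close>, so
        the sign of their coefficients is taken from the lower bound.\<close>
      have pos: "0 \<le> station_coeff d lam m (\<omega> i m) k" if "i < n" "m \<le> d" "k < d" for i m k
        using near_\<omega>[OF that] c[OF that(2,3)] \<theta>(1) by (meson less_imp_le mult_pos_pos order_trans)
      show "w 0 / (\<Sum>i<d. w i) * (\<theta> ^ Suc d * \<rho>) ^ n \<le> l1_norm_mat (left_prod d (\<lambda>i. cycle_matrix d lam (\<omega> i)) n)"
      proof (rule l1_norm_mat_left_prod_ge[OF cycle_matrix_carrier])
        show "0 \<le> cycle_matrix d lam (\<omega> i) $$ (k, l)" if "i < n" "k < d" "l < d" for i k l
          using pos that by (intro cycle_matrix_nonneg) auto
        show "\<theta> ^ Suc d * \<rho> * w j \<le> row_mul d (cycle_matrix d lam (\<omega> i)) w j" if "i < n" "j < d" for i j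
          using visit_row_perturb[where n=0 and i=j and \<theta>=\<theta> and q=q and q'="\<omega> i" and w=w and lam=lam and d=d]
            near_\<omega>[OF that(1)] c \<theta> growth(1,3) that by (simp add: row_mul_cycle_matrix less_imp_le mult.assoc)
      qed (use growth(1) d r in auto)
    qed
  qed
qed

end
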